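(* Let $\mathbf{X}_1,\dots,\mathbf{X}_n$ be i.i.d. bivariate random vectors with continuous distribution function $F$, continuous marginals and copula $C$. Assume that $C$ is associative, i.e. $C(x,C(y,z))=C(C(x,y),z)$ for all $(x,y,z)\in[0,1]^3$, and that for $p=1,2$ the first order partial derivative $\dot C_p$ of $C$ with respect to the $p$-th coordinate exists and is continuous on $\{\mathbf{u}\in[0,1]^2:0<u_p<1\}$. Let $\mathbb{H}_n(x,y,z)=\sqrt{n}\{C_n(x,C_n(y,z))-C_n(C_n(x,y),z)\}$ with $C_n$ the empirical copula. Then, as $n\to\infty$, $$\int_{[0,1]^3}\{\mathbb{H}_n(x,y,z)\}^2\,d(x,y,z)\ \text{ converges weakly to }\ \int_{[0,1]^3}\{\mathbb{H}_C(x,y,z)\}^2\,d(x,y,z),$$ $$\sup_{(x,y,z)\in[0,1]^3}|\mathbb{H}_n(x,y,z)|\ \text{ converges weakly to }\ \sup_{(x,y,z)\in[0,1]^3}|\mathbb{H}_C(x,y,z)|.$$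
   Context: Empirical copula: $C_n(\mathbf{u})=F_n(F_{n1}^-(u_1),F_{n2}^-(u_2))$, where $F_n(\mathbf{x})=n^{-1}\sum_{i=1}^n\mathbb{I}\{X_{i1}\le x_1,X_{i2}\le x_2\}$, $F_{np}(x)=n^{-1}\sum_{i=1}^n\mathbb{I}\{X_{ip}\le x\}$ ($p=1,2$), and $G^-(u)=\inf\{x\in\mathbb{R}:G(x)\ge u\}$ (so $G^-(0)=-\infty$). $\mathbb{B}_C$ is a centered Gaussian field on $[0,1]^2$ with continuous sample paths and $\mathrm{Cov}(\mathbb{B}_C(\mathbf{x}),\mathbb{B}_C(\mathbf{y}))=C(\mathbf{x}\wedge\mathbf{y})-C(\mathbf{x})C(\mathbf{y})$ (componentwise minimum); $\mathbb{G}_C(\mathbf{x})=\mathbb{B}_C(\mathbf{x})-\dot C_1(\mathbf{x})\mathbb{B}_C(x_1,1)-\dot C_2(\mathbf{x})\mathbb{B}_C(1,x_2)$; and $$\mathbb{H}_C(x,y,z)=\mathbb{G}_C(x,C(y,z))-\mathbb{G}_C(C(x,y),z)+\dot C_2(x,C(y,z))\mathbb{G}_C(y,z)-\dot C_1(C(x,y),z)\mathbb{G}_C(x,y).$$ Convention: $\dot C_p$ is set to $0$ at points with $u_p\in\{0,1\}$ (there it is only multiplied by quantities that vanish almost surely). *)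

theory Defs
  imports "HOL-Probability.Probability"
begin

definition joint_cdf :: "(real \<times> real) measure \<Rightarrow> real \<Rightarrow> real \<Rightarrow> real" where
  "joint_cdf \<mu> x1 x2 = measure \<mu> ({..x1} \<times> {..x2})"

definition copula :: "(real \<Rightarrow> real \<Rightarrow> real) \<Rightarrow> bool" where
  "copula C \<longleftrightarrow>
     (\<forall>u\<in>{0..1}. \<forall>v\<in>{0..1}. C u v \<in> {0..1}) \<and>
     (\<forall>u\<in>{0..1}. C u 0 = 0 \<and> C 0 u = 0 \<and> C u 1 = u \<and> C 1 u = u) \<and>
     (\<forall>u u' v v'. 0 \<le> u \<and> u \<le> u' \<and> u' \<le> 1 \<and> 0 \<le> v \<and> v \<le> v' \<and> v' \<le> 1 \<longrightarrow>
        C u' v' - C u v' - C u' v + C u v \<ge> 0)"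

definition copula_of :: "(real \<times> real) measure \<Rightarrow> (real \<Rightarrow> real \<Rightarrow> real) \<Rightarrow> bool" where
  "copula_of \<mu> C \<longleftrightarrow> copula C \<and>
     (\<forall>x1 x2. joint_cdf \<mu> x1 x2 = C (cdf (distr \<mu> borel fst) x1) (cdf (distr \<mu> borel snd) x2))"

text \<open>The partial derivatives of \<open>C\<close>, set to 0 where the differentiated coordinate is 0 or 1.\<close>

definition dC1 :: "(real \<Rightarrow> real \<Rightarrow> real) \<Rightarrow> real \<Rightarrow> real \<Rightarrow> real" where
  "dC1 C u v = (if 0 < u \<and> u < 1 then deriv (\<lambda>t. C t v) u else 0)"

definition dC2 :: "(real \<Rightarrow> real \<Rightarrow> real) \<Rightarrow> real \<Rightarrow> real \<Rightarrow> real" where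
  "dC2 C u v = (if 0 < v \<and> v < 1 then deriv (\<lambda>t. C u t) v else 0)"

text \<open>
  A sample of size \<open>n\<close> consists of the values \<open>s 0, \<dots>, s (n - 1)\<close>. Generalised inverses are
  \<open>ereal\<close>-valued, because the inverse at 0 is \<open>-\<infinity>\<close>; the bivariate empirical distribution
  function accordingly takes extended real arguments.
\<close>

definition emp_cdf1 :: "nat \<Rightarrow> (nat \<Rightarrow> real) \<Rightarrow> real \<Rightarrow> real" where
  "emp_cdf1 n s x = (\<Sum>i<n. of_bool (s i \<le> x)) / real n"

definition emp_cdf2 :: "nat \<Rightarrow> (nat \<Rightarrow> real \<times> real) \<Rightarrow> ereal \<Rightarrow> ereal \<Rightarrow> real" where
  "emp_cdf2 n s x1 x2 =
     (\<Sum>i<n. of_bool (ereal (fst (s i)) \<le> x1 \<and> ereal (snd (s i)) \<le> x2)) / real n"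

definition gen_inv :: "(real \<Rightarrow> real) \<Rightarrow> real \<Rightarrow> ereal" where
  "gen_inv G u = Inf (ereal ` {x. G x \<ge> u})"

definition emp_copula :: "nat \<Rightarrow> (nat \<Rightarrow> real \<times> real) \<Rightarrow> real \<Rightarrow> real \<Rightarrow> real" where
  "emp_copula n s u v =
     emp_cdf2 n s (gen_inv (emp_cdf1 n (fst \<circ> s)) u) (gen_inv (emp_cdf1 n (snd \<circ> s)) v)"

definition H_emp :: "nat \<Rightarrow> (nat \<Rightarrow> real \<times> real) \<Rightarrow> real \<Rightarrow> real \<Rightarrow> real \<Rightarrow> real" where
  "H_emp n s x y z = sqrt (real n) *
     (emp_copula n s x (emp_copula n s y z) - emp_copula n s (emp_copula n s x y) z)"

text \<open>Normal random variables; the degenerate ones (variance 0) are included.\<close>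

definition normal_rv :: "'b measure \<Rightarrow> ('b \<Rightarrow> real) \<Rightarrow> bool" where
  "normal_rv N Y \<longleftrightarrow> Y \<in> borel_measurable N \<and>
     (\<exists>m. (AE \<omega> in N. Y \<omega> = m) \<or> (\<exists>\<sigma>>0. distributed N lborel Y (normal_density m \<sigma>)))"

text \<open>All finite-dimensional distributions are multivariate normal, that is, all finite linear
  combinations are normal.\<close>

definition gaussian_field :: "'b measure \<Rightarrow> 'i set \<Rightarrow> ('i \<Rightarrow> 'b \<Rightarrow> real) \<Rightarrow> bool" where
  "gaussian_field N T B \<longleftrightarrow>
     (\<forall>I a. finite I \<and> I \<subseteq> T \<longrightarrow> normal_rv N (\<lambda>\<omega>. \<Sum>u\<in>I. a u * B u \<omega>))"

definition cov :: "'b measure \<Rightarrow> ('b \<Rightarrow> real) \<Rightarrow> ('b \<Rightarrow> real) \<Rightarrow> real" where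
  "cov N Y Z = (\<integral>\<omega>. (Y \<omega> - (\<integral>\<omega>. Y \<omega> \<partial>N)) * (Z \<omega> - (\<integral>\<omega>. Z \<omega> \<partial>N)) \<partial>N)"

definition C_bridge ::
    "'b measure \<Rightarrow> (real \<Rightarrow> real \<Rightarrow> real) \<Rightarrow> (real \<times> real \<Rightarrow> 'b \<Rightarrow> real) \<Rightarrow> bool" where
  "C_bridge N C B \<longleftrightarrow>
     gaussian_field N ({0..1} \<times> {0..1}) B \<and>
     (\<forall>u\<in>{0..1} \<times> {0..1}. (\<integral>\<omega>. B u \<omega> \<partial>N) = 0) \<and>
     (\<forall>\<omega>\<in>space N. continuous_on ({0..1} \<times> {0..1}) (\<lambda>u. B u \<omega>)) \<and>
     (\<forall>x1\<in>{0..1}. \<forall>x2\<in>{0..1}. \<forall>y1\<in>{0..1}. \<forall>y2\<in>{0..1}.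
        cov N (B (x1, x2)) (B (y1, y2)) = C (min x1 y1) (min x2 y2) - C x1 x2 * C y1 y2)"

text \<open>In the next two definitions \<open>b\<close> is a sample path of the Gaussian field.\<close>

definition G_lim ::
    "(real \<Rightarrow> real \<Rightarrow> real) \<Rightarrow> (real \<times> real \<Rightarrow> real) \<Rightarrow> real \<Rightarrow> real \<Rightarrow> real" where
  "G_lim C b x1 x2 = b (x1, x2) - dC1 C x1 x2 * b (x1, 1) - dC2 C x1 x2 * b (1, x2)"

definition H_lim ::
    "(real \<Rightarrow> real \<Rightarrow> real) \<Rightarrow> (real \<times> real \<Rightarrow> real) \<Rightarrow> real \<Rightarrow> real \<Rightarrow> real \<Rightarrow> real" where
  "H_lim C b x y z =
     G_lim C b x (C y z) - G_lim C b (C x y) z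
     + dC2 C x (C y z) * G_lim C b y z - dC1 C (C x y) z * G_lim C b x y"

text \<open>The measurability conditions are needed because \<^const>\<open>distr\<close> of a non-measurable function
  is the null measure. The limit may live on another probability space.\<close>

definition converges_weakly ::
    "'a measure \<Rightarrow> (nat \<Rightarrow> 'a \<Rightarrow> real) \<Rightarrow> 'b measure \<Rightarrow> ('b \<Rightarrow> real) \<Rightarrow> bool" where
  "converges_weakly M Y N Z \<longleftrightarrow>
     (\<forall>n. Y n \<in> borel_measurable M) \<and> Z \<in> borel_measurable N \<and>
     weak_conv_m (\<lambda>n. distr M borel (Y n)) (distr N borel Z)"

end

theory Submission
  imports Defs "HOL-Real_Asymp.Real_Asymp"
begin

text \<open>
  Transforming the margins by \<open>F\<^sub>1\<close> and \<open>F\<^sub>2\<close> turns the sample into one with distribution function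
  \<open>C\<close> and, almost surely, does not change ranks, on which alone the empirical copula depends. Let \<open>b\<close> be
  the empirical process \<open>\<surd>n (F\<^sub>n - C)\<close> of the transformed sample.

  Deterministically, if \<open>b\<close> has small oscillation at a fixed scale and vanishes on the edges through
  the origin, at \<open>(1, 1)\<close> and at the rational zeros of \<open>C\<close>, then
  \<open>H_emp n\<close> is uniformly close to the linear functional \<open>H_lim C b\<close>: the mean value theorem linearises the
  increments of \<open>C\<close>, and where the partial derivatives fail to be continuous their cofactors are
  small. For \<open>dC2 C x (C y z)\<close> this concerns the points where \<open>C(y, z)\<close> is near 0 or 1; the zero set of \<open>C\<close>
  carries no mass and there the derivatives vanish because \<open>C\<close> attains its minimum.

  Dyadic chaining with an exponential inequality shows that \<open>b\<close> has small oscillation with high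
  probability. So the functional is well approximated by a continuous function of the values of
  \<open>b\<close> on a finite grid, and weak convergence in a path space is not needed: the univariate
  central limit theorem gives convergence of the expectations of trigonometric polynomials in the grid
  values, and Stone-Weierstrass extends this to bounded continuous functions.
\<close>

section \<open>Ranks and the empirical copula\<close>

text \<open>The obstacle is that the derivatives are continuous only off the edges, while in
  \<open>dC2 C x (C y z)\<close> the edge is pulled back to a level set of \<open>C\<close>; for
  max(y + z - 1, 0) this is a whole triangle. So the cofactor \<open>G_lim C b y z\<close> has to be
  small near every zero of \<open>C\<close>, and this comes from the fact that almost surely no
  observation lies below a zero of \<open>C\<close>. Such properties are used only to compare
  \<open>H_emp\<close> with \<open>H_lim C\<close> of the same empirical path. The rest relies on
  \<open>H_lim C\<close> being linear in the path and, as the derivatives lie in [0, 1], Lipschitz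
  with constant 12 in the supremum norm. Replacing a path by its values on a dyadic grid therefore
  costs at most 12 times its oscillation, for the empirical process and for \<open>B\<close> alike;
  for \<open>B\<close>, continuity of the paths is enough to make this small. Associativity enters
  once, to cancel \<open>C x (C y z)\<close> against \<open>C (C x y) z\<close>, whose difference
  the factor sqrt n would blow up. Both limit statements are instances of one theorem on functionals
  that are uniformly continuous on bounded sets (\<open>cube_functional\<close>).\<close>

lemma le_gen_inv_iff: "ereal x \<le> gen_inv G u \<longleftrightarrow> (\<forall>y. u \<le> G y \<longrightarrow> x \<le> y)"
  unfolding gen_inv_def by (auto simp: le_INF_iff)

definition sample_rank :: "nat \<Rightarrow> (nat \<Rightarrow> real) \<Rightarrow> nat \<Rightarrow> nat" where
  "sample_rank n s i = card {j. j < n \<and> s j < s i}"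

lemma emp_cdf1_card: "emp_cdf1 n s x = card {j. j < n \<and> s j \<le> x} / n"
proof -
  have "{..<n} \<inter> {j. s j \<le> x} = {j. j < n \<and> s j \<le> x}" by auto
  then show ?thesis by (simp add: emp_cdf1_def sum.If_cases of_bool_def)
qed

text \<open>Strictly to the left of \<open>s i\<close> the empirical distribution function reaches
  at most rank / n, so the inverse at \<open>u\<close> stays left of \<open>s i\<close> exactly if
  rank / n is already at least \<open>u\<close>. Ties are allowed, and the infinite values of the
  inverse (\<open>u\<close> \<le> 0 or \<open>u\<close> > 1) are covered.\<close>

lemma le_gen_inv_emp_cdf1_iff:
  assumes "n > 0"
  shows "ereal (s i) \<le> gen_inv (emp_cdf1 n s) u \<longleftrightarrow> real (sample_rank n s i) < n * u"
proof
  assume L: "ereal (s i) \<le> gen_inv (emp_cdf1 n s) u"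
  show "real (sample_rank n s i) < n * u"
  proof (rule ccontr)
    assume "\<not> ?thesis"
    then have c: "n * u \<le> card {j. j < n \<and> s j < s i}" by (simp add: sample_rank_def)
    \<comment> \<open>The largest sample value below \<open>s i\<close>; the entry
      \<open>s i - 1\<close> only keeps the set nonempty when there is none.\<close>
    define y where "y = Max (insert (s i - 1) (s ` {j. j < n \<and> s j < s i}))"
    have "y < s i" unfolding y_def by (subst Max_less_iff) auto
    have "card {j. j < n \<and> s j < s i} \<le> card {j. j < n \<and> s j \<le> y}"
      by (rule card_mono) (auto simp: y_def)
    then have "n * u \<le> real (card {j. j < n \<and> s j \<le> y})" using c by linarith
    then have "u \<le> emp_cdf1 n s y" using assms by (simp add: emp_cdf1_card field_simps)
    with L \<open>y < s i\<close> show False by (auto simp: le_gen_inv_iff dest: spec[of _ y])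
  qed
next
  assume R: "real (sample_rank n s i) < n * u"
  show "ereal (s i) \<le> gen_inv (emp_cdf1 n s) u"
    unfolding le_gen_inv_iff
  proof (intro allI impI, rule ccontr)
    fix y assume y: "u \<le> emp_cdf1 n s y" "\<not> s i \<le> y"
    have "n * u \<le> card {j. j < n \<and> s j \<le> y}"
      using y(1) assms by (simp add: emp_cdf1_card field_simps)
    also have "card {j. j < n \<and> s j \<le> y} \<le> card {j. j < n \<and> s j < s i}"
      by (rule card_mono) (use y(2) in auto)
    finally show False using R by (simp add: sample_rank_def)
  qed
qed

lemma emp_copula_rank:
  assumes "n > 0"
  shows "emp_copula n s u v =
    (\<Sum>i<n. of_bool (real (sample_rank n (fst \<circ> s) i) < n * u \<and>
                   real (sample_rank n (snd \<circ> s) i) < n * v)) / n"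
  using le_gen_inv_emp_cdf1_iff[OF assms, of "fst \<circ> s"] le_gen_inv_emp_cdf1_iff[OF assms, of "snd \<circ> s"]
  by (simp add: emp_copula_def emp_cdf2_def)

text \<open>Serves two purposes: the raw sample can be replaced by the transformed one, and
  \<open>H_emp\<close> takes only finitely many values as a function of the sample, which settles
  measurability.\<close>

lemma emp_copula_cong_order:
  assumes "\<And>i j. i < n \<Longrightarrow> j < n \<Longrightarrow> fst (s i) < fst (s j) \<longleftrightarrow> fst (t i) < fst (t j)"
    and "\<And>i j. i < n \<Longrightarrow> j < n \<Longrightarrow> snd (s i) < snd (s j) \<longleftrightarrow> snd (t i) < snd (t j)"
  shows "emp_copula n s = emp_copula n t"
proof (cases "n = 0")
  case True then show ?thesis by (simp add: emp_copula_def emp_cdf2_def fun_eq_iff)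
next
  case False
  have 1: "sample_rank n (fst \<circ> s) i = sample_rank n (fst \<circ> t) i" if "i < n" for i
    unfolding sample_rank_def using assms(1) that by (intro arg_cong[of _ _ card]) auto
  have 2: "sample_rank n (snd \<circ> s) i = sample_rank n (snd \<circ> t) i" if "i < n" for i
    unfolding sample_rank_def using assms(2) that by (intro arg_cong[of _ _ card]) auto
  show ?thesis using False
    by (auto simp: fun_eq_iff emp_copula_rank 1 2 simp del: sum_of_bool_eq intro!: arg_cong2[of _ _ _ _ "(/)"] sum.cong)
qed

lemma emp_copula_range: "emp_copula n s u v \<in> {0..1}"
proof (cases "n = 0")
  case True then show ?thesis by (simp add: emp_copula_def emp_cdf2_def)
next
  case False
  have "(\<Sum>i<n. of_bool (ereal (fst (s i)) \<le> x \<and> ereal (snd (s i)) \<le> y)) \<le> (\<Sum>i<n. 1::real)" for x y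
    by (intro sum_mono) auto
  then show ?thesis using False
    by (simp add: emp_copula_def emp_cdf2_def sum_nonneg field_simps)
qed

text \<open>The count is the ceiling of n u, hence within 1 of n u.\<close>

lemma abs_card_less_div_diff_le:
  fixes n :: nat and u :: real
  assumes "n > 0" "u \<in> {0..1}"
  shows "\<bar>card {k. k < n \<and> real k < n * u} / n - u\<bar> \<le> 1 / n"
proof -
  have "n * u \<le> n" using assms mult_left_le by fastforce
  then have "{k. k < n \<and> real k < n * u} = {..<nat \<lceil>n * u\<rceil>}"
    by (auto simp: less_ceiling_iff zless_nat_eq_int_zless)
  then have c: "card {k. k < n \<and> real k < n * u} = nat \<lceil>n * u\<rceil>" by simp
  have "0 \<le> n * u" using assms by auto
  then have "real (nat \<lceil>n * u\<rceil>) - n * u \<in> {0..1}"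
    by (simp add: of_nat_nat) linarith
  then have "\<bar>real (nat \<lceil>n * u\<rceil>) - n * u\<bar> \<le> 1" by auto
  moreover have "real (nat \<lceil>n * u\<rceil>) / n - u = (real (nat \<lceil>n * u\<rceil>) - n * u) / n"
    using assms by (simp add: field_simps)
  ultimately show ?thesis unfolding c using assms by (simp add: abs_divide divide_right_mono)
qed

text \<open>The rank is strictly increasing in the sample value, so without ties it is injective; an
  injective self-map of a finite set is onto.\<close>

lemma sample_rank_bij_betw:
  assumes "inj_on s {..<n}"
  shows "bij_betw (sample_rank n s) {..<n} {..<n}"
proof -
  have lt: "sample_rank n s i < sample_rank n s j" if "i < n" "s i < s j" for i j
    unfolding sample_rank_def by (rule psubset_card_mono) (use that in auto)
  have "inj_on (sample_rank n s) {..<n}"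
  proof (rule inj_onI)
    fix i j assume "i \<in> {..<n}" "j \<in> {..<n}" "sample_rank n s i = sample_rank n s j"
    then have "\<not> s i < s j" "\<not> s j < s i" using lt by fastforce+
    then have "s i = s j" by auto
    with assms \<open>i \<in> {..<n}\<close> \<open>j \<in> {..<n}\<close> show "i = j" by (auto dest: inj_onD)
  qed
  moreover have "sample_rank n s ` {..<n} \<subseteq> {..<n}"
  proof clarsimp
    fix i assume "i < n"
    then have "{j. j < n \<and> s j < s i} \<subset> {..<n}" by auto
    then have "card {j. j < n \<and> s j < s i} < card {..<n}" by (intro psubset_card_mono) auto
    then show "sample_rank n s i < n" by (simp add: sample_rank_def)
  qed
  ultimately show ?thesis by (simp add: bij_betw_def endo_inj_surj)
qed

text \<open>Turns the threshold on ranks into a threshold on values: \<alpha> is the largest value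
  selected by \<open>u\<close>, a real substitute in [0, 1] for \<open>gen_inv\<close>. Since the
  ranks are exactly 0 to n - 1, the number of selected values is the ceiling of n u.\<close>

lemma ex_sample_quantile:
  assumes "n > 0" "inj_on s {..<n}" "\<And>i. i < n \<Longrightarrow> 0 < s i \<and> s i \<le> 1" "u \<in> {0..1}"
  shows "\<exists>\<alpha>\<in>{0..1}. (\<forall>i<n. real (sample_rank n s i) < n * u \<longleftrightarrow> s i \<le> \<alpha>) \<and>
    \<bar>card {i. i < n \<and> s i \<le> \<alpha>} / n - u\<bar> \<le> 1 / n"
proof -
  define T where "T = {i. i < n \<and> real (sample_rank n s i) < n * u}"
  have fT: "finite T" by (simp add: T_def)
  \<comment> \<open>The entry 0 replaces the inverse at -\<infinity> when nothing is selected; it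
    selects nothing because all sample values are positive.\<close>
  define \<alpha> where "\<alpha> = Max (insert 0 (s ` T))"
  have \<alpha>2: "\<alpha> \<in> insert 0 (s ` T)"
    unfolding \<alpha>_def by (rule Max_in) (use fT in auto)
  then have \<alpha>: "\<alpha> \<in> {0..1}" "\<alpha> \<in> insert 0 (s ` T)"
    using assms(3) by (auto simp: T_def less_imp_le)
  have iff: "real (sample_rank n s i) < n * u \<longleftrightarrow> s i \<le> \<alpha>" if "i < n" for i
  proof
    assume "real (sample_rank n s i) < n * u"
    with that show "s i \<le> \<alpha>" unfolding \<alpha>_def using fT by (auto simp: T_def)
  next
    assume le: "s i \<le> \<alpha>"
    then have "\<alpha> \<noteq> 0" using assms(3)[OF that] by auto
    with \<alpha>(2) obtain j where j: "j \<in> T" "\<alpha> = s j" by auto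
    have "sample_rank n s i \<le> sample_rank n s j"
      unfolding sample_rank_def by (rule card_mono) (use le j in auto)
    then show "real (sample_rank n s i) < n * u" using j by (auto simp: T_def)
  qed
  have "{i. i < n \<and> s i \<le> \<alpha>} = T" using iff by (auto simp: T_def)
  moreover have "card T = card {k. k < n \<and> real k < n * u}"
  proof (rule bij_betw_same_card)
    show "bij_betw (sample_rank n s) T {k. k < n \<and> real k < n * u}"
      using sample_rank_bij_betw[OF assms(2)] unfolding bij_betw_def T_def
      by (auto simp: inj_on_def image_iff set_eq_iff) (metis lessThan_iff)+
  qed
  ultimately show ?thesis
    using abs_card_less_div_diff_le[OF assms(1,4)] \<alpha>(1) iff by (intro bexI[of _ \<alpha>]) auto
qed

definition edf :: "nat \<Rightarrow> (nat \<Rightarrow> real \<times> real) \<Rightarrow> real \<times> real \<Rightarrow> real" where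
  "edf n s p = (\<Sum>i<n. of_bool (fst (s i) \<le> fst p \<and> snd (s i) \<le> snd p)) / n"

definition eproc :: "(real \<Rightarrow> real \<Rightarrow> real) \<Rightarrow> nat \<Rightarrow> (nat \<Rightarrow> real \<times> real) \<Rightarrow> real \<times> real \<Rightarrow> real" where
  "eproc C n s p = sqrt n * (edf n s p - C (fst p) (snd p))"

text \<open>The interval is open at 0 so that the threshold 0 selects nothing, and closed at 1 so
  that the threshold 1 selects everything and \<open>edf n s (\<alpha>, 1)\<close> is a marginal
  distribution function.\<close>

definition generic_sample :: "nat \<Rightarrow> (nat \<Rightarrow> real \<times> real) \<Rightarrow> bool" where
  "generic_sample n s \<longleftrightarrow> inj_on (fst \<circ> s) {..<n} \<and> inj_on (snd \<circ> s) {..<n} \<and>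
     (\<forall>i<n. 0 < fst (s i) \<and> fst (s i) \<le> 1 \<and> 0 < snd (s i) \<and> snd (s i) \<le> 1)"

text \<open>Here \<alpha> and \<beta> are the marginal sample quantiles. The two bounds up to the
  jump height 1 / n are what later expresses \<alpha> - u and \<beta> - v through the marginal
  values of the empirical process.\<close>

lemma emp_copula_eq_edf:
  assumes "n > 0" "generic_sample n s" "u \<in> {0..1}" "v \<in> {0..1}"
  obtains \<alpha> \<beta> where "\<alpha> \<in> {0..1}" "\<beta> \<in> {0..1}" "emp_copula n s u v = edf n s (\<alpha>, \<beta>)"
    "\<bar>edf n s (\<alpha>, 1) - u\<bar> \<le> 1 / n" "\<bar>edf n s (1, \<beta>) - v\<bar> \<le> 1 / n"
proof -
  obtain \<alpha> where \<alpha>: "\<alpha> \<in> {0..1}"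
      "\<And>i. i < n \<Longrightarrow> real (sample_rank n (fst \<circ> s) i) < n * u \<longleftrightarrow> fst (s i) \<le> \<alpha>"
      "\<bar>card {i. i < n \<and> fst (s i) \<le> \<alpha>} / n - u\<bar> \<le> 1 / n"
    using ex_sample_quantile[of n "fst \<circ> s" u] assms by (auto simp: generic_sample_def)
  obtain \<beta> where \<beta>: "\<beta> \<in> {0..1}"
      "\<And>i. i < n \<Longrightarrow> real (sample_rank n (snd \<circ> s) i) < n * v \<longleftrightarrow> snd (s i) \<le> \<beta>"
      "\<bar>card {i. i < n \<and> snd (s i) \<le> \<beta>} / n - v\<bar> \<le> 1 / n"
    using ex_sample_quantile[of n "snd \<circ> s" v] assms by (auto simp: generic_sample_def)
  have "edf n s (\<alpha>, 1) = card ({..<n} \<inter> {i. fst (s i) \<le> \<alpha> \<and> snd (s i) \<le> 1}) / n"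
    by (simp add: edf_def of_bool_def sum.If_cases)
  also have "{..<n} \<inter> {i. fst (s i) \<le> \<alpha> \<and> snd (s i) \<le> 1} = {i. i < n \<and> fst (s i) \<le> \<alpha>}"
    using assms(2) by (auto simp: generic_sample_def)
  finally have 1: "\<bar>edf n s (\<alpha>, 1) - u\<bar> \<le> 1 / n" using \<alpha>(3) by simp
  have "edf n s (1, \<beta>) = card ({..<n} \<inter> {i. fst (s i) \<le> 1 \<and> snd (s i) \<le> \<beta>}) / n"
    by (simp add: edf_def of_bool_def sum.If_cases)
  also have "{..<n} \<inter> {i. fst (s i) \<le> 1 \<and> snd (s i) \<le> \<beta>} = {i. i < n \<and> snd (s i) \<le> \<beta>}"
    using assms(2) by (auto simp: generic_sample_def)
  finally have 2: "\<bar>edf n s (1, \<beta>) - v\<bar> \<le> 1 / n" using \<beta>(3) by simp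
  have "emp_copula n s u v = edf n s (\<alpha>, \<beta>)"
    using \<alpha>(2) \<beta>(2) by (simp add: emp_copula_rank[OF assms(1)] edf_def)
  then show ?thesis using that \<alpha>(1) \<beta>(1) 1 2 by blast
qed

section \<open>Analysis of copulas\<close>

locale copula_fun =
  fixes C :: "real \<Rightarrow> real \<Rightarrow> real"
  assumes copula: "copula C"
begin

lemma range: "u \<in> {0..1} \<Longrightarrow> v \<in> {0..1} \<Longrightarrow> C u v \<in> {0..1}"
  using copula by (auto simp: copula_def)

lemma boundary [simp]: "u \<in> {0..1} \<Longrightarrow> C u 0 = 0" "u \<in> {0..1} \<Longrightarrow> C 0 u = 0"
    "u \<in> {0..1} \<Longrightarrow> C u 1 = u" "u \<in> {0..1} \<Longrightarrow> C 1 u = u"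
  using copula by (auto simp: copula_def)

lemma two_increasing:
  "0 \<le> u \<Longrightarrow> u \<le> u' \<Longrightarrow> u' \<le> 1 \<Longrightarrow> 0 \<le> v \<Longrightarrow> v \<le> v' \<Longrightarrow> v' \<le> 1 \<Longrightarrow>
    0 \<le> C u' v' - C u v' - C u' v + C u v"
  using copula unfolding copula_def by blast

text \<open>The rectangle inequality on the part of the strip below \<open>v\<close> gives
  monotonicity, and on the part above \<open>v\<close> the Lipschitz bound.\<close>

lemma increment_bounds1:
  assumes "u \<in> {0..1}" "u' \<in> {0..1}" "v \<in> {0..1}" "u \<le> u'"
  shows "0 \<le> C u' v - C u v" "C u' v - C u v \<le> u' - u"
  using two_increasing[of u u' 0 v] two_increasing[of u u' v 1] assms by auto

lemma increment_bounds2: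
  assumes "u \<in> {0..1}" "v \<in> {0..1}" "v' \<in> {0..1}" "v \<le> v'"
  shows "0 \<le> C u v' - C u v" "C u v' - C u v \<le> v' - v"
  using two_increasing[of 0 u v v'] two_increasing[of u 1 v v'] assms by auto

lemma mono: "u \<in> {0..1} \<Longrightarrow> u' \<in> {0..1} \<Longrightarrow> v \<in> {0..1} \<Longrightarrow> v' \<in> {0..1} \<Longrightarrow>
    u \<le> u' \<Longrightarrow> v \<le> v' \<Longrightarrow> C u v \<le> C u' v'"
  using increment_bounds1[of u u' v] increment_bounds2[of u' v v'] by auto

lemma lipschitz1: "u \<in> {0..1} \<Longrightarrow> u' \<in> {0..1} \<Longrightarrow> v \<in> {0..1} \<Longrightarrow> \<bar>C u' v - C u v\<bar> \<le> \<bar>u' - u\<bar>"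
  using increment_bounds1[of u u' v] increment_bounds1[of u' u v] by (cases "u \<le> u'") auto

lemma lipschitz2: "u \<in> {0..1} \<Longrightarrow> v \<in> {0..1} \<Longrightarrow> v' \<in> {0..1} \<Longrightarrow> \<bar>C u v' - C u v\<bar> \<le> \<bar>v' - v\<bar>"
  using increment_bounds2[of u v v'] increment_bounds2[of u v' v] by (cases "v \<le> v'") auto

lemma lipschitz: "u \<in> {0..1} \<Longrightarrow> u' \<in> {0..1} \<Longrightarrow> v \<in> {0..1} \<Longrightarrow> v' \<in> {0..1} \<Longrightarrow>
    \<bar>C u' v' - C u v\<bar> \<le> \<bar>u' - u\<bar> + \<bar>v' - v\<bar>"
  using lipschitz1[of u u' v] lipschitz2[of u' v v'] by linarith

lemma le_min: "u \<in> {0..1} \<Longrightarrow> v \<in> {0..1} \<Longrightarrow> C u v \<le> u" "u \<in> {0..1} \<Longrightarrow> v \<in> {0..1} \<Longrightarrow> C u v \<le> v"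
  using mono[of u u v 1] mono[of u 1 v v] by auto

lemma swap: "copula (\<lambda>u v. C v u)"
  unfolding copula_def
proof (intro conjI allI impI ballI)
  fix u u' v v' :: real assume "0 \<le> u \<and> u \<le> u' \<and> u' \<le> 1 \<and> 0 \<le> v \<and> v \<le> v' \<and> v' \<le> 1"
  then show "C v' u' - C v' u - C v u' + C v u \<ge> 0" using two_increasing[of v v' u u'] by auto
qed (use range in auto)

lemma continuous_on: "continuous_on ({0..1} \<times> {0..1}) (\<lambda>p. C (fst p) (snd p))"
proof (rule continuous_onI)
  fix p :: "real \<times> real" and e :: real assume p: "p \<in> {0..1} \<times> {0..1}" and e: "0 < e"
  show "\<exists>d>0. \<forall>q\<in>{0..1} \<times> {0..1}. dist q p < d \<longrightarrow> dist (C (fst q) (snd q)) (C (fst p) (snd p)) \<le> e"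
  proof (intro exI[of _ "e/2"] conjI ballI impI)
    fix q assume q: "q \<in> {0..1::real} \<times> {0..1::real}" and d: "dist q p < e/2"
    have "\<bar>fst q - fst p\<bar> \<le> e/2" "\<bar>snd q - snd p\<bar> \<le> e/2"
      using d dist_fst_le[of q p] dist_snd_le[of q p] by (auto simp: dist_real_def)
    then show "dist (C (fst q) (snd q)) (C (fst p) (snd p)) \<le> e"
      using lipschitz[of "fst p" "fst q" "snd p" "snd q"] p q by (auto simp: dist_real_def mem_Times_iff)
  qed (use e in auto)
qed

text \<open>The zero set of a copula may have interior points; compactness makes closeness to it uniform.\<close>

lemma zero_set_near:
  assumes "0 < \<tau>"
  obtains \<rho> where "0 < \<rho>" "\<And>y z. y \<in> {0..1} \<Longrightarrow> z \<in> {0..1} \<Longrightarrow> C y z < \<rho> \<Longrightarrow>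
    \<exists>y'\<in>{0..1}. \<exists>z'\<in>{0..1}. \<bar>y' - y\<bar> \<le> \<tau> \<and> \<bar>z' - z\<bar> \<le> \<tau> \<and> C y' z' = 0"
proof -
  define Z where "Z = {p \<in> {0..1} \<times> {0..1}. C (fst p) (snd p) = 0}"
  define S where "S = {p \<in> {0..1} \<times> {0..1}. \<tau> \<le> infdist p Z}"
  have Z: "Z \<noteq> {}" by (auto simp: Z_def intro!: exI[of _ 0])
  have cS: "compact S"
  proof -
    have "S = ({0..1} \<times> {0..1}) \<inter> {p. \<tau> \<le> infdist p Z}" by (auto simp: S_def)
    moreover have "closed {p. \<tau> \<le> infdist p Z}" by (intro closed_Collect_le continuous_intros)
    ultimately show ?thesis by (auto intro!: compact_Int_closed compact_Times)
  qed
  have near: "\<exists>y'\<in>{0..1}. \<exists>z'\<in>{0..1}. \<bar>y' - y\<bar> \<le> \<tau> \<and> \<bar>z' - z\<bar> \<le> \<tau> \<and> C y' z' = 0"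
    if "y \<in> {0..1}" "z \<in> {0..1}" "(y, z) \<notin> S" for y z
  proof -
    have "infdist (y, z) Z < \<tau>" using that by (auto simp: S_def)
    then obtain q where q: "q \<in> Z" "dist (y, z) q < \<tau>"
      using cInf_lessD[of "dist (y, z) ` Z" \<tau>] Z by (auto simp: infdist_def)
    have "\<bar>fst q - y\<bar> \<le> \<tau>" "\<bar>snd q - z\<bar> \<le> \<tau>"
      using q(2) dist_fst_le[of "(y,z)" q] dist_snd_le[of "(y,z)" q] by (auto simp: dist_real_def)
    then show ?thesis using q(1)
      by (intro bexI[of _ "fst q"] bexI[of _ "snd q"]) (auto simp: Z_def)
  qed
  show ?thesis
  proof (cases "S = {}")
    case True then show ?thesis using near by (intro that[of 1]) auto
  next
    case False
    \<comment> \<open>\<open>S\<close> is the compact set of points at distance at least \<tau> from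
      the zero set. The minimum of \<open>C\<close> on it is positive and serves as \<rho>.\<close>
    have "continuous_on S (\<lambda>p. C (fst p) (snd p))"
      by (rule continuous_on_subset[OF continuous_on]) (auto simp: S_def)
    from continuous_attains_inf[OF cS False this] obtain p where
      p: "p \<in> S" "\<And>q. q \<in> S \<Longrightarrow> C (fst p) (snd p) \<le> C (fst q) (snd q)" by auto
    have "C (fst p) (snd p) \<noteq> 0"
    proof
      assume "C (fst p) (snd p) = 0"
      then have "p \<in> Z" using p(1) by (auto simp: S_def Z_def)
      then show False using p(1) assms by (simp add: S_def)
    qed
    moreover have "C (fst p) (snd p) \<in> {0..1}" using p(1) by (intro range) (auto simp: S_def)
    ultimately have "0 < C (fst p) (snd p)" by auto
    then show ?thesis
    proof (rule that)
      fix y z assume "y \<in> {0..1}" "z \<in> {0..1}" "C y z < C (fst p) (snd p)"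
      then show "\<exists>y'\<in>{0..1}. \<exists>z'\<in>{0..1}. \<bar>y' - y\<bar> \<le> \<tau> \<and> \<bar>z' - z\<bar> \<le> \<tau> \<and> C y' z' = 0"
        using p(2)[of "(y, z)"] by (intro near) auto
    qed
  qed
qed

end

text \<open>One coordinate only: the statements for the other derivative come from interpreting the
  same locale for the transposed copula.\<close>

locale copula_d1 = copula_fun +
  assumes diff1: "u \<in> {0<..<1} \<Longrightarrow> v \<in> {0..1} \<Longrightarrow> (\<lambda>t. C t v) differentiable (at u)"
    and cont1: "continuous_on ({0<..<1} \<times> {0..1}) (\<lambda>(u, v). dC1 C u v)"
begin

lemma has_deriv:
  assumes "u \<in> {0<..<1}" "v \<in> {0..1}"
  shows "((\<lambda>t. C t v) has_real_derivative dC1 C u v) (at u)"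
  using diff1[OF assms] assms(1) by (simp add: dC1_def DERIV_deriv_iff_real_differentiable)

text \<open>Difference quotients lie in [0, 1] because \<open>C\<close> is monotone and 1-Lipschitz
  in each argument; at the edges the value is 0 by convention.\<close>

lemma dC1_bounds:
  assumes "u \<in> {0..1}" "v \<in> {0..1}"
  shows "dC1 C u v \<in> {0..1}"
proof (cases "u \<in> {0<..<1}")
  case False then show ?thesis by (auto simp: dC1_def)
next
  case True
  have lim: "((\<lambda>h. (C (u + h) v - C u v) / h) \<longlongrightarrow> dC1 C u v) (at 0)"
    using has_deriv[OF True assms(2)] by (simp add: DERIV_def)
  have "\<forall>\<^sub>F h in at 0. \<bar>h\<bar> < min u (1 - u)"
    using True by (auto simp: eventually_at dist_real_def intro!: exI[of _ "min u (1 - u)"])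
  then have ev: "\<forall>\<^sub>F h in at 0. (C (u + h) v - C u v) / h \<in> {0..1}"
    using eventually_neq_at_within[of 0]
  proof eventually_elim
    case (elim h)
    then have uh: "u + h \<in> {0..1}" by auto
    show ?case
      using increment_bounds1[OF assms(1) uh assms(2)] increment_bounds1[OF uh assms] elim
      by (cases "h > 0") (auto simp: divide_simps)
  qed
  have "0 \<le> dC1 C u v" by (rule tendsto_lowerbound[OF lim]) (use ev in \<open>auto elim: eventually_mono\<close>)
  moreover have "dC1 C u v \<le> 1" by (rule tendsto_upperbound[OF lim]) (use ev in \<open>auto elim: eventually_mono\<close>)
  ultimately show ?thesis by auto
qed

lemma dC1_zero:
  assumes "u \<in> {0..1}" "v \<in> {0..1}" "C u v = 0"
  shows "dC1 C u v = 0"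
proof (cases "u \<in> {0<..<1}")
  case False then show ?thesis by (auto simp: dC1_def)
next
  case True
  show ?thesis
  proof (rule DERIV_local_min[OF has_deriv[OF True assms(2)]])
    show "0 < min u (1 - u)" using True by auto
    show "\<forall>y. \<bar>u - y\<bar> < min u (1 - u) \<longrightarrow> C u v \<le> C y v"
    proof (intro allI impI)
      fix y assume "\<bar>u - y\<bar> < min u (1 - u)"
      then have "y \<in> {0..1}" by auto
      then show "C u v \<le> C y v" using range[of y v] assms by auto
    qed
  qed
qed

text \<open>The mean value theorem asks for differentiability only between the endpoints, so
  \<open>u\<close> and \<open>u'\<close> may lie on the edge even though the derivative need not
  exist there.\<close>

lemma mvt:
  assumes "u \<in> {0..1}" "u' \<in> {0..1}" "v \<in> {0..1}"
  obtains \<xi> where "\<xi> \<in> {0..1}" "\<bar>\<xi> - u\<bar> \<le> \<bar>u' - u\<bar>" "C u' v - C u v = dC1 C \<xi> v * (u' - u)"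
proof -
  have *: "\<exists>\<xi>. a < \<xi> \<and> \<xi> < b \<and> C b v - C a v = dC1 C \<xi> v * (b - a)"
    if ab: "a < b" "a \<in> {0..1}" "b \<in> {0..1}" for a b
  proof -
    have "continuous_on {a..b} (\<lambda>t. C t v)"
    proof (rule continuous_onI)
      fix x e :: real assume x: "x \<in> {a..b}" "0 < e"
      show "\<exists>d>0. \<forall>y\<in>{a..b}. dist y x < d \<longrightarrow> dist (C y v) (C x v) \<le> e"
      proof (intro exI[of _ e] conjI ballI impI)
        fix y assume "y \<in> {a..b}" "dist y x < e"
        then show "dist (C y v) (C x v) \<le> e"
          using lipschitz1[of x y v] x ab assms(3) by (simp add: dist_real_def)
      qed (use x in auto)
    qed
    moreover have "(\<lambda>t. C t v) differentiable (at x)" if "a < x" "x < b" for x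
      using that ab assms(3) by (intro diff1) auto
    ultimately obtain l z where z: "a < z" "z < b" "DERIV (\<lambda>t. C t v) z :> l" "C b v - C a v = (b - a) * l"
      using MVT[OF ab(1)] by blast
    have "z \<in> {0<..<1}" using z ab by auto
    from DERIV_unique[OF z(3) has_deriv[OF this assms(3)]] z show ?thesis by auto
  qed
  consider "u < u'" | "u' < u" | "u = u'" by linarith
  then show ?thesis
  proof cases
    case 1
    with *[of u u'] assms obtain \<xi> where "u < \<xi>" "\<xi> < u'" "C u' v - C u v = dC1 C \<xi> v * (u' - u)" by auto
    then show ?thesis using assms by (intro that[of \<xi>]) auto
  next
    case 2
    with *[of u' u] assms obtain \<xi> where "u' < \<xi>" "\<xi> < u" "C u v - C u' v = dC1 C \<xi> v * (u - u')" by auto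
    then show ?thesis using assms by (intro that[of \<xi>]) (auto simp: algebra_simps)
  next
    case 3 then show ?thesis using assms by (intro that[of u]) auto
  qed
qed

lemma dC1_uniform:
  assumes "0 < \<rho>" "0 < \<epsilon>"
  obtains \<tau> where "0 < \<tau>" "\<And>u u' v v'. \<rho> \<le> u \<Longrightarrow> u \<le> 1 - \<rho> \<Longrightarrow> v \<in> {0..1} \<Longrightarrow> v' \<in> {0..1} \<Longrightarrow>
     \<bar>u' - u\<bar> \<le> \<tau> \<Longrightarrow> \<bar>v' - v\<bar> \<le> \<tau> \<Longrightarrow> \<bar>dC1 C u' v' - dC1 C u v\<bar> \<le> \<epsilon>"
proof -
  let ?K = "{\<rho>/2..1-\<rho>/2} \<times> {0..1::real}"
  have "continuous_on ?K (\<lambda>(u, v). dC1 C u v)"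
    by (rule continuous_on_subset[OF cont1]) (use assms in auto)
  then have "uniformly_continuous_on ?K (\<lambda>(u, v). dC1 C u v)"
    by (intro compact_uniformly_continuous compact_Times) auto
  then obtain d where d: "0 < d" "\<And>p q. p \<in> ?K \<Longrightarrow> q \<in> ?K \<Longrightarrow> dist q p < d \<Longrightarrow>
      dist (case q of (u, v) \<Rightarrow> dC1 C u v) (case p of (u, v) \<Rightarrow> dC1 C u v) < \<epsilon>"
    using assms(2) unfolding uniformly_continuous_on_def by metis
  show ?thesis
  \<comment> \<open>The margin \<rho>/2 keeps \<open>u'\<close> inside the compact set; d/3 in each
    coordinate makes the two displacements add up to less than \<open>d\<close>.\<close>
  proof (rule that[of "min (\<rho>/2) (d/3)"])
    fix u u' v v' assume *: "\<rho> \<le> u" "u \<le> 1 - \<rho>" "v \<in> {0..1}" "v' \<in> {0..1}"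
      "\<bar>u' - u\<bar> \<le> min (\<rho>/2) (d/3)" "\<bar>v' - v\<bar> \<le> min (\<rho>/2) (d/3)"
    have "dist (u', v') (u, v) \<le> dist u' u + dist v' v"
      unfolding dist_Pair_Pair by (rule sqrt_sum_squares_le_sum) auto
    also have "\<dots> < d" using * d(1) by (auto simp: dist_real_def)
    finally have "dist (u', v') (u, v) < d" .
    moreover have "\<bar>u' - u\<bar> \<le> \<rho>/2" using * by simp
    then have "u' - u \<le> \<rho>/2" "u - u' \<le> \<rho>/2" by linarith+
    then have "(u', v') \<in> ?K" "(u, v) \<in> ?K" using *(1-4) assms(1) by auto
    ultimately show "\<bar>dC1 C u' v' - dC1 C u v\<bar> \<le> \<epsilon>"
      using d(2)[of "(u, v)" "(u', v')"] by (simp add: dist_real_def)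
  qed (use assms d in auto)
qed

text \<open>In the applications \<open>s\<close> is sqrt n and \<open>g\<close> approximates the
  scaled displacement \<open>s * (u' - u)\<close>. Where \<open>u\<close> is away from the edges,
  uniform continuity moves the derivative from the mean value point to (u, v) at cost \<epsilon>/L
  times L. Near the edges the derivatives are merely bounded by 1, but there \<open>g\<close> itself
  is at most \<epsilon>, whence the 2 \<epsilon>.\<close>

lemma increment_estimate:
  assumes "0 < \<rho>" "0 < L" "0 < \<epsilon>"
  obtains \<tau> where "0 < \<tau>" "\<And>u u' v v' g s. u \<in> {0..1} \<Longrightarrow> u' \<in> {0..1} \<Longrightarrow> v \<in> {0..1} \<Longrightarrow> v' \<in> {0..1} \<Longrightarrow>
     \<bar>u' - u\<bar> \<le> \<tau> \<Longrightarrow> \<bar>v' - v\<bar> \<le> \<tau> \<Longrightarrow> \<bar>g\<bar> \<le> L \<Longrightarrow> (u < \<rho> \<or> 1 - \<rho> < u \<Longrightarrow> \<bar>g\<bar> \<le> \<epsilon>) \<Longrightarrow>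
     \<bar>s * (C u' v' - C u v') - dC1 C u v * g\<bar> \<le> \<bar>s * (u' - u) - g\<bar> + 2 * \<epsilon>"
proof -
  from dC1_uniform[of \<rho> "\<epsilon> / L"] assms obtain \<tau> where \<tau>: "0 < \<tau>" "\<And>u u' v v'. \<rho> \<le> u \<Longrightarrow> u \<le> 1 - \<rho> \<Longrightarrow> v \<in> {0..1} \<Longrightarrow> v' \<in> {0..1} \<Longrightarrow>
     \<bar>u' - u\<bar> \<le> \<tau> \<Longrightarrow> \<bar>v' - v\<bar> \<le> \<tau> \<Longrightarrow> \<bar>dC1 C u' v' - dC1 C u v\<bar> \<le> \<epsilon> / L"
    by (metis divide_pos_pos)
  show ?thesis
  proof (rule that[OF \<tau>(1)])
    fix u u' v v' g s assume *: "u \<in> {0..1}" "u' \<in> {0..1}" "v \<in> {0..1}" "v' \<in> {0..1}"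
      "\<bar>u' - u\<bar> \<le> \<tau>" "\<bar>v' - v\<bar> \<le> \<tau>" "\<bar>g\<bar> \<le> L" "u < \<rho> \<or> 1 - \<rho> < u \<Longrightarrow> \<bar>g\<bar> \<le> \<epsilon>"
    obtain \<xi> where \<xi>: "\<xi> \<in> {0..1}" "\<bar>\<xi> - u\<bar> \<le> \<bar>u' - u\<bar>" "C u' v' - C u v' = dC1 C \<xi> v' * (u' - u)"
      using mvt[OF *(1,2,4)] by blast
    have eq: "s * (C u' v' - C u v') - dC1 C u v * g =
        dC1 C \<xi> v' * (s * (u' - u) - g) + (dC1 C \<xi> v' - dC1 C u v) * g"
      by (simp add: \<xi>(3) algebra_simps)
    have b: "\<bar>dC1 C \<xi> v'\<bar> \<le> 1" "\<bar>dC1 C u v\<bar> \<le> 1" using dC1_bounds[of \<xi> v'] dC1_bounds[of u v] \<xi> * by auto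
    have 1: "\<bar>dC1 C \<xi> v' * (s * (u' - u) - g)\<bar> \<le> \<bar>s * (u' - u) - g\<bar>"
      unfolding abs_mult using b(1) by (intro mult_left_le_one_le) auto
    have 2: "\<bar>(dC1 C \<xi> v' - dC1 C u v) * g\<bar> \<le> 2 * \<epsilon>"
    proof (cases "u < \<rho> \<or> 1 - \<rho> < u")
      case True
      have "\<bar>(dC1 C \<xi> v' - dC1 C u v) * g\<bar> \<le> 2 * \<epsilon>"
        unfolding abs_mult using *(8)[OF True] b by (intro mult_mono) auto
      then show ?thesis .
    next
      case False
      have "\<bar>(dC1 C \<xi> v' - dC1 C u v) * g\<bar> \<le> \<epsilon> / L * L"
        unfolding abs_mult using \<tau>(2)[of u v v' \<xi>] False * \<xi> assms by (intro mult_mono) auto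
      then show ?thesis using assms by simp
    qed
    show "\<bar>s * (C u' v' - C u v') - dC1 C u v * g\<bar> \<le> \<bar>s * (u' - u) - g\<bar> + 2 * \<epsilon>"
      unfolding eq using 1 2 by linarith
  qed
qed

text \<open>The same case distinction shows that a derivative times its cofactor varies little even
  where the derivative is discontinuous. Smallness near the edge is asked of \<open>g\<close> alone;
  \<open>g'\<close> enters only through \<open>g - g'\<close>.\<close>

lemma product_modulus:
  assumes "0 < \<rho>" "0 < L" "0 < \<epsilon>"
  obtains \<tau> where "0 < \<tau>" "\<And>u u' v v' g g'. u \<in> {0..1} \<Longrightarrow> u' \<in> {0..1} \<Longrightarrow> v \<in> {0..1} \<Longrightarrow> v' \<in> {0..1} \<Longrightarrow>
     \<bar>u' - u\<bar> \<le> \<tau> \<Longrightarrow> \<bar>v' - v\<bar> \<le> \<tau> \<Longrightarrow> \<bar>g\<bar> \<le> L \<Longrightarrow> (u < \<rho> \<or> 1 - \<rho> < u \<Longrightarrow> \<bar>g\<bar> \<le> \<epsilon>) \<Longrightarrow>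
     \<bar>dC1 C u v * g - dC1 C u' v' * g'\<bar> \<le> \<bar>g - g'\<bar> + 2 * \<epsilon>"
proof -
  from dC1_uniform[of \<rho> "\<epsilon> / L"] assms obtain \<tau> where \<tau>: "0 < \<tau>" "\<And>u u' v v'. \<rho> \<le> u \<Longrightarrow> u \<le> 1 - \<rho> \<Longrightarrow> v \<in> {0..1} \<Longrightarrow> v' \<in> {0..1} \<Longrightarrow>
     \<bar>u' - u\<bar> \<le> \<tau> \<Longrightarrow> \<bar>v' - v\<bar> \<le> \<tau> \<Longrightarrow> \<bar>dC1 C u' v' - dC1 C u v\<bar> \<le> \<epsilon> / L"
    by (metis divide_pos_pos)
  show ?thesis
  proof (rule that[OF \<tau>(1)])
    fix u u' v v' g g' assume *: "u \<in> {0..1}" "u' \<in> {0..1}" "v \<in> {0..1}" "v' \<in> {0..1}"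
      "\<bar>u' - u\<bar> \<le> \<tau>" "\<bar>v' - v\<bar> \<le> \<tau>" "\<bar>g\<bar> \<le> L" "u < \<rho> \<or> 1 - \<rho> < u \<Longrightarrow> \<bar>g\<bar> \<le> \<epsilon>"
    \<comment> \<open>Arranged so that the difference of the derivatives multiplies
      \<open>g\<close>, the factor controlled near the edge, while \<open>g - g'\<close> gets a
      factor bounded by 1.\<close>
    have eq: "dC1 C u v * g - dC1 C u' v' * g' = dC1 C u' v' * (g - g') - (dC1 C u' v' - dC1 C u v) * g"
      by (simp add: algebra_simps)
    have b: "\<bar>dC1 C u' v'\<bar> \<le> 1" "\<bar>dC1 C u v\<bar> \<le> 1" using dC1_bounds[of u' v'] dC1_bounds[of u v] * by auto
    have 1: "\<bar>dC1 C u' v' * (g - g')\<bar> \<le> \<bar>g - g'\<bar>"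
      unfolding abs_mult using b(1) by (intro mult_left_le_one_le) auto
    have 2: "\<bar>(dC1 C u' v' - dC1 C u v) * g\<bar> \<le> 2 * \<epsilon>"
    proof (cases "u < \<rho> \<or> 1 - \<rho> < u")
      case True
      have "\<bar>(dC1 C u' v' - dC1 C u v) * g\<bar> \<le> 2 * \<epsilon>"
        unfolding abs_mult using *(8)[OF True] b by (intro mult_mono) auto
      then show ?thesis .
    next
      case False
      have "\<bar>(dC1 C u' v' - dC1 C u v) * g\<bar> \<le> \<epsilon> / L * L"
        unfolding abs_mult using \<tau>(2)[of u v v' u'] False * assms by (intro mult_mono) auto
      then show ?thesis using assms by simp
    qed
    show "\<bar>dC1 C u v * g - dC1 C u' v' * g'\<bar> \<le> \<bar>g - g'\<bar> + 2 * \<epsilon>"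
      unfolding eq using 1 2 by linarith
  qed
qed

end

section \<open>Linearisation of the associativity process\<close>

text \<open>A single scale \<delta> with a single bound \<eta> instead of a modulus of continuity:
  the empirical path jumps, so for fixed n its oscillation does not tend to 0 with \<delta>.\<close>

definition osc_le :: "real \<Rightarrow> real \<Rightarrow> (real \<times> real \<Rightarrow> real) \<Rightarrow> bool" where
  "osc_le \<delta> \<eta> b \<longleftrightarrow> (\<forall>u\<in>{0..1}. \<forall>u'\<in>{0..1}. \<forall>v\<in>{0..1}. \<forall>v'\<in>{0..1}.
     \<bar>u' - u\<bar> \<le> \<delta> \<longrightarrow> \<bar>v' - v\<bar> \<le> \<delta> \<longrightarrow> \<bar>b (u', v') - b (u, v)\<bar> \<le> \<eta>)"

text \<open>Only rational zeros are listed so that countably many null sets suffice;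
  \<open>tied_down_zero_set\<close> reaches the remaining zeros at the price of one
  oscillation.\<close>

definition tied_down :: "(real \<Rightarrow> real \<Rightarrow> real) \<Rightarrow> (real \<times> real \<Rightarrow> real) \<Rightarrow> bool" where
  "tied_down C b \<longleftrightarrow> (\<forall>t\<in>{0..1}. b (0, t) = 0 \<and> b (t, 0) = 0) \<and> b (1, 1) = 0 \<and>
     (\<forall>u\<in>{0..1} \<inter> \<rat>. \<forall>v\<in>{0..1} \<inter> \<rat>. C u v = 0 \<longrightarrow> b (u, v) = 0)"

definition bounded_path :: "real \<Rightarrow> (real \<times> real \<Rightarrow> real) \<Rightarrow> bool" where
  "bounded_path L b \<longleftrightarrow> (\<forall>u\<in>{0..1}. \<forall>v\<in>{0..1}. \<bar>b (u, v)\<bar> \<le> L)"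

lemma osc_leD: "osc_le \<delta> \<eta> b \<Longrightarrow> u \<in> {0..1} \<Longrightarrow> u' \<in> {0..1} \<Longrightarrow> v \<in> {0..1} \<Longrightarrow> v' \<in> {0..1} \<Longrightarrow>
   \<bar>u' - u\<bar> \<le> \<delta> \<Longrightarrow> \<bar>v' - v\<bar> \<le> \<delta> \<Longrightarrow> \<bar>b (u', v') - b (u, v)\<bar> \<le> \<eta>"
  by (auto simp: osc_le_def)

text \<open>The segment from the origin, where the path vanishes, to (u, v) is walked in
  \<open>m\<close> equal steps, each changing the path by at most \<eta>.\<close>

lemma osc_le_bounded_path:
  assumes osc: "osc_le \<delta> \<eta> b" and "b (0, 0) = 0" and m: "0 < m" "1 / real m \<le> \<delta>"
  shows "bounded_path (m * \<eta>) b"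
  unfolding bounded_path_def
proof (intro ballI)
  fix u v :: real assume uv: "u \<in> {0..1}" "v \<in> {0..1}"
  have "\<bar>b (k / m * u, k / m * v)\<bar> \<le> k * \<eta>" if "k \<le> m" for k :: nat
    using that
  proof (induction k)
    case 0 then show ?case using assms(2) by simp
  next
    case (Suc k)
    have in01: "j / m * t \<in> {0..1}" if "j \<le> m" "t \<in> {0..1}" for j :: nat and t :: real
    proof -
      have "real j / m \<le> 1" using that m by simp
      then have "j / m * t \<le> 1 * 1" using that by (intro mult_mono) auto
      then show ?thesis using that by auto
    qed
    have step: "\<bar>Suc k / m * t - k / m * t\<bar> \<le> \<delta>" if "t \<in> {0..1}" for t :: real
    proof -
      have "Suc k / m * t - k / m * t = 1 / m * t" by (simp add: add_divide_distrib algebra_simps)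
      then have "\<bar>Suc k / m * t - k / m * t\<bar> = 1 / m * t" using that by simp
      also have "\<dots> \<le> 1 / m * 1" using that by (intro mult_left_mono) auto
      finally show ?thesis using m by simp
    qed
    have "\<bar>b (Suc k / m * u, Suc k / m * v) - b (k / m * u, k / m * v)\<bar> \<le> \<eta>"
      using Suc.prems uv by (intro osc_leD[OF osc] in01 step) auto
    then show ?case using Suc by (auto simp: algebra_simps)
  qed
  from this[of m] m show "\<bar>b (u, v)\<bar> \<le> m * \<eta>" by simp
qed

locale smooth_copula = copula_d1 C + flip: copula_d1 "\<lambda>u v. C v u" for C
begin

lemma dC2_eq: "dC2 C u v = dC1 (\<lambda>u v. C v u) v u"
  by (simp add: dC1_def dC2_def)

lemma dC2_bounds: "u \<in> {0..1} \<Longrightarrow> v \<in> {0..1} \<Longrightarrow> dC2 C u v \<in> {0..1}"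
  unfolding dC2_eq by (rule flip.dC1_bounds)

lemma dC2_zero: "u \<in> {0..1} \<Longrightarrow> v \<in> {0..1} \<Longrightarrow> C u v = 0 \<Longrightarrow> dC2 C u v = 0"
  unfolding dC2_eq by (rule flip.dC1_zero)

text \<open>The marginal paths vanish at both of their endpoints. This supplies the smallness near
  the edge in \<open>increment_estimate\<close> and \<open>product_modulus\<close>, with \<rho> =
  \<delta>.\<close>

lemma tied_down_small:
  assumes "osc_le \<delta> \<eta> b" "tied_down C b" "t \<in> {0..1}" "t < \<delta> \<or> 1 - \<delta> < t"
  shows "\<bar>b (t, 1)\<bar> \<le> \<eta>" "\<bar>b (1, t)\<bar> \<le> \<eta>"
proof -
  have \<delta>: "0 < \<delta>" using assms(3,4) by auto
  from assms(4) have "\<bar>b (t, 1)\<bar> \<le> \<eta> \<and> \<bar>b (1, t)\<bar> \<le> \<eta>"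
  proof
    assume "t < \<delta>"
    with \<delta> osc_leD[OF assms(1), of 0 t 1 1] osc_leD[OF assms(1), of 1 1 0 t] assms(2,3) show ?thesis
      by (auto simp: tied_down_def)
  next
    assume "1 - \<delta> < t"
    with \<delta> osc_leD[OF assms(1), of 1 t 1 1] osc_leD[OF assms(1), of 1 1 1 t] assms(2,3) show ?thesis
      by (auto simp: tied_down_def)
  qed
  then show "\<bar>b (t, 1)\<bar> \<le> \<eta>" "\<bar>b (1, t)\<bar> \<le> \<eta>" by auto
qed

lemma G_lim_abs_le:
  assumes "bounded_path L b" "u \<in> {0..1}" "v \<in> {0..1}"
  shows "\<bar>G_lim C b u v\<bar> \<le> 3 * L"
proof -
  have "\<bar>dC1 C u v * b (u, 1)\<bar> \<le> \<bar>b (u, 1)\<bar>" "\<bar>dC2 C u v * b (1, v)\<bar> \<le> \<bar>b (1, v)\<bar>"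
    unfolding abs_mult using dC1_bounds[OF assms(2,3)] dC2_bounds[OF assms(2,3)]
    by (auto intro!: mult_left_le_one_le)
  moreover have "\<bar>b (u, v)\<bar> \<le> L" "\<bar>b (u, 1)\<bar> \<le> L" "\<bar>b (1, v)\<bar> \<le> L"
    using assms by (auto simp: bounded_path_def)
  ultimately show ?thesis unfolding G_lim_def by linarith
qed

text \<open>Four terms \<open>G_lim\<close>, each at most 3 L. Combined with
  \<open>H_lim_diff\<close> this is the Lipschitz bound in the path by which discretisation errors
  are estimated.\<close>

lemma H_lim_abs_le:
  assumes "bounded_path L b" "x \<in> {0..1}" "y \<in> {0..1}" "z \<in> {0..1}"
  shows "\<bar>H_lim C b x y z\<bar> \<le> 12 * L"
proof -
  have c: "C y z \<in> {0..1}" "C x y \<in> {0..1}" using range assms by auto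
  have "\<bar>dC2 C x (C y z) * G_lim C b y z\<bar> \<le> \<bar>G_lim C b y z\<bar>"
       "\<bar>dC1 C (C x y) z * G_lim C b x y\<bar> \<le> \<bar>G_lim C b x y\<bar>"
    unfolding abs_mult using dC1_bounds[OF c(2) assms(4)] dC2_bounds[OF assms(2) c(1)]
    by (auto intro!: mult_left_le_one_le)
  then show ?thesis unfolding H_lim_def
    using G_lim_abs_le[OF assms(1,2) c(1)] G_lim_abs_le[OF assms(1) c(2) assms(4)]
      G_lim_abs_le[OF assms(1,3,4)] G_lim_abs_le[OF assms(1,2,3)] by linarith
qed

lemma G_lim_diff: "G_lim C b u v - G_lim C b' u v = G_lim C (\<lambda>p. b p - b' p) u v"
  by (simp add: G_lim_def algebra_simps)

lemma H_lim_diff: "H_lim C b x y z - H_lim C b' x y z = H_lim C (\<lambda>p. b p - b' p) x y z"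
  by (simp add: H_lim_def G_lim_diff[symmetric] algebra_simps)

text \<open>The scale \<tau> does not depend on the path. The constant is 1 for the value of the
  path and 1 + 2 for each of the two products.\<close>

lemma G_lim_modulus:
  assumes "0 < \<eta>" "0 < \<delta>" "0 < L"
  obtains \<tau> where "0 < \<tau>" "\<And>b u u' v v'. osc_le \<delta> \<eta> b \<Longrightarrow> tied_down C b \<Longrightarrow> bounded_path L b \<Longrightarrow>
     u \<in> {0..1} \<Longrightarrow> u' \<in> {0..1} \<Longrightarrow> v \<in> {0..1} \<Longrightarrow> v' \<in> {0..1} \<Longrightarrow> \<bar>u' - u\<bar> \<le> \<tau> \<Longrightarrow> \<bar>v' - v\<bar> \<le> \<tau> \<Longrightarrow>
     \<bar>G_lim C b u v - G_lim C b u' v'\<bar> \<le> 7 * \<eta>"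
proof -
  obtain \<tau>1 where t1: "0 < \<tau>1" "\<And>u u' v v' g g'. u \<in> {0..1} \<Longrightarrow> u' \<in> {0..1} \<Longrightarrow> v \<in> {0..1} \<Longrightarrow> v' \<in> {0..1} \<Longrightarrow>
     \<bar>u' - u\<bar> \<le> \<tau>1 \<Longrightarrow> \<bar>v' - v\<bar> \<le> \<tau>1 \<Longrightarrow> \<bar>g\<bar> \<le> L \<Longrightarrow> (u < \<delta> \<or> 1 - \<delta> < u \<Longrightarrow> \<bar>g\<bar> \<le> \<eta>) \<Longrightarrow>
     \<bar>dC1 C u v * g - dC1 C u' v' * g'\<bar> \<le> \<bar>g - g'\<bar> + 2 * \<eta>"
    by (rule product_modulus[OF assms(2,3,1)]) blast
  obtain \<tau>2 where t2: "0 < \<tau>2" "\<And>u u' v v' g g'. u \<in> {0..1} \<Longrightarrow> u' \<in> {0..1} \<Longrightarrow> v \<in> {0..1} \<Longrightarrow> v' \<in> {0..1} \<Longrightarrow>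
     \<bar>u' - u\<bar> \<le> \<tau>2 \<Longrightarrow> \<bar>v' - v\<bar> \<le> \<tau>2 \<Longrightarrow> \<bar>g\<bar> \<le> L \<Longrightarrow> (u < \<delta> \<or> 1 - \<delta> < u \<Longrightarrow> \<bar>g\<bar> \<le> \<eta>) \<Longrightarrow>
     \<bar>dC2 C v u * g - dC2 C v' u' * g'\<bar> \<le> \<bar>g - g'\<bar> + 2 * \<eta>"
    unfolding dC2_eq by (rule flip.product_modulus[OF assms(2,3,1)]) blast
  show ?thesis
  proof (rule that[of "min \<delta> (min \<tau>1 \<tau>2)"])
    fix b u u' v v' assume b: "osc_le \<delta> \<eta> b" "tied_down C b" "bounded_path L b" and
      *: "u \<in> {0..1}" "u' \<in> {0..1}" "v \<in> {0..1}" "v' \<in> {0..1}"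
         "\<bar>u' - u\<bar> \<le> min \<delta> (min \<tau>1 \<tau>2)" "\<bar>v' - v\<bar> \<le> min \<delta> (min \<tau>1 \<tau>2)"
    have L: "\<bar>b (u, 1)\<bar> \<le> L" "\<bar>b (1, v)\<bar> \<le> L" using b(3) * by (auto simp: bounded_path_def)
    have o: "\<bar>b (u', v') - b (u, v)\<bar> \<le> \<eta>" "\<bar>b (u', 1) - b (u, 1)\<bar> \<le> \<eta>" "\<bar>b (1, v') - b (1, v)\<bar> \<le> \<eta>"
      using * assms by (auto intro!: osc_leD[OF b(1)])
    have "\<bar>dC1 C u v * b (u, 1) - dC1 C u' v' * b (u', 1)\<bar> \<le> \<bar>b (u, 1) - b (u', 1)\<bar> + 2 * \<eta>"
      using * L tied_down_small[OF b(1,2)] by (intro t1) auto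
    moreover have "\<bar>dC2 C u v * b (1, v) - dC2 C u' v' * b (1, v')\<bar> \<le> \<bar>b (1, v) - b (1, v')\<bar> + 2 * \<eta>"
      using * L tied_down_small[OF b(1,2)] by (intro t2) auto
    ultimately show "\<bar>G_lim C b u v - G_lim C b u' v'\<bar> \<le> 7 * \<eta>"
      unfolding G_lim_def using o by linarith
  qed (use assms t1 t2 in auto)
qed

text \<open>By monotonicity \<open>C\<close> also vanishes at every point to the lower left of a
  zero. A rational point of this kind lies within \<delta>, and there the path is exactly 0.\<close>

lemma tied_down_zero_set:
  assumes b: "osc_le \<delta> \<eta> b" "tied_down C b" and "0 < \<delta>" "0 < \<eta>"
    and uv: "u \<in> {0..1}" "v \<in> {0..1}" "C u v = 0"
  shows "\<bar>b (u, v)\<bar> \<le> \<eta>"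
proof (cases "u = 0 \<or> v = 0")
  case True then show ?thesis using assms by (auto simp: tied_down_def)
next
  case False
  have ex: "\<exists>r\<in>{0..1} \<inter> \<rat>. r \<le> t \<and> \<bar>t - r\<bar> \<le> \<delta>" if t: "t \<in> {0..1}" "t \<noteq> 0" for t :: real
  proof -
    obtain r where "r \<in> \<rat>" "max 0 (t - \<delta>) < r" "r < t"
      using Rats_dense_in_real[of "max 0 (t - \<delta>)" t] t \<open>0 < \<delta>\<close> by auto
    then show ?thesis using t by (intro bexI[of _ r]) auto
  qed
  from ex[OF uv(1)] False obtain u' where u': "u' \<in> {0..1} \<inter> \<rat>" "u' \<le> u" "\<bar>u - u'\<bar> \<le> \<delta>" by auto
  from ex[OF uv(2)] False obtain v' where v': "v' \<in> {0..1} \<inter> \<rat>" "v' \<le> v" "\<bar>v - v'\<bar> \<le> \<delta>" by auto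
  have "C u' v' = 0" using mono[of u' u v' v] range[of u' v'] u' v' uv by auto
  then have "b (u', v') = 0" using b(2) u' v' unfolding tied_down_def by blast
  then show ?thesis using osc_leD[OF b(1), of u' u v' v] u' v' uv by auto
qed

text \<open>Where \<open>C\<close> is small a zero of \<open>C\<close> is close; there both
  derivatives vanish and \<open>G_lim\<close> reduces to the path, which is at most \<eta>, so that
  8 = 7 + 1. Where \<open>C y z\<close> is near 1, both \<open>y\<close> and \<open>z\<close> are,
  because \<open>C\<close> lies below the minimum, and \<open>G_lim\<close> vanishes at (1, 1). This
  is the smallness that the discontinuous outer derivative in \<open>H_lim\<close> requires of its
  cofactor.\<close>

lemma G_lim_small:
  assumes "0 < \<eta>" "0 < \<delta>" "0 < L"
  obtains \<rho> where "0 < \<rho>" "\<And>b y z. osc_le \<delta> \<eta> b \<Longrightarrow> tied_down C b \<Longrightarrow> bounded_path L b \<Longrightarrow>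
     y \<in> {0..1} \<Longrightarrow> z \<in> {0..1} \<Longrightarrow> C y z < \<rho> \<or> 1 - \<rho> < C y z \<Longrightarrow> \<bar>G_lim C b y z\<bar> \<le> 8 * \<eta>"
proof -
  obtain \<tau> where \<tau>: "0 < \<tau>" "\<And>b u u' v v'. osc_le \<delta> \<eta> b \<Longrightarrow> tied_down C b \<Longrightarrow> bounded_path L b \<Longrightarrow>
     u \<in> {0..1} \<Longrightarrow> u' \<in> {0..1} \<Longrightarrow> v \<in> {0..1} \<Longrightarrow> v' \<in> {0..1} \<Longrightarrow> \<bar>u' - u\<bar> \<le> \<tau> \<Longrightarrow> \<bar>v' - v\<bar> \<le> \<tau> \<Longrightarrow>
     \<bar>G_lim C b u v - G_lim C b u' v'\<bar> \<le> 7 * \<eta>"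
    by (rule G_lim_modulus[OF assms]) blast
  obtain \<rho> where \<rho>: "0 < \<rho>" "\<And>y z. y \<in> {0..1} \<Longrightarrow> z \<in> {0..1} \<Longrightarrow> C y z < \<rho> \<Longrightarrow>
    \<exists>y'\<in>{0..1}. \<exists>z'\<in>{0..1}. \<bar>y' - y\<bar> \<le> \<tau> \<and> \<bar>z' - z\<bar> \<le> \<tau> \<and> C y' z' = 0"
    by (rule zero_set_near[OF \<tau>(1)]) blast
  show ?thesis
  proof (rule that[of "min \<rho> \<tau>"])
    fix b y z assume b: "osc_le \<delta> \<eta> b" "tied_down C b" "bounded_path L b" and
      yz: "y \<in> {0..1}" "z \<in> {0..1}" "C y z < min \<rho> \<tau> \<or> 1 - min \<rho> \<tau> < C y z"
    from yz(3) show "\<bar>G_lim C b y z\<bar> \<le> 8 * \<eta>"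
    proof
      assume "C y z < min \<rho> \<tau>"
      then obtain y' z' where *: "y' \<in> {0..1}" "z' \<in> {0..1}" "\<bar>y' - y\<bar> \<le> \<tau>" "\<bar>z' - z\<bar> \<le> \<tau>" "C y' z' = 0"
        using \<rho>(2)[OF yz(1,2)] by auto
      have "G_lim C b y' z' = b (y', z')"
        using dC1_zero[OF *(1,2,5)] dC2_zero[OF *(1,2,5)] by (simp add: G_lim_def)
      with tied_down_zero_set[OF b(1,2) assms(2,1) *(1,2,5)] \<tau>(2)[OF b yz(1) *(1) yz(2) *(2,3,4)]
      show ?thesis by auto
    next
      assume "1 - min \<rho> \<tau> < C y z"
      then have "\<bar>1 - y\<bar> \<le> \<tau>" "\<bar>1 - z\<bar> \<le> \<tau>" using le_min[OF yz(1,2)] yz by auto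
      from \<tau>(2)[OF b yz(1) _ yz(2) _ this]
      have "\<bar>G_lim C b y z - G_lim C b 1 1\<bar> \<le> 7 * \<eta>" by auto
      moreover have "G_lim C b 1 1 = 0" using b(2) by (simp add: G_lim_def tied_down_def)
      ultimately show ?thesis using assms by auto
    qed
  qed (use \<rho> \<tau> in auto)
qed

lemma eventually_le_div_sqrt:
  assumes "0 < (c::real)"
  shows "\<forall>\<^sub>F n in sequentially. K / sqrt n \<le> c"
proof -
  have "(\<lambda>n. K / sqrt (real n)) \<longlonglongrightarrow> 0" by real_asymp
  from order_tendstoD(2)[OF this assms] show ?thesis by (auto elim: eventually_mono)
qed

text \<open>The empirical copula is \<open>edf\<close> at the quantiles (\<alpha>, \<beta>), so the
  scaled error is the path there plus sqrt n times an increment of \<open>C\<close>. The latter is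
  linearised one coordinate at a time; \<alpha> - u is close to -b(u, 1) / sqrt n since
  \<open>edf\<close> at (\<alpha>, 1) is \<open>u\<close> up to 1 / n. The constant is 1 + 4 + 4,
  and the threshold for n is uniform over all admissible samples.\<close>

lemma emp_copula_asymp:
  assumes "0 < \<eta>" "0 < \<delta>" "0 < L"
  shows "\<forall>\<^sub>F n in sequentially. \<forall>s u v. generic_sample n s \<longrightarrow> osc_le \<delta> \<eta> (eproc C n s) \<longrightarrow>
     tied_down C (eproc C n s) \<longrightarrow> bounded_path L (eproc C n s) \<longrightarrow> u \<in> {0..1} \<longrightarrow> v \<in> {0..1} \<longrightarrow>
     \<bar>sqrt n * (emp_copula n s u v - C u v) - G_lim C (eproc C n s) u v\<bar> \<le> 9 * \<eta>"
proof -
  obtain \<tau>1 where t1: "0 < \<tau>1" "\<And>u u' v v' g s. u \<in> {0..1} \<Longrightarrow> u' \<in> {0..1} \<Longrightarrow> v \<in> {0..1} \<Longrightarrow> v' \<in> {0..1} \<Longrightarrow>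
     \<bar>u' - u\<bar> \<le> \<tau>1 \<Longrightarrow> \<bar>v' - v\<bar> \<le> \<tau>1 \<Longrightarrow> \<bar>g\<bar> \<le> L \<Longrightarrow> (u < \<delta> \<or> 1 - \<delta> < u \<Longrightarrow> \<bar>g\<bar> \<le> \<eta>) \<Longrightarrow>
     \<bar>s * (C u' v' - C u v') - dC1 C u v * g\<bar> \<le> \<bar>s * (u' - u) - g\<bar> + 2 * \<eta>"
    by (rule increment_estimate[OF assms(2,3,1)]) blast
  obtain \<tau>2 where t2: "0 < \<tau>2" "\<And>u u' v v' g s. u \<in> {0..1} \<Longrightarrow> u' \<in> {0..1} \<Longrightarrow> v \<in> {0..1} \<Longrightarrow> v' \<in> {0..1} \<Longrightarrow>
     \<bar>u' - u\<bar> \<le> \<tau>2 \<Longrightarrow> \<bar>v' - v\<bar> \<le> \<tau>2 \<Longrightarrow> \<bar>g\<bar> \<le> L \<Longrightarrow> (u < \<delta> \<or> 1 - \<delta> < u \<Longrightarrow> \<bar>g\<bar> \<le> \<eta>) \<Longrightarrow>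
     \<bar>s * (C v' u' - C v' u) - dC2 C v u * g\<bar> \<le> \<bar>s * (u' - u) - g\<bar> + 2 * \<eta>"
    unfolding dC2_eq by (rule flip.increment_estimate[OF assms(2,3,1)]) blast
  define \<tau> where "\<tau> = min \<delta> (min \<tau>1 \<tau>2)"
  have "0 < \<tau>" using assms t1 t2 by (auto simp: \<tau>_def)
  show ?thesis
    using eventually_le_div_sqrt[OF \<open>0 < \<tau>\<close>, of "L + 1"] eventually_le_div_sqrt[OF assms(1), of 1]
      eventually_gt_at_top[of 0]
  proof (eventually_elim, intro allI impI)
    fix n s and u v :: real
    assume n: "(L + 1) / sqrt (real n) \<le> \<tau>" "1 / sqrt (real n) \<le> \<eta>" "0 < n"
      and s: "generic_sample n s" and b': "osc_le \<delta> \<eta> (eproc C n s)"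
        "tied_down C (eproc C n s)" "bounded_path L (eproc C n s)"
      and uv: "u \<in> {0..1}" "v \<in> {0..1}"
    define b where "b = eproc C n s"
    note b = b'[folded b_def]
    define r where "r = sqrt (real n)"
    have r: "1 \<le> r" "r * r = n" using n(3) by (auto simp: r_def)
    have n1: "r * (1 / n) = 1 / r" "1 / r \<le> \<eta>" "(L + 1) / r \<le> \<tau>" using r n by (auto simp: field_simps r_def[symmetric] simp flip: r(2))
    obtain \<alpha> \<beta> where ab: "\<alpha> \<in> {0..1}" "\<beta> \<in> {0..1}" "emp_copula n s u v = edf n s (\<alpha>, \<beta>)"
      "\<bar>edf n s (\<alpha>, 1) - u\<bar> \<le> 1 / n" "\<bar>edf n s (1, \<beta>) - v\<bar> \<le> 1 / n"
      by (rule emp_copula_eq_edf[OF n(3) s uv])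
    \<comment> \<open>Applied to either margin: \<open>t\<close> is the argument, \<open>t'\<close>
      the quantile, \<open>e\<close> the marginal \<open>edf\<close> at the quantile. Then
      \<open>b''\<close> is the path at the quantile and \<open>b'\<close> the path at the argument.
      The bound 1 / n becomes 1 / r after scaling, and boundedness of the path forces
      \<open>t'\<close> close to \<open>t\<close>.\<close>
    have key: "\<bar>r * (t' - t) + b'\<bar> \<le> \<bar>b' - b''\<bar> + 1 / r \<and> \<bar>t' - t\<bar> \<le> \<tau>"
      if "\<bar>e - t\<bar> \<le> 1 / n" "b'' = r * (e - t')" "\<bar>b''\<bar> \<le> L" for e t t' b' b''
    proof -
      have 1: "\<bar>r * (e - t)\<bar> \<le> 1 / r"
        using mult_left_mono[OF that(1), of r] r n1 by (simp add: abs_mult)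
      have "r * (t' - t) + b' = r * (e - t) + (b' - b'')" by (simp add: that(2) algebra_simps)
      then have A: "\<bar>r * (t' - t) + b'\<bar> \<le> \<bar>b' - b''\<bar> + 1 / r" using 1 by linarith
      have "r * (t' - t) = r * (e - t) - b''" by (simp add: that(2) algebra_simps)
      then have "\<bar>r * (t' - t)\<bar> \<le> 1 / r + L" using 1 that(3) by linarith
      also have "\<dots> \<le> L + 1" using r by (simp add: field_simps)
      finally have "\<bar>t' - t\<bar> \<le> (L + 1) / r"
        using r by (simp add: abs_mult pos_le_divide_eq mult.commute)
      then show ?thesis using A n1 by auto
    qed
    have bL: "\<bar>b (x, y)\<bar> \<le> L" if "x \<in> {0..1}" "y \<in> {0..1}" for x y
      using b(3) that by (auto simp: bounded_path_def)
    have k1: "\<bar>r * (\<alpha> - u) + b (u, 1)\<bar> \<le> \<bar>b (u, 1) - b (\<alpha>, 1)\<bar> + 1 / r \<and> \<bar>\<alpha> - u\<bar> \<le> \<tau>"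
      using bL[of \<alpha> 1] ab(1) by (intro key[OF ab(4)]) (auto simp: b_def eproc_def r_def)
    have k2: "\<bar>r * (\<beta> - v) + b (1, v)\<bar> \<le> \<bar>b (1, v) - b (1, \<beta>)\<bar> + 1 / r \<and> \<bar>\<beta> - v\<bar> \<le> \<tau>"
      using bL[of 1 \<beta>] ab(2) by (intro key[OF ab(5)]) (auto simp: b_def eproc_def r_def)
    have small: "\<bar>\<alpha> - u\<bar> \<le> \<delta>" "\<bar>\<beta> - v\<bar> \<le> \<delta>" "\<bar>\<alpha> - u\<bar> \<le> \<tau>1" "\<bar>\<beta> - v\<bar> \<le> \<tau>1" "\<bar>\<alpha> - u\<bar> \<le> \<tau>2" "\<bar>\<beta> - v\<bar> \<le> \<tau>2"
      using k1 k2 by (auto simp: \<tau>_def)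
    have o: "\<bar>b (\<alpha>, \<beta>) - b (u, v)\<bar> \<le> \<eta>" "\<bar>b (\<alpha>, 1) - b (u, 1)\<bar> \<le> \<eta>" "\<bar>b (1, \<beta>) - b (1, v)\<bar> \<le> \<eta>"
      using small uv ab assms by (auto intro!: osc_leD[OF b(1)])
    \<comment> \<open>The increment first moves \<alpha> to \<open>u\<close> at height \<beta>, then
      \<beta> to \<open>v\<close>. In the first move the derivative is nevertheless wanted at (u,
      v), which is why \<open>increment_estimate\<close> lets the second coordinate vary
      too.\<close>
    define T1 where "T1 = r * (C \<alpha> \<beta> - C u \<beta>) - dC1 C u v * (- b (u, 1))"
    define T2 where "T2 = r * (C u \<beta> - C u v) - dC2 C u v * (- b (1, v))"
    have "\<bar>T1\<bar> \<le> \<bar>r * (\<alpha> - u) - (- b (u, 1))\<bar> + 2 * \<eta>"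
      unfolding T1_def using small uv ab bL[of u 1] tied_down_small[OF b(1,2)] by (intro t1) auto
    also have "\<bar>r * (\<alpha> - u) - (- b (u, 1))\<bar> \<le> \<eta> + \<eta>"
      using k1 o(2) n1(2) by linarith
    finally have T1: "\<bar>T1\<bar> \<le> 4 * \<eta>" by simp
    have "\<bar>T2\<bar> \<le> \<bar>r * (\<beta> - v) - (- b (1, v))\<bar> + 2 * \<eta>"
      unfolding T2_def using small uv ab bL[of 1 v] tied_down_small[OF b(1,2)] t2(1) by (intro t2) auto
    also have "\<bar>r * (\<beta> - v) - (- b (1, v))\<bar> \<le> \<eta> + \<eta>"
      using k2 o(3) n1(2) by linarith
    finally have T2: "\<bar>T2\<bar> \<le> 4 * \<eta>" by simp
    have "b (\<alpha>, \<beta>) = r * (edf n s (\<alpha>, \<beta>) - C \<alpha> \<beta>)" by (simp add: b_def eproc_def r_def)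
    then have "r * (emp_copula n s u v - C u v) - G_lim C b u v = (b (\<alpha>, \<beta>) - b (u, v)) + T1 + T2"
      unfolding ab(3) G_lim_def T1_def T2_def by (simp add: algebra_simps)
    then have "\<bar>r * (emp_copula n s u v - C u v) - G_lim C b u v\<bar> \<le> 9 * \<eta>"
      using T1 T2 o(1) by linarith
    then show "\<bar>sqrt n * (emp_copula n s u v - C u v) - G_lim C (eproc C n s) u v\<bar> \<le> 9 * \<eta>"
      by (simp add: b_def r_def)
  qed
qed

text \<open>Each side splits into the error of the outer empirical copula at its random inner
  argument and the increment of \<open>C\<close> caused by the inner error. Since
  \<open>C x (C y z)\<close> and \<open>C (C x y) z\<close> cancel, the constant is 16 + 16 + 25 +
  25.\<close>

lemma H_emp_asymp:
  assumes assoc: "\<And>x y z. x \<in> {0..1} \<Longrightarrow> y \<in> {0..1} \<Longrightarrow> z \<in> {0..1} \<Longrightarrow> C x (C y z) = C (C x y) z"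
    and "0 < \<eta>" "0 < \<delta>" "0 < L"
  shows "\<forall>\<^sub>F n in sequentially. \<forall>s x y z. generic_sample n s \<longrightarrow> osc_le \<delta> \<eta> (eproc C n s) \<longrightarrow>
     tied_down C (eproc C n s) \<longrightarrow> bounded_path L (eproc C n s) \<longrightarrow>
     x \<in> {0..1} \<longrightarrow> y \<in> {0..1} \<longrightarrow> z \<in> {0..1} \<longrightarrow>
     \<bar>H_emp n s x y z - H_lim C (eproc C n s) x y z\<bar> \<le> 82 * \<eta>"
proof -
  note pos = assms(2-4)
  obtain \<tau> where \<tau>: "0 < \<tau>" "\<And>b u u' v v'. osc_le \<delta> \<eta> b \<Longrightarrow> tied_down C b \<Longrightarrow> bounded_path L b \<Longrightarrow>
     u \<in> {0..1} \<Longrightarrow> u' \<in> {0..1} \<Longrightarrow> v \<in> {0..1} \<Longrightarrow> v' \<in> {0..1} \<Longrightarrow> \<bar>u' - u\<bar> \<le> \<tau> \<Longrightarrow> \<bar>v' - v\<bar> \<le> \<tau> \<Longrightarrow>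
     \<bar>G_lim C b u v - G_lim C b u' v'\<bar> \<le> 7 * \<eta>"
    by (rule G_lim_modulus[OF pos]) blast
  obtain \<rho> where \<rho>: "0 < \<rho>" "\<And>b y z. osc_le \<delta> \<eta> b \<Longrightarrow> tied_down C b \<Longrightarrow> bounded_path L b \<Longrightarrow>
     y \<in> {0..1} \<Longrightarrow> z \<in> {0..1} \<Longrightarrow> C y z < \<rho> \<or> 1 - \<rho> < C y z \<Longrightarrow> \<bar>G_lim C b y z\<bar> \<le> 8 * \<eta>"
    by (rule G_lim_small[OF pos]) blast
  \<comment> \<open>In the outer linearisation \<open>G_lim\<close> takes the place of the path, so
    the bound L becomes 3 L and smallness near the edge becomes 8 \<eta>, with the width \<rho> of
    \<open>G_lim_small\<close>.\<close>
  have p3: "0 < 3 * L" "0 < 8 * \<eta>" using pos by auto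
  obtain \<tau>1 where t1: "0 < \<tau>1" "\<And>u u' v v' g s. u \<in> {0..1} \<Longrightarrow> u' \<in> {0..1} \<Longrightarrow> v \<in> {0..1} \<Longrightarrow> v' \<in> {0..1} \<Longrightarrow>
     \<bar>u' - u\<bar> \<le> \<tau>1 \<Longrightarrow> \<bar>v' - v\<bar> \<le> \<tau>1 \<Longrightarrow> \<bar>g\<bar> \<le> 3 * L \<Longrightarrow> (u < \<rho> \<or> 1 - \<rho> < u \<Longrightarrow> \<bar>g\<bar> \<le> 8 * \<eta>) \<Longrightarrow>
     \<bar>s * (C u' v' - C u v') - dC1 C u v * g\<bar> \<le> \<bar>s * (u' - u) - g\<bar> + 2 * (8 * \<eta>)"
    by (rule increment_estimate[OF \<rho>(1) p3]) blast
  obtain \<tau>2 where t2: "0 < \<tau>2" "\<And>u u' v v' g s. u \<in> {0..1} \<Longrightarrow> u' \<in> {0..1} \<Longrightarrow> v \<in> {0..1} \<Longrightarrow> v' \<in> {0..1} \<Longrightarrow>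
     \<bar>u' - u\<bar> \<le> \<tau>2 \<Longrightarrow> \<bar>v' - v\<bar> \<le> \<tau>2 \<Longrightarrow> \<bar>g\<bar> \<le> 3 * L \<Longrightarrow> (u < \<rho> \<or> 1 - \<rho> < u \<Longrightarrow> \<bar>g\<bar> \<le> 8 * \<eta>) \<Longrightarrow>
     \<bar>s * (C v' u' - C v' u) - dC2 C v u * g\<bar> \<le> \<bar>s * (u' - u) - g\<bar> + 2 * (8 * \<eta>)"
    unfolding dC2_eq by (rule flip.increment_estimate[OF \<rho>(1) p3]) blast
  define \<sigma> where "\<sigma> = min \<tau> (min \<tau>1 \<tau>2)"
  have "0 < \<sigma>" using \<tau> t1 t2 by (auto simp: \<sigma>_def)
  show ?thesis
    using emp_copula_asymp[OF pos] eventually_le_div_sqrt[OF \<open>0 < \<sigma>\<close>, of "3 * L + 9 * \<eta>"]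
      eventually_gt_at_top[of 0]
  proof (eventually_elim, intro allI impI)
    fix n s and x y z :: real
    assume emp: "\<forall>s u v. generic_sample n s \<longrightarrow> osc_le \<delta> \<eta> (eproc C n s) \<longrightarrow>
       tied_down C (eproc C n s) \<longrightarrow> bounded_path L (eproc C n s) \<longrightarrow> u \<in> {0..1} \<longrightarrow> v \<in> {0..1} \<longrightarrow>
       \<bar>sqrt n * (emp_copula n s u v - C u v) - G_lim C (eproc C n s) u v\<bar> \<le> 9 * \<eta>"
      and n: "(3 * L + 9 * \<eta>) / sqrt (real n) \<le> \<sigma>" "0 < n"
      and s: "generic_sample n s" and b': "osc_le \<delta> \<eta> (eproc C n s)"
        "tied_down C (eproc C n s)" "bounded_path L (eproc C n s)"
      and xyz: "x \<in> {0..1}" "y \<in> {0..1}" "z \<in> {0..1}"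
    define b where "b = eproc C n s"
    note b = b'[folded b_def]
    define r where "r = sqrt (real n)"
    have r: "1 \<le> r" using n(2) by (auto simp: r_def)
    define E where "E = emp_copula n s"
    have E: "E u v \<in> {0..1}" for u v unfolding E_def by (rule emp_copula_range)
    have g: "\<bar>r * (E u v - C u v) - G_lim C b u v\<bar> \<le> 9 * \<eta>" if "u \<in> {0..1}" "v \<in> {0..1}" for u v
      using emp s b' that unfolding b_def r_def E_def by blast
    have close: "\<bar>E u v - C u v\<bar> \<le> \<sigma>" if uv: "u \<in> {0..1}" "v \<in> {0..1}" for u v
    proof -
      have "\<bar>r * (E u v - C u v)\<bar> \<le> 3 * L + 9 * \<eta>"
        using g[OF uv] G_lim_abs_le[OF b(3) uv] by linarith
      then have "\<bar>E u v - C u v\<bar> \<le> (3 * L + 9 * \<eta>) / r"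
        using r by (simp add: abs_mult pos_le_divide_eq mult.commute)
      then show ?thesis using n(1) by (simp add: r_def)
    qed
    define c c' d d' where "c = C y z" and "c' = E y z" and "d = C x y" and "d' = E x y"
    have in01: "c \<in> {0..1}" "c' \<in> {0..1}" "d \<in> {0..1}" "d' \<in> {0..1}"
      using E range xyz by (simp_all add: c_def c'_def d_def d'_def)
    have cl: "\<bar>c' - c\<bar> \<le> \<tau>" "\<bar>c' - c\<bar> \<le> \<tau>2" "\<bar>d' - d\<bar> \<le> \<tau>" "\<bar>d' - d\<bar> \<le> \<tau>1"
      using close[of y z] close[of x y] xyz by (auto simp: \<sigma>_def c_def c'_def d_def d'_def)
    \<comment> \<open>9 for the empirical copula at the random point (x, c') and 7 for moving
      \<open>G_lim\<close> back to (x, c).\<close>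
    have 1: "\<bar>r * (E x c' - C x c') - G_lim C b x c\<bar> \<le> 16 * \<eta>"
      using g[OF xyz(1) in01(2)] \<tau>(2)[OF b xyz(1) xyz(1) in01(1,2)] cl \<tau>(1) by auto
    have 2: "\<bar>r * (E d' z - C d' z) - G_lim C b d z\<bar> \<le> 16 * \<eta>"
      using g[OF in01(4) xyz(3)] \<tau>(2)[OF b in01(3,4) xyz(3) xyz(3)] cl \<tau>(1) by auto
    \<comment> \<open>The case hypothesis of \<open>t2\<close> concerns \<open>c\<close> near 0 or
      1, and \<open>G_lim_small\<close> answers it. With 9 for the inner empirical copula this gives
      25.\<close>
    have "\<bar>r * (C x c' - C x c) - dC2 C x c * G_lim C b y z\<bar> \<le> \<bar>r * (c' - c) - G_lim C b y z\<bar> + 2 * (8 * \<eta>)"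
      using xyz in01 cl t2(1) G_lim_abs_le[OF b(3) xyz(2,3)] \<rho>(2)[OF b xyz(2,3)]
      by (intro t2(2)) (auto simp: c_def)
    then have 3: "\<bar>r * (C x c' - C x c) - dC2 C x c * G_lim C b y z\<bar> \<le> 25 * \<eta>"
      using g[OF xyz(2,3)] by (simp add: c_def c'_def)
    have "\<bar>r * (C d' z - C d z) - dC1 C d z * G_lim C b x y\<bar> \<le> \<bar>r * (d' - d) - G_lim C b x y\<bar> + 2 * (8 * \<eta>)"
      using xyz in01 cl t1(1) G_lim_abs_le[OF b(3) xyz(1,2)] \<rho>(2)[OF b xyz(1,2)]
      by (intro t1(2)) (auto simp: d_def)
    then have 4: "\<bar>r * (C d' z - C d z) - dC1 C d z * G_lim C b x y\<bar> \<le> 25 * \<eta>"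
      using g[OF xyz(1,2)] by (simp add: d_def d'_def)
    have "C x c = C d z" using assoc[OF xyz] by (simp add: c_def d_def)
    then have "H_emp n s x y z - H_lim C b x y z =
       (r * (E x c' - C x c') - G_lim C b x c) - (r * (E d' z - C d' z) - G_lim C b d z)
       + (r * (C x c' - C x c) - dC2 C x c * G_lim C b y z) - (r * (C d' z - C d z) - dC1 C d z * G_lim C b x y)"
      unfolding H_emp_def H_lim_def c_def[symmetric] d_def[symmetric] E_def[symmetric] r_def[symmetric]
        c'_def[symmetric] d'_def[symmetric]
      by (simp add: algebra_simps)
    then have "\<bar>H_emp n s x y z - H_lim C b x y z\<bar> \<le> 82 * \<eta>" using 1 2 3 4 by linarith
    then show "\<bar>H_emp n s x y z - H_lim C (eproc C n s) x y z\<bar> \<le> 82 * \<eta>" by (simp add: b_def)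
  qed
qed

end

section \<open>Equicontinuity of the bivariate empirical process\<close>

lemma exp_le_quadratic:
  fixes s :: real
  assumes "\<bar>s\<bar> \<le> 1"
  shows "exp s \<le> 1 + s + s\<^sup>2"
proof (cases "0 \<le> s")
  case True then show ?thesis using exp_bound[of s] assms by auto
next
  case False
  define t where "t = - s"
  have t: "0 < t" using False by (simp add: t_def)
  \<comment> \<open>The product is 1 + t cubed.\<close>
  have "1 \<le> (1 - t + t\<^sup>2) * (1 + t)" using t by (simp add: algebra_simps power2_eq_square)
  also have "\<dots> \<le> (1 - t + t\<^sup>2) * exp t"
  proof (rule mult_left_mono)
    have "0 \<le> (t - 1/2)\<^sup>2 + 3/4" by simp
    also have "\<dots> = 1 - t + t\<^sup>2" by (simp add: power2_eq_square algebra_simps)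
    finally show "0 \<le> 1 - t + t\<^sup>2" .
  qed (rule exp_ge_add_one_self)
  finally have "exp (- t) \<le> 1 - t + t\<^sup>2" by (simp add: exp_minus field_simps)
  then show ?thesis by (simp add: t_def)
qed

context prob_space
begin

text \<open>A bound of Bernstein type: the exponent carries \<open>prob A\<close>, not just a
  constant, so that thin strips get correspondingly small deviations. The price is the restriction
  on \<open>s\<close>.\<close>

lemma expectation_exp_centered_indicator:
  assumes A: "A \<in> events" and s: "\<bar>s\<bar> \<le> 1"
  shows "integrable M (\<lambda>\<omega>. exp (s * (indicator A \<omega> - prob A)))"
    and "expectation (\<lambda>\<omega>. exp (s * (indicator A \<omega> - prob A))) \<le> exp (prob A * s\<^sup>2)"
proof -
  have eq: "exp (s * (indicator A \<omega> - prob A)) = exp (- s * prob A) + (exp (- s * prob A) * (exp s - 1)) * indicator A \<omega>" for \<omega>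
    by (cases "\<omega> \<in> A") (simp_all add: algebra_simps flip: exp_add)
  show "integrable M (\<lambda>\<omega>. exp (s * (indicator A \<omega> - prob A)))"
    unfolding eq using A by (intro Bochner_Integration.integrable_add integrable_mult_right) (auto simp: integrable_indicator_iff emeasure_eq_measure)
  have "expectation (\<lambda>\<omega>. exp (s * (indicator A \<omega> - prob A))) = exp (- s * prob A) * (1 + (exp s - 1) * prob A)"
    unfolding eq using A by (subst Bochner_Integration.integral_add) (auto simp: prob_space algebra_simps emeasure_eq_measure)
  also have "\<dots> \<le> exp (- s * prob A) * exp ((exp s - 1) * prob A)"
    using exp_ge_add_one_self[of "(exp s - 1) * prob A"] by (intro mult_left_mono) auto
  also have "\<dots> = exp (prob A * (exp s - 1 - s))" by (simp add: algebra_simps flip: exp_add)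
  also have "\<dots> \<le> exp (prob A * s\<^sup>2)"
    using exp_le_quadratic[OF s] by (auto intro!: mult_left_mono)
  finally show "expectation (\<lambda>\<omega>. exp (s * (indicator A \<omega> - prob A))) \<le> exp (prob A * s\<^sup>2)" .
qed

text \<open>Chernoff's method with s = \<theta> / sqrt n, so \<bar>s\<bar> \<le> 1 becomes \<theta>
  \<le> sqrt n; the factor 2 accounts for the two tails. The upper bound \<open>q\<close> stands for
  the mass because for strips only the width is known.\<close>

lemma empirical_measure_tail:
  fixes W :: "nat \<Rightarrow> 'a \<Rightarrow> 'c"
  assumes indep: "indep_vars (\<lambda>_. N) W UNIV" and S: "S \<in> sets N"
    and p: "\<And>i. prob (W i -` S \<inter> space M) = p" and q: "p \<le> q" and n: "0 < n"
    and \<theta>: "0 \<le> \<theta>" "\<theta> \<le> sqrt n"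
  shows "prob {\<omega>\<in>space M. \<kappa> \<le> \<bar>(\<Sum>i<n. indicator S (W i \<omega>) - p) / sqrt n\<bar>} \<le> 2 * exp (q * \<theta>\<^sup>2 - \<theta> * \<kappa>)"
proof -
  have [measurable]: "W i \<in> measurable M N" for i using indep by (auto simp: indep_vars_def)
  note S[measurable]
  define D where "D \<omega> = (\<Sum>i<n. indicator S (W i \<omega>) - p) / sqrt n" for \<omega>
  have [measurable]: "D \<in> borel_measurable M" unfolding D_def by measurable
  have one: "prob {\<omega>\<in>space M. \<kappa> \<le> c * D \<omega>} \<le> exp (q * \<theta>\<^sup>2 - \<theta> * \<kappa>)" if c: "c = 1 \<or> c = -1" for c :: real
  proof -
    define s where "s = c * \<theta> / sqrt n"
    have s: "\<bar>s\<bar> \<le> 1" "n * s\<^sup>2 = \<theta>\<^sup>2" using c \<theta> n by (auto simp: s_def abs_mult field_simps)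
    define Y where "Y i \<omega> = exp (s * (indicator S (W i \<omega>) - p))" for i \<omega>
    have Yeq: "Y i \<omega> = exp (s * (indicator (W i -` S \<inter> space M) \<omega> - prob (W i -` S \<inter> space M)))" if "\<omega> \<in> space M" for i \<omega>
      using that by (simp add: Y_def p indicator_def)
    have ev: "W i -` S \<inter> space M \<in> events" for i by measurable
    have Yi: "integrable M (Y i)" for i
      using expectation_exp_centered_indicator(1)[OF ev s(1)]
      by (rule Bochner_Integration.integrable_cong[THEN iffD1, rotated -1]) (auto simp: Yeq)
    have Ye: "expectation (Y i) \<le> exp (q * s\<^sup>2)" for i
    proof -
      have "expectation (Y i) = expectation (\<lambda>\<omega>. exp (s * (indicator (W i -` S \<inter> space M) \<omega> - prob (W i -` S \<inter> space M))))"
        by (rule Bochner_Integration.integral_cong) (auto simp: Yeq)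
      also have "\<dots> \<le> exp (p * s\<^sup>2)" using expectation_exp_centered_indicator(2)[OF ev s(1), of i] by (simp add: p)
      also have "\<dots> \<le> exp (q * s\<^sup>2)" using q by (auto intro!: mult_right_mono)
      finally show ?thesis .
    qed
    have ind: "indep_vars (\<lambda>_. borel) Y {..<n}"
      unfolding Y_def
      by (rule indep_vars_compose2[OF indep_vars_subset[OF indep], where Y="\<lambda>i w. exp (s * (indicator S w - p))"]) auto
    have prod_eq: "exp (\<theta> * (c * D \<omega>)) = (\<Prod>i<n. Y i \<omega>)" for \<omega>
      by (simp add: Y_def D_def s_def flip: exp_sum) (simp add: sum_distrib_left sum_divide_distrib algebra_simps)
    have "{\<omega>\<in>space M. \<kappa> \<le> c * D \<omega>} \<subseteq> {\<omega>\<in>space M. exp (\<theta> * \<kappa>) \<le> (\<Prod>i<n. Y i \<omega>)}"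
      unfolding prod_eq[symmetric] using \<theta> by (auto intro!: mult_left_mono)
    then have "prob {\<omega>\<in>space M. \<kappa> \<le> c * D \<omega>} \<le> prob {\<omega>\<in>space M. exp (\<theta> * \<kappa>) \<le> (\<Prod>i<n. Y i \<omega>)}"
      unfolding prod_eq[symmetric] by (intro finite_measure_mono) auto
    also have "\<dots> \<le> expectation (\<lambda>\<omega>. \<Prod>i<n. Y i \<omega>) / exp (\<theta> * \<kappa>)"
    proof (rule integral_Markov_inequality_measure[where A="{}"])
      show "integrable M (\<lambda>\<omega>. \<Prod>i<n. Y i \<omega>)"
        by (rule indep_vars_integrable) (auto intro!: ind Yi)
    qed (auto simp: Y_def intro!: prod_nonneg)
    also have "expectation (\<lambda>\<omega>. \<Prod>i<n. Y i \<omega>) = (\<Prod>i<n. expectation (Y i))"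
      by (rule indep_vars_lebesgue_integral) (auto intro!: ind Yi)
    also have "\<dots> \<le> (\<Prod>i<n. exp (q * s\<^sup>2))"
      by (intro prod_mono) (auto intro!: Ye integral_nonneg_AE simp: Y_def)
    also have "\<dots> = exp (q * \<theta>\<^sup>2)" by (simp add: s(2)[symmetric] algebra_simps flip: exp_of_nat_mult)
    finally show ?thesis by (simp add: exp_diff divide_right_mono)
  qed
  have "{\<omega>\<in>space M. \<kappa> \<le> \<bar>D \<omega>\<bar>} = {\<omega>\<in>space M. \<kappa> \<le> 1 * D \<omega>} \<union> {\<omega>\<in>space M. \<kappa> \<le> -1 * D \<omega>}" by auto
  also have "prob \<dots> \<le> prob {\<omega>\<in>space M. \<kappa> \<le> 1 * D \<omega>} + prob {\<omega>\<in>space M. \<kappa> \<le> -1 * D \<omega>}"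
    by (intro measure_Un_le) auto
  also have "\<dots> \<le> 2 * exp (q * \<theta>\<^sup>2 - \<theta> * \<kappa>)" using one[of 1] one[of "-1"] by auto
  finally show ?thesis by (simp add: D_def)
qed

end

lemma measurable_fst_borel [measurable]: "fst \<in> measurable borel (borel :: real measure)"
  and measurable_snd_borel [measurable]: "snd \<in> measurable borel (borel :: real measure)"
  by (auto intro!: borel_measurable_continuous_onI continuous_intros)

lemma eproc_increment1:
  assumes "0 < n" "u \<le> u'"
  shows "eproc C n s (u', v) - eproc C n s (u, v) =
    (\<Sum>i<n. indicator ({u<..u'} \<times> {..v}) (s i) - (C u' v - C u v)) / sqrt n"
proof -
  have eq: "indicator ({u<..u'} \<times> {..v}) (s i) = (of_bool (fst (s i) \<le> u' \<and> snd (s i) \<le> v) - of_bool (fst (s i) \<le> u \<and> snd (s i) \<le> v) :: real)" for i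
    using assms by (cases "s i") (auto simp: indicator_def)
  define a b :: real where "a = (\<Sum>i<n. of_bool (fst (s i) \<le> u' \<and> snd (s i) \<le> v))"
    and "b = (\<Sum>i<n. of_bool (fst (s i) \<le> u \<and> snd (s i) \<le> v))"
  define r where "r = sqrt (real n)"
  have r: "0 < r" "real n = r * r" using assms by (auto simp: r_def)
  have S: "(\<Sum>i<n. indicator ({u<..u'} \<times> {..v}) (s i) - (C u' v - C u v)) = a - b - n * (C u' v - C u v)"
    unfolding eq a_def b_def by (simp add: sum_subtractf del: sum_of_bool_eq)
  have E: "eproc C n s (u', v) = r * (a / n - C u' v)" "eproc C n s (u, v) = r * (b / n - C u v)"
    by (simp_all add: eproc_def edf_def a_def b_def r_def del: sum_of_bool_eq)
  show ?thesis using r(1) unfolding S E r_def[symmetric] r(2) by (simp add: field_simps)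
qed

lemma eproc_flip: "eproc (\<lambda>u v. C v u) n (\<lambda>i. prod.swap (s i)) (v, u) = eproc C n s (u, v)"
  by (simp add: eproc_def edf_def conj_commute)

text \<open>The sample after the marginal transformation. Only its distribution function on the unit
  square is prescribed; that the values almost surely lie in the square is derived in
  \<open>AE_unit\<close>.\<close>

locale copula_sample = prob_space M + copula_fun C
  for M :: "'a measure" and C +
  fixes W :: "nat \<Rightarrow> 'a \<Rightarrow> real \<times> real"
  assumes indep: "indep_vars (\<lambda>_. borel) W UNIV"
    and W_distr: "distr M borel (W i) = distr M borel (W j)"
    and W_cdf: "u \<in> {0..1} \<Longrightarrow> v \<in> {0..1} \<Longrightarrow> prob {\<omega>\<in>space M. fst (W i \<omega>) \<le> u \<and> snd (W i \<omega>) \<le> v} = C u v"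
begin

lemma W_measurable [measurable]: "W i \<in> borel_measurable M"
  using indep by (auto simp: indep_vars_def)

lemma flip: "copula_sample M (\<lambda>u v. C v u) (\<lambda>i \<omega>. prod.swap (W i \<omega>))"
proof -
  interpret flip: copula_fun "\<lambda>u v. C v u" by unfold_locales (rule swap)
  show ?thesis
  proof unfold_locales
    fix i j
    have [measurable]: "prod.swap \<in> measurable borel (borel :: (real \<times> real) measure)"
      by (auto intro!: borel_measurable_continuous_onI continuous_on_swap)
    have "distr (distr M borel (W i)) borel prod.swap = distr (distr M borel (W j)) borel prod.swap"
      by (simp add: W_distr[of i j])
    then show "distr M borel (\<lambda>\<omega>. prod.swap (W i \<omega>)) = distr M borel (\<lambda>\<omega>. prod.swap (W j \<omega>))"
      by (simp add: distr_distr comp_def)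
    show "indep_vars (\<lambda>_. borel) (\<lambda>i \<omega>. prod.swap (W i \<omega>)) UNIV"
      by (rule indep_vars_compose2[OF indep, where Y="\<lambda>_. prod.swap"])
         (auto intro!: borel_measurable_continuous_onI continuous_on_swap)
  qed (use W_cdf in \<open>auto simp: conj_commute\<close>)
qed

lemma eproc_measurable [measurable]: "(\<lambda>\<omega>. eproc C n (\<lambda>i. W i \<omega>) p) \<in> borel_measurable M"
  unfolding eproc_def edf_def by measurable

lemma prob_strip:
  assumes "u \<in> {0..1}" "u' \<in> {0..1}" "v \<in> {0..1}" "u \<le> u'"
  shows "prob (W i -` ({u<..u'} \<times> {..v}) \<inter> space M) = C u' v - C u v"
proof -
  have "W i -` ({u<..u'} \<times> {..v}) \<inter> space M =
     {\<omega>\<in>space M. fst (W i \<omega>) \<le> u' \<and> snd (W i \<omega>) \<le> v} - {\<omega>\<in>space M. fst (W i \<omega>) \<le> u \<and> snd (W i \<omega>) \<le> v}"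
    by (auto simp: mem_Times_iff)
  also have "prob \<dots> = C u' v - C u v"
    by (subst finite_measure_Diff) (use assms in \<open>auto simp: W_cdf\<close>)
  finally show ?thesis .
qed

lemma increment_tail:
  assumes "u \<in> {0..1}" "u' \<in> {0..1}" "v \<in> {0..1}" "u \<le> u'" "u' - u \<le> q" "0 < n" "0 \<le> \<theta>" "\<theta> \<le> sqrt n"
  shows "prob {\<omega>\<in>space M. \<kappa> \<le> \<bar>eproc C n (\<lambda>i. W i \<omega>) (u', v) - eproc C n (\<lambda>i. W i \<omega>) (u, v)\<bar>}
    \<le> 2 * exp (q * \<theta>\<^sup>2 - \<theta> * \<kappa>)"
  unfolding eproc_increment1[OF assms(6,4)]
  by (rule empirical_measure_tail[OF indep])
     (use assms prob_strip increment_bounds1(2)[OF assms(1-4)] in \<open>auto intro!: borel_Times\<close>)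

end

section \<open>Dyadic chaining\<close>

definition dyadic :: "nat \<Rightarrow> real \<Rightarrow> nat" where
  "dyadic k t = nat \<lfloor>2 ^ k * t\<rfloor>"

lemma dyadic_bounds:
  assumes "t \<in> {0..1}"
  shows "dyadic k t \<le> 2 ^ k" "dyadic k t / 2 ^ k \<le> t" "t < (dyadic k t + 1) / 2 ^ k"
    "real (dyadic k t) / 2 ^ k \<in> {0..1}"
proof -
  have nn: "0 \<le> 2 ^ k * t" using assms by auto
  then have r: "real (dyadic k t) = of_int \<lfloor>2 ^ k * t\<rfloor>" by (simp add: dyadic_def)
  have "2 ^ k * t \<le> 2 ^ k" using assms by (simp add: mult_left_le)
  then have "real (dyadic k t) \<le> 2 ^ k" unfolding r by linarith
  then have "real (dyadic k t) \<le> real (2 ^ k)" by simp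
  then show *: "dyadic k t \<le> 2 ^ k" by (simp only: of_nat_le_iff)
  have "real (dyadic k t) \<le> 2 ^ k * t" "2 ^ k * t < real (dyadic k t) + 1" unfolding r by linarith+
  then show "dyadic k t / 2 ^ k \<le> t" "t < (dyadic k t + 1) / 2 ^ k" by (simp_all add: field_simps)
  show "real (dyadic k t) / 2 ^ k \<in> {0..1}" using \<open>real (dyadic k t) \<le> 2 ^ k\<close> by simp
qed

text \<open>Passing to the next level moves the left grid point by at most one step of the finer
  grid, so one increment per coordinate bridges two levels.\<close>

lemma dyadic_Suc:
  assumes "t \<in> {0..1}"
  shows "dyadic (Suc k) t = 2 * dyadic k t \<or> dyadic (Suc k) t = 2 * dyadic k t + 1"
proof -
  have "real (dyadic k t) \<le> 2 ^ k * t" "2 ^ k * t < real (dyadic k t) + 1"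
    using dyadic_bounds[OF assms, of k] by (simp_all add: field_simps)
  moreover have "real (dyadic (Suc k) t) \<le> 2 * (2 ^ k * t)" "2 * (2 ^ k * t) < real (dyadic (Suc k) t) + 1"
    using dyadic_bounds[OF assms, of "Suc k"] by (simp_all add: field_simps)
  ultimately have "real (dyadic (Suc k) t) < real (2 * dyadic k t + 2)" "real (2 * dyadic k t) < real (dyadic (Suc k) t + 1)"
    by simp_all
  then show ?thesis unfolding of_nat_less_iff by linarith
qed

lemma dyadic_close:
  assumes "t \<in> {0..1}" "t' \<in> {0..1}" "\<bar>t' - t\<bar> \<le> 1 / 2 ^ k"
  shows "dyadic k t' \<le> dyadic k t + 1"
proof -
  have "real (dyadic k t') \<le> 2 ^ k * t'" "2 ^ k * t < real (dyadic k t) + 1"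
    using dyadic_bounds[OF assms(1), of k] dyadic_bounds[OF assms(2), of k] by (simp_all add: field_simps)
  moreover have "2 ^ k * (t' - t) \<le> 2 ^ k * (1 / 2 ^ k)" using assms(3) by (intro mult_left_mono) auto
  ultimately have "real (dyadic k t') < real (dyadic k t + 2)" by (simp add: algebra_simps)
  then show ?thesis unfolding of_nat_less_iff by linarith
qed

text \<open>Restricted to neighbours along one axis: these are finitely many increments, each the
  centred empirical mass of one strip and hence accessible to the tail bound.\<close>

definition grid_incr_le :: "nat \<Rightarrow> real \<Rightarrow> (real \<times> real \<Rightarrow> real) \<Rightarrow> bool" where
  "grid_incr_le k \<kappa> b \<longleftrightarrow> (\<forall>i<2^k. \<forall>j\<le>2^k.
     \<bar>b (real (Suc i) / 2^k, real j / 2^k) - b (real i / 2^k, real j / 2^k)\<bar> \<le> \<kappa> \<and>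
     \<bar>b (real j / 2^k, real (Suc i) / 2^k) - b (real j / 2^k, real i / 2^k)\<bar> \<le> \<kappa>)"

lemma grid_incr_leD:
  assumes g: "grid_incr_le k \<kappa> b" and "0 \<le> \<kappa>" "i \<le> 2^k" "i' \<le> 2^k" "j \<le> 2^k" "j' \<le> 2^k"
    "i' \<le> Suc i" "i \<le> Suc i'" "j' \<le> Suc j" "j \<le> Suc j'"
  shows "\<bar>b (real i' / 2^k, real j' / 2^k) - b (real i / 2^k, real j / 2^k)\<bar> \<le> 2 * \<kappa>"
proof -
  have 1: "\<bar>b (real i' / 2^k, real l / 2^k) - b (real i / 2^k, real l / 2^k)\<bar> \<le> \<kappa>" if "l \<le> 2^k" for l
  proof -
    consider "i' = i" | "i' = Suc i" | "i = Suc i'" using assms by linarith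
    then show ?thesis using g that assms(2-4) unfolding grid_incr_le_def
      by cases (auto simp: abs_minus_commute Suc_le_eq)
  qed
  have 2: "\<bar>b (real l / 2^k, real j' / 2^k) - b (real l / 2^k, real j / 2^k)\<bar> \<le> \<kappa>" if "l \<le> 2^k" for l
  proof -
    consider "j' = j" | "j' = Suc j" | "j = Suc j'" using assms by linarith
    then show ?thesis using g that assms(2,5,6) unfolding grid_incr_le_def
      by cases (auto simp: abs_minus_commute Suc_le_eq)
  qed
  show ?thesis using 1[of j'] 2[of i] assms by linarith
qed

lemma edf_mono: "fst p \<le> fst q \<Longrightarrow> snd p \<le> snd q \<Longrightarrow> edf n s p \<le> edf n s q"
  unfolding edf_def by (intro divide_right_mono sum_mono) auto

text \<open>From level \<open>m\<close> to \<open>K\<close> the increments telescope, at most 2 S in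
  all. Below level \<open>K\<close> the exponential bound is out of reach; there monotonicity of
  \<open>edf\<close> and of \<open>C\<close> takes over, and \<open>C\<close> changes by at most 2 /
  2^K < 4 / n over a cell. So each point is within 4 S + 4 / sqrt n of its value at level
  \<open>m\<close>; two such errors and one step at level \<open>m\<close> give 10 S + 8 / sqrt
  n.\<close>

lemma (in copula_fun) chaining:
  fixes s :: "nat \<Rightarrow> real \<times> real"
  assumes "0 < n" "m \<le> K" and \<kappa>: "\<And>k. 0 \<le> \<kappa> k" and K: "n < 2 ^ Suc K"
    and g: "\<And>k. m \<le> k \<Longrightarrow> k \<le> K \<Longrightarrow> grid_incr_le k (\<kappa> k) (eproc C n s)"
  shows "osc_le (1 / 2^m) (10 * (\<Sum>k=m..K. \<kappa> k) + 8 / sqrt n) (eproc C n s)"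
proof -
  define b where "b = eproc C n s"
  define G where "G k p = (real (dyadic k (fst p)) / 2^k, real (dyadic k (snd p)) / 2^k)" for k and p :: "real \<times> real"
  note g' = g[folded b_def]
  have step: "\<bar>b (G (Suc k) p) - b (G k p)\<bar> \<le> 2 * \<kappa> (Suc k)"
    if p: "p \<in> {0..1} \<times> {0..1}" and k: "m \<le> k" "Suc k \<le> K" for k p
  proof -
    \<comment> \<open>The coarse grid point is rewritten with even indices of the finer grid, so
      that both points lie on the same grid.\<close>
    have Gk: "G k p = (real (2 * dyadic k (fst p)) / 2^Suc k, real (2 * dyadic k (snd p)) / 2^Suc k)"
      by (simp add: G_def)
    have le: "2 * dyadic k (fst p) \<le> 2 ^ Suc k" "2 * dyadic k (snd p) \<le> 2 ^ Suc k"
      using dyadic_bounds(1)[of "fst p" k] dyadic_bounds(1)[of "snd p" k] p by auto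
    show ?thesis unfolding Gk unfolding G_def
      using dyadic_Suc[of "fst p" k] dyadic_Suc[of "snd p" k] p k
        dyadic_bounds(1)[of "fst p" "Suc k"] dyadic_bounds(1)[of "snd p" "Suc k"]
      by (intro grid_incr_leD[OF g' \<kappa>] le) auto
  qed
  have coarse: "\<bar>b (G (m + j) p) - b (G m p)\<bar> \<le> 2 * (\<Sum>k=m..m+j. \<kappa> k)"
    if p: "p \<in> {0..1} \<times> {0..1}" and "m + j \<le> K" for p j
    using that(2)
  proof (induction j)
    case 0 then show ?case using \<kappa> by simp
  next
    case (Suc j)
    have "(\<Sum>k=m..m + Suc j. \<kappa> k) = (\<Sum>k=m..m + j. \<kappa> k) + \<kappa> (m + Suc j)" by simp
    then show ?case using Suc step[OF p, of "m + j"] by simp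
  qed
  define S where "S = (\<Sum>k=m..K. \<kappa> k)"
  have \<kappa>S: "\<kappa> k \<le> S" if "m \<le> k" "k \<le> K" for k
    unfolding S_def using that \<kappa> by (intro member_le_sum) auto
  have fine: "\<bar>b p - b (G K p)\<bar> \<le> 2 * S + 4 / sqrt n" if p: "p \<in> {0..1} \<times> {0..1}" for p
  proof -
    obtain u v where uv: "p = (u, v)" "u \<in> {0..1}" "v \<in> {0..1}" using p by (cases p) auto
    define i where "i t = dyadic K t" for t
    \<comment> \<open>The right neighbour, except at the last grid point (t = 1), which is its own
      neighbour.\<close>
    define i' where "i' t = (if i t < 2^K then Suc (i t) else i t)" for t
    have t: "i t \<le> 2^K" "i' t \<le> 2^K" "real (i t) / 2^K \<le> t" "t \<le> real (i' t) / 2^K"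
      "real (i' t) / 2^K \<le> real (i t) / 2^K + 1 / 2^K" "real (i t) / 2^K \<in> {0..1}" "real (i' t) / 2^K \<in> {0..1}"
      "i' t \<le> Suc (i t)" "i t \<le> Suc (i' t)"
      if "t \<in> {0..1}" for t
    proof -
      note d = dyadic_bounds[OF that, of K, folded i_def]
      have "real (i t) = 2^K" if "\<not> i t < 2^K" using d(1) that by (metis le_neq_implies_less of_nat_numeral of_nat_power)
      then show "t \<le> real (i' t) / 2^K" using d that by (auto simp: i'_def add.commute)
      show le: "i' t \<le> 2^K" using d(1) by (auto simp: i'_def)
      then have "real (i' t) \<le> real (2^K)" by (simp only: of_nat_le_iff)
      then show "real (i' t) / 2^K \<in> {0..1}" by simp
      show "i' t \<le> Suc (i t)" "i t \<le> Suc (i' t)" by (auto simp: i'_def)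
      show "real (i' t) / 2^K \<le> real (i t) / 2^K + 1 / 2^K" by (auto simp: i'_def add_divide_distrib)
    qed (use dyadic_bounds[OF that, of K] in \<open>simp_all add: i_def\<close>)
    define lo hi where "lo = (real (i u) / 2^K, real (i v) / 2^K)" and "hi = (real (i' u) / 2^K, real (i' v) / 2^K)"
    have GK: "G K p = lo" by (simp add: G_def lo_def uv i_def)
    have bhl: "\<bar>b hi - b lo\<bar> \<le> 2 * \<kappa> K"
      unfolding hi_def lo_def using t(1,2,8,9)[OF uv(2)] t(1,2,8,9)[OF uv(3)] assms(2)
      by (intro grid_incr_leD[OF g' \<kappa>]) auto
    have C1: "\<bar>C (fst hi) (snd hi) - C (fst lo) (snd lo)\<bar> \<le> 2 / 2^K"
      using lipschitz[of "fst lo" "fst hi" "snd lo" "snd hi"] t[OF uv(2)] t[OF uv(3)]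
      by (auto simp: lo_def hi_def)
    have C2: "C (fst lo) (snd lo) \<le> C u v" "C u v \<le> C (fst hi) (snd hi)"
      using t[OF uv(2)] t[OF uv(3)] uv by (auto simp: lo_def hi_def intro!: mono)
    have e: "edf n s lo \<le> edf n s p" "edf n s p \<le> edf n s hi"
      using t[OF uv(2)] t[OF uv(3)] uv by (auto simp: lo_def hi_def intro!: edf_mono)
    define r where "r = sqrt (real n)"
    have r: "0 < r" "r * r = n" using assms(1) by (auto simp: r_def)
    define h where "h = r * (2 / 2^K)"
    have h: "h \<le> 4 / r"
    proof -
      have "real n < real (2 ^ Suc K)" using K by (simp only: of_nat_less_iff)
      then have "r * r \<le> 2 * 2^K" using r by simp
      then show ?thesis using r by (simp add: h_def field_simps)
    qed
    have up: "r * (C (fst hi) (snd hi) - C (fst lo) (snd lo)) \<le> h"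
      unfolding h_def using C1 r by (intro mult_left_mono) auto
    have "r * C (fst lo) (snd lo) \<le> r * C u v" "r * C u v \<le> r * C (fst hi) (snd hi)"
      "r * edf n s lo \<le> r * edf n s p" "r * edf n s p \<le> r * edf n s hi"
      using C2 e r by (auto intro!: mult_left_mono)
    moreover have bq: "b q = r * edf n s q - r * C (fst q) (snd q)" for q
      by (simp add: b_def eproc_def r_def algebra_simps)
    \<comment> \<open>Sandwich: \<open>b lo - h\<close> \<le> \<open>b p\<close> \<le>
      \<open>b hi + h\<close>, where \<open>h\<close> pays for pairing \<open>edf\<close> and
      \<open>C\<close> at different corners of the cell.\<close>
    ultimately have "\<bar>b p - b lo\<bar> \<le> 2 * \<kappa> K + h"
      using up bhl bq[of p] bq[of lo] bq[of hi] uv(1) \<kappa>[of K]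
      unfolding abs_le_iff fst_conv snd_conv by (simp add: right_diff_distrib)
    also have "\<dots> \<le> 2 * S + 4 / r" using h \<kappa>S[of K] assms(2) by auto
    finally show ?thesis by (simp add: GK r_def)
  qed
  have near: "\<bar>b p - b (G m p)\<bar> \<le> 4 * S + 4 / sqrt n" if p: "p \<in> {0..1} \<times> {0..1}" for p
    using coarse[OF p, of "K - m"] fine[OF p] assms(2) unfolding S_def by auto
  show ?thesis unfolding osc_le_def b_def[symmetric] S_def[symmetric]
  proof (intro ballI impI)
    fix u u' v v' :: real assume uv: "u \<in> {0..1}" "u' \<in> {0..1}" "v \<in> {0..1}" "v' \<in> {0..1}"
      "\<bar>u' - u\<bar> \<le> 1 / 2^m" "\<bar>v' - v\<bar> \<le> 1 / 2^m"
    have "\<bar>b (G m (u', v')) - b (G m (u, v))\<bar> \<le> 2 * \<kappa> m"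
      unfolding G_def fst_conv snd_conv
      using uv dyadic_bounds(1) dyadic_close[of u u' m] dyadic_close[of u' u m] dyadic_close[of v v' m] dyadic_close[of v' v m] assms(2)
      by (intro grid_incr_leD[OF g' \<kappa>]) (auto simp: abs_minus_commute)
    moreover have "2 * \<kappa> m \<le> 2 * S" using \<kappa>S[of m] assms(2) by auto
    ultimately show "\<bar>b (u', v') - b (u, v)\<bar> \<le> 10 * S + 8 / sqrt n"
      using near[of "(u, v)"] near[of "(u', v')"] uv by auto
  qed
qed

context copula_sample
begin

lemma grid_incr_measurable [measurable]:
  "{\<omega>\<in>space M. grid_incr_le k \<kappa> (eproc C n (\<lambda>i. W i \<omega>))} \<in> events"
  unfolding grid_incr_le_def by measurable

text \<open>A strip of level \<open>k\<close> has mass at most \<open>2\<^sup>-\<^sup>k\<close>, so the exponent \<open>\<theta> = 2\<^sup>k\<^sup>/\<^sup>2\<close>, admissible while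
  \<open>2\<^sup>k \<le> n\<close>, makes the threshold \<open>2\<^sup>-\<^sup>k\<^sup>/\<^sup>4\<close> both summable and exceeded with summable probability,
  although there are about \<open>4\<^sup>k\<close> strips.\<close>

lemma prob_not_grid_incr_le:
  assumes n: "2 ^ k \<le> n"
  defines "q \<equiv> root 4 2"
  shows "prob {\<omega>\<in>space M. \<not> grid_incr_le k (1 / q ^ k) (eproc C n (\<lambda>i. W i \<omega>))} \<le> 8 * exp 1 * 12 ^ 12 / 2 ^ k"
proof -
  interpret flip: copula_sample M "\<lambda>u v. C v u" "\<lambda>i \<omega>. prod.swap (W i \<omega>)" by (rule flip)
  have q: "1 < q" "q ^ 4 = 2" by (simp_all add: q_def)
  have n0: "0 < n" using n by (metis gr0I leD zero_less_numeral zero_less_power)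
  define \<theta> where "\<theta> = q ^ (2 * k)"
  have q2k: "(q ^ (2 * k))\<^sup>2 = 2 ^ k"
    by (metis (no_types, opaque_lifting) q(2) mult.commute numeral_Bit0 mult_2_right power_even_eq power_mult)
  have \<theta>: "0 \<le> \<theta>" "\<theta>\<^sup>2 = 2 ^ k" using q q2k by (auto simp: \<theta>_def)
  have "\<theta> = sqrt (2 ^ k)" using \<theta> by (metis real_sqrt_unique)
  also have "2 ^ k \<le> real n" using n by (metis of_nat_le_iff of_nat_numeral of_nat_power)
  finally have \<theta>n: "\<theta> \<le> sqrt n" by simp
  have \<theta>\<kappa>: "\<theta> * (1 / q ^ k) = q ^ k" using q by (simp add: \<theta>_def mult_2 power_add)
  \<comment> \<open>The strip width times the square of \<theta> is 1 and \<theta> times the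
    threshold is \<open>q ^ k\<close>; hence the exponent 1 - \<open>q ^ k\<close> for every
    strip.\<close>
  define e where "e = 2 * exp (1 - q ^ k)"
  define A where "A i j = {\<omega>\<in>space M. 1 / q ^ k \<le> \<bar>eproc C n (\<lambda>i. W i \<omega>) (real (Suc i) / 2^k, real j / 2^k) - eproc C n (\<lambda>i. W i \<omega>) (real i / 2^k, real j / 2^k)\<bar>}" for i j
  define B where "B i j = {\<omega>\<in>space M. 1 / q ^ k \<le> \<bar>eproc C n (\<lambda>i. W i \<omega>) (real j / 2^k, real (Suc i) / 2^k) - eproc C n (\<lambda>i. W i \<omega>) (real j / 2^k, real i / 2^k)\<bar>}" for i j
  have [measurable]: "A i j \<in> events" "B i j \<in> events" for i j unfolding A_def B_def by measurable
  have AB: "prob (A i j) \<le> e" "prob (B i j) \<le> e" if ij: "i < 2^k" "j \<le> 2^k" for i j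
  proof -
    have r: "real (Suc i) \<le> real (2^k)" "real j \<le> real (2^k)" using ij by (simp_all only: of_nat_le_iff Suc_le_eq)
    have in01: "real i / 2^k \<in> {0..1}" "real (Suc i) / 2^k \<in> {0..1}" "real j / 2^k \<in> {0..1}"
      using r ij(1) by auto
    have d: "real i / 2^k \<le> real (Suc i) / 2^k" "real (Suc i) / 2^k - real i / 2^k \<le> 1 / 2^k"
      by (simp_all add: divide_right_mono add_divide_distrib)
    show "prob (A i j) \<le> e"
      using increment_tail[OF in01 d n0 \<theta>(1) \<theta>n, of "1 / q ^ k"]
      unfolding \<theta>\<kappa> \<theta>(2) by (simp add: A_def e_def)
    show "prob (B i j) \<le> e"
      using flip.increment_tail[OF in01 d n0 \<theta>(1) \<theta>n, of "1 / q ^ k"]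
      unfolding eproc_flip \<theta>\<kappa> \<theta>(2) by (simp add: B_def e_def)
  qed
  have "{\<omega>\<in>space M. \<not> grid_incr_le k (1 / q ^ k) (eproc C n (\<lambda>i. W i \<omega>))} \<subseteq> (\<Union>(i,j)\<in>{..<2^k}\<times>{..2^k}. A i j \<union> B i j)"
    by (auto simp: grid_incr_le_def A_def B_def)
  then have "prob {\<omega>\<in>space M. \<not> grid_incr_le k (1 / q ^ k) (eproc C n (\<lambda>i. W i \<omega>))} \<le> prob (\<Union>(i,j)\<in>{..<2^k}\<times>{..2^k}. A i j \<union> B i j)"
    by (intro finite_measure_mono) auto
  also have "\<dots> \<le> (\<Sum>ij\<in>{..<2^k}\<times>{..2^k}. prob (case ij of (i, j) \<Rightarrow> A i j \<union> B i j))"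
    by (intro finite_measure_subadditive_finite) auto
  also have "\<dots> \<le> (\<Sum>ij\<in>{..<2^k::nat}\<times>{..2^k::nat}. 2 * e)"
  proof (intro sum_mono, clarsimp)
    fix i j :: nat assume "i < 2^k" "j \<le> 2^k"
    then show "prob (A i j \<union> B i j) \<le> 2 * e"
      using measure_Un_le[of "A i j" M "B i j"] AB[of i j] by auto
  qed
  also have "\<dots> = 2^k * (2^k + 1) * (2 * e)" by (simp add: algebra_simps)
  also have "\<dots> \<le> 2^k * (2 * 2^k) * (2 * e)"
    by (intro mult_mono) (auto simp: e_def)
  also have "\<dots> = 8 * exp 1 * (2^k * 2^k / exp (q ^ k))" by (simp add: e_def exp_diff)
  also have "\<dots> \<le> 8 * exp 1 * (12 ^ 12 / 2^k)"
  proof (rule mult_left_mono)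
    \<comment> \<open>Twelfth power of x \<le> exp x: because \<open>q ^ 12\<close> = 8, the
      exponential exceeds 8^k up to a constant, which beats the roughly 4^k strips and leaves
      2^-k.\<close>
    have "q ^ k / 12 \<le> exp (q ^ k / 12)"
      using exp_ge_add_one_self[of "q ^ k / 12"] by linarith
    then have "(q ^ k / 12) ^ 12 \<le> exp (q ^ k / 12) ^ 12"
      using q by (intro power_mono) auto
    also have "\<dots> = exp (q ^ k)" by (simp flip: exp_of_nat_mult)
    finally have "(q ^ k / 12) ^ 12 \<le> exp (q ^ k)" .
    moreover have "(q ^ k) ^ 12 = (2 ^ k) ^ 3"
    proof -
      have "(q ^ k) ^ 12 = (q ^ 4) ^ (k * 3)" by (simp only: power_mult[symmetric]) (simp add: mult.commute)
      then show ?thesis by (simp add: q(2) power_mult)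
    qed
    ultimately have "(2 ^ k) ^ 3 / 12 ^ 12 \<le> exp (q ^ k)" by (simp add: power_divide)
    then show "2^k * 2^k / exp (q ^ k) \<le> 12 ^ 12 / 2 ^ k"
      by (simp add: divide_simps power3_eq_cube mult.commute mult.left_commute)
  qed simp
  finally show ?thesis by simp
qed

text \<open>Thresholds and exceptional probabilities are both geometric in the level, so their sums
  from \<open>m\<close> on are small uniformly in n. The conclusion asks for an event on which the
  oscillation is small, since \<open>osc_le\<close> itself quantifies over uncountably many
  points.\<close>

theorem asymptotic_equicontinuity:
  assumes "0 < \<epsilon>" "0 < \<eta>"
  obtains m where "\<forall>\<^sub>F n in sequentially. \<exists>A\<in>events. 1 - \<epsilon> \<le> prob A \<and>
    (\<forall>\<omega>\<in>A. osc_le (1 / 2^m) \<eta> (eproc C n (\<lambda>i. W i \<omega>)))"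
proof -
  define q :: real where "q = root 4 2"
  have q: "1 < q" by (simp add: q_def)
  define K0 :: real where "K0 = 8 * exp 1 * 12 ^ 12"
  have sum_geo: "(\<Sum>k=m..K. 1 / r ^ k) \<le> (1 / r ^ m) * (r / (r - 1))" if "1 < r" for r :: real and m K
  proof (cases "m \<le> K")
    case True
    have "(\<Sum>k=m..K. 1 / r ^ k) = (\<Sum>k=m..K. (1 / r) ^ k)" by (simp add: power_divide)
    also have "\<dots> = ((1/r) ^ m - (1/r) ^ Suc K) / (1 - 1/r)" using that True by (auto simp: sum_gp)
    also have "\<dots> \<le> (1/r) ^ m / (1 - 1/r)" using that by (intro divide_right_mono) auto
    also have "\<dots> = (1 / r ^ m) * (r / (r - 1))" using that by (simp add: field_simps power_divide)
    finally show ?thesis .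
  qed (use that in auto)
  have l1: "(\<lambda>m. 10 * ((1 / q ^ m) * (q / (q - 1)))) \<longlonglongrightarrow> 10 * (0 * (q / (q - 1)))"
    using q by (intro tendsto_intros) (simp add: LIMSEQ_inverse_realpow_zero[unfolded inverse_eq_divide])
  have l2: "(\<lambda>m. K0 * ((1 / 2 ^ m) * (2 / (2 - 1)))) \<longlonglongrightarrow> K0 * (0 * (2 / (2 - 1)))"
    by (intro tendsto_intros) (simp add: LIMSEQ_inverse_realpow_zero[unfolded inverse_eq_divide])
  have "\<forall>\<^sub>F m in sequentially. 10 * ((1 / q ^ m) * (q / (q - 1))) < \<eta> / 2 \<and> K0 * ((1 / 2 ^ m) * (2 / (2 - 1))) < \<epsilon>"
    using order_tendstoD(2)[OF l1, of "\<eta>/2"] order_tendstoD(2)[OF l2, of \<epsilon>] assms by (auto intro: eventually_conj)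
  then obtain m where m: "10 * ((1 / q ^ m) * (q / (q - 1))) < \<eta> / 2" "K0 * ((1 / 2 ^ m) * (2 / (2 - 1))) < \<epsilon>"
    by (auto simp: eventually_sequentially)
  have "(\<lambda>n. 8 / sqrt (real n)) \<longlonglongrightarrow> 0" by real_asymp
  then have l3: "\<forall>\<^sub>F n in sequentially. 8 / sqrt (real n) < \<eta> / 2"
    by (rule order_tendstoD(2)) (use assms in auto)
  show ?thesis
  proof (rule that[of m])
    show "\<forall>\<^sub>F n in sequentially. \<exists>A\<in>events. 1 - \<epsilon> \<le> prob A \<and>
      (\<forall>\<omega>\<in>A. osc_le (1 / 2^m) \<eta> (eproc C n (\<lambda>i. W i \<omega>)))"
      using l3 eventually_ge_at_top[of "2^m"]
    proof eventually_elim
      case (elim n)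
      have small: "8 / sqrt (real n) < \<eta> / 2" using elim assms by auto
      have n0: "0 < n" using elim by (metis gr0I leD zero_less_numeral zero_less_power)
      \<comment> \<open>The last level with 2^K \<le> n: the tail bound still applies there, and n <
        2^(K+1) is what \<open>chaining\<close> requires.\<close>
      define K where "K = floor_log n"
      have K: "2 ^ K \<le> n" "n < 2 ^ Suc K" using n0 by (auto simp: K_def floor_log_exp2_le floor_log_exp2_gt)
      have "m \<le> K" using elim K by (metis less_Suc_eq_le order_le_less_trans one_less_numeral_iff power_strict_increasing_iff semiring_norm(76))
      define A where "A = {\<omega>\<in>space M. \<forall>k\<in>{m..K}. grid_incr_le k (1 / q ^ k) (eproc C n (\<lambda>i. W i \<omega>))}"
      have [measurable]: "A \<in> events" unfolding A_def by measurable
      have "space M - A = (\<Union>k\<in>{m..K}. {\<omega>\<in>space M. \<not> grid_incr_le k (1 / q ^ k) (eproc C n (\<lambda>i. W i \<omega>))})"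
        by (auto simp: A_def)
      then have "prob (space M - A) \<le> (\<Sum>k=m..K. prob {\<omega>\<in>space M. \<not> grid_incr_le k (1 / q ^ k) (eproc C n (\<lambda>i. W i \<omega>))})"
        by (auto intro!: finite_measure_subadditive_finite)
      also have "\<dots> \<le> (\<Sum>k=m..K. K0 * (1 / 2 ^ k))"
      proof (rule sum_mono)
        fix k assume "k \<in> {m..K}"
        then have "(2::nat) ^ k \<le> n" using K(1) by (meson atLeastAtMost_iff le_trans one_le_numeral power_increasing)
        from prob_not_grid_incr_le[OF this] show "prob {\<omega>\<in>space M. \<not> grid_incr_le k (1 / q ^ k) (eproc C n (\<lambda>i. W i \<omega>))} \<le> K0 * (1 / 2 ^ k)"
          by (simp add: K0_def q_def)
      qed
      also have "\<dots> = K0 * (\<Sum>k=m..K. 1 / 2 ^ k)" by (simp add: sum_distrib_left)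
      also have "\<dots> \<le> K0 * ((1 / 2 ^ m) * (2 / (2 - 1)))"
        using sum_geo[of 2 m K] by (intro mult_left_mono) (auto simp: K0_def)
      also have "\<dots> < \<epsilon>" by (rule m(2))
      finally have "1 - \<epsilon> \<le> prob A" by (simp add: prob_compl)
      moreover have "osc_le (1 / 2^m) \<eta> (eproc C n (\<lambda>i. W i \<omega>))" if "\<omega> \<in> A" for \<omega>
      proof -
        have "osc_le (1 / 2^m) (10 * (\<Sum>k=m..K. 1 / q ^ k) + 8 / sqrt n) (eproc C n (\<lambda>i. W i \<omega>))"
          using that q by (intro chaining n0 \<open>m \<le> K\<close> K) (auto simp: A_def)
        moreover have "10 * (\<Sum>k=m..K. 1 / q ^ k) + 8 / sqrt n \<le> \<eta>"
          using sum_geo[OF q, of m K] small m(1) by linarith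
        ultimately show ?thesis unfolding osc_le_def by (meson order_trans)
      qed
      ultimately show ?case by (intro bexI[of _ A]) auto
    qed
  qed
qed

end

section \<open>Convergence of finite-dimensional distributions\<close>

text \<open>Cosine and sine share a frequency so that the product formulas stay within the class. A
  wave depends on one linear combination of the coordinates, and this is where the univariate limit
  theorem applies.\<close>

inductive trig_poly :: "nat \<Rightarrow> ((nat \<Rightarrow> real) \<Rightarrow> real) \<Rightarrow> bool" for d where
  wave: "trig_poly d (\<lambda>x. c * cos (\<Sum>k<d. a k * x k) + e * sin (\<Sum>k<d. a k * x k))"
| add: "trig_poly d f \<Longrightarrow> trig_poly d g \<Longrightarrow> trig_poly d (\<lambda>x. f x + g x)"

lemma trig_poly_const: "trig_poly d (\<lambda>_. c)"
  using trig_poly.wave[of d c "\<lambda>_. 0" 0] by simp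

text \<open>Product-to-sum formulas; the new frequencies are the sum and the difference of the old
  ones.\<close>

lemma trig_poly_wave_mult:
  "trig_poly d (\<lambda>x. (c * cos (\<Sum>k<d. a k * x k) + e * sin (\<Sum>k<d. a k * x k)) *
                    (c' * cos (\<Sum>k<d. a' k * x k) + e' * sin (\<Sum>k<d. a' k * x k)))"
proof -
  have "(c * cos A + e * sin A) * (c' * cos B + e' * sin B) =
     ((c * c' - e * e') / 2 * cos (A + B) + (c * e' + e * c') / 2 * sin (A + B)) +
     ((c * c' + e * e') / 2 * cos (A - B) + (e * c' - c * e') / 2 * sin (A - B))" for A B
    by (simp add: cos_add sin_add cos_diff sin_diff) (simp add: field_simps)
  then show ?thesis
    using trig_poly.add[OF trig_poly.wave[of d "(c * c' - e * e') / 2" "\<lambda>k. a k + a' k" "(c * e' + e * c') / 2"]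
                           trig_poly.wave[of d "(c * c' + e * e') / 2" "\<lambda>k. a k - a' k" "(e * c' - c * e') / 2"]]
    by (simp add: sum.distrib sum_subtractf distrib_right left_diff_distrib)
qed

lemma trig_poly_mult:
  assumes "trig_poly d f" "trig_poly d g"
  shows "trig_poly d (\<lambda>x. f x * g x)"
  using assms
proof (induction rule: trig_poly.induct)
  case (wave c a e)
  from this show ?case
  proof (induction rule: trig_poly.induct)
    case wave then show ?case by (rule trig_poly_wave_mult)
  next
    case (add f g) then show ?case by (simp add: distrib_left trig_poly.add)
  qed
next
  case (add f g) then show ?case by (simp add: distrib_right trig_poly.add)
qed

lemma trig_poly_compose:
  assumes p: "trig_poly d p" and "real_polynomial_function q"
  shows "trig_poly d (\<lambda>x. q (p x))"
  using assms(2)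
proof (induction rule: real_polynomial_function.induct)
  case (linear f)
  then obtain c where "f = (\<lambda>x. x * c)" by (auto simp: real_bounded_linear)
  then show ?case using trig_poly_mult[OF p trig_poly_const[of d c]] by simp
qed (auto intro: trig_poly_const trig_poly.add trig_poly_mult)

lemma trig_poly_continuous: "trig_poly d f \<Longrightarrow> continuous_on UNIV f"
  by (induction rule: trig_poly.induct) (auto intro!: continuous_intros)

lemma trig_poly_bounded: "trig_poly d f \<Longrightarrow> \<exists>K. \<forall>x. \<bar>f x\<bar> \<le> K"
proof (induction rule: trig_poly.induct)
  case (wave c a e)
  have "\<bar>c * cos A + e * sin A\<bar> \<le> \<bar>c\<bar> + \<bar>e\<bar>" for A
  proof -
    have "\<bar>c * cos A\<bar> \<le> \<bar>c\<bar>" "\<bar>e * sin A\<bar> \<le> \<bar>e\<bar>" by (simp_all add: abs_mult mult_left_le)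
    then show ?thesis by linarith
  qed
  then show ?case by blast
next
  case (add f g)
  then obtain K K' where "\<And>x. \<bar>f x\<bar> \<le> K" "\<And>x. \<bar>g x\<bar> \<le> K'" by auto
  then have "\<bar>f x + g x\<bar> \<le> K + K'" for x by (meson abs_triangle_ineq add_mono order_trans)
  then show ?case by blast
qed

text \<open>Stone-Weierstrass on the cube, viewed inside the sequence space with zeros from
  coordinate \<open>d\<close> on. Points are separated by a sine of one coordinate whose frequency
  keeps the argument in [-pi/2, pi/2], where sine is injective.\<close>

lemma trig_poly_dense:
  fixes f :: "(nat \<Rightarrow> real) \<Rightarrow> real"
  assumes f: "continuous_on UNIV f" and "0 < \<epsilon>"
  obtains p where "trig_poly d p"
    "\<And>x. (\<And>k. k < d \<Longrightarrow> \<bar>x k\<bar> \<le> L) \<Longrightarrow> (\<And>k. d \<le> k \<Longrightarrow> x k = 0) \<Longrightarrow> \<bar>f x - p x\<bar> < \<epsilon>"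
proof -
  define S where "S = PiE UNIV (\<lambda>k. if k < d then {-L..L} else {0::real})"
  have "compactin (product_topology (\<lambda>_::nat. euclidean::real topology) UNIV) S"
    unfolding S_def by (subst compactin_PiE) auto
  then have cS: "compact S" by (simp add: euclidean_product_topology)
  have "\<exists>p. trig_poly d p \<and> (\<forall>x\<in>S. \<bar>f x - p x\<bar> < \<epsilon>)"
  proof (rule Stone_Weierstrass_HOL[OF cS, of "trig_poly d"])
    fix x y assume xy: "x \<in> S \<and> y \<in> S \<and> x \<noteq> y"
    then obtain k where k: "x k \<noteq> y k" by auto
    have kd: "k < d"
    proof (rule ccontr)
      assume "\<not> k < d"
      then have "x k = 0" "y k = 0" using xy by (auto simp: S_def PiE_iff split: if_splits)
      with k show False by simp
    qed
    \<comment> \<open>Positive whatever the sign of \<open>L\<close>, so that the frequency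
      \<open>e\<close> below is well defined.\<close>
    define l where "l = \<bar>L\<bar> + 1"
    have l: "0 < l" by (simp add: l_def)
    define e where "e = pi / 2 / l"
    from l have e: "0 < e" by (simp add: e_def)
    have wv: "(\<Sum>j<d. (if j = k then e else 0) * z j) = e * z k" for z :: "nat \<Rightarrow> real"
      using kd by (simp add: if_distrib[of "\<lambda>c. c * _"] sum.delta cong: if_cong)
    have le: "-(pi/2) \<le> e * t \<and> e * t \<le> pi/2" if "\<bar>t\<bar> \<le> L" for t
    proof -
      have "\<bar>e * t\<bar> \<le> e * l" unfolding abs_mult using that e by (intro mult_mono) (auto simp: l_def)
      also have "\<dots> = pi / 2" using l by (simp add: e_def)
      finally show ?thesis by linarith
    qed
    have "\<bar>x k\<bar> \<le> L" "\<bar>y k\<bar> \<le> L" using xy kd by (auto simp: S_def PiE_iff dest!: spec[of _ k])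
    then have "sin (e * x k) \<noteq> sin (e * y k)"
      using sin_inj_pi[of "e * x k" "e * y k"] le[of "x k"] le[of "y k"] e k by auto
    then show "\<exists>f. trig_poly d f \<and> f x \<noteq> f y"
      using trig_poly.wave[of d 0 "\<lambda>j. if j = k then e else 0" 1] unfolding wv by auto
  next
    show "continuous_on S f" using f continuous_on_subset by blast
  qed (use assms in \<open>auto intro: trig_poly_const trig_poly.add trig_poly_mult
         continuous_on_subset[OF trig_poly_continuous]\<close>)
  then obtain p where "trig_poly d p" "\<forall>x\<in>S. \<bar>f x - p x\<bar> < \<epsilon>" by auto
  moreover have "x \<in> S" if "\<And>k. k < d \<Longrightarrow> \<bar>x k\<bar> \<le> L" "\<And>k. d \<le> k \<Longrightarrow> x k = 0" for x
    unfolding S_def PiE_iff using that by (auto simp: abs_le_iff minus_le_iff)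
  ultimately show ?thesis by (intro that[of p]) auto
qed

lemma tendsto_of_approximations:
  fixes x :: "nat \<Rightarrow> real"
  assumes "\<And>\<epsilon>. 0 < \<epsilon> \<Longrightarrow> \<exists>x' y'. (\<forall>\<^sub>F n in sequentially. \<bar>x n - x' n\<bar> \<le> \<epsilon>) \<and> \<bar>y - y'\<bar> \<le> \<epsilon> \<and> x' \<longlonglongrightarrow> y'"
  shows "x \<longlonglongrightarrow> y"
proof (rule tendstoI)
  fix e :: real assume "0 < e"
  then have e3: "0 < e/4" by auto
  from assms[OF this] obtain x' y' where a: "\<forall>\<^sub>F n in sequentially. \<bar>x n - x' n\<bar> \<le> e/4" "\<bar>y - y'\<bar> \<le> e/4" "x' \<longlonglongrightarrow> y'" by auto
  from tendstoD[OF a(3) e3] a(1) show "\<forall>\<^sub>F n in sequentially. dist (x n) y < e"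
  proof eventually_elim
    case (elim n)
    then show ?case using a(2) unfolding dist_real_def by linarith
  qed
qed

lemma (in prob_space) abs_expectation_diff_le:
  fixes f g :: "'a \<Rightarrow> real"
  assumes "integrable M f" "integrable M g" "integrable M h" "AE \<omega> in M. \<bar>f \<omega> - g \<omega>\<bar> \<le> h \<omega>"
  shows "\<bar>expectation f - expectation g\<bar> \<le> expectation h"
proof -
  have "\<bar>expectation f - expectation g\<bar> = \<bar>expectation (\<lambda>\<omega>. f \<omega> - g \<omega>)\<bar>"
    using assms by (simp add: Bochner_Integration.integral_diff)
  also have "\<dots> \<le> expectation (\<lambda>\<omega>. \<bar>f \<omega> - g \<omega>\<bar>)" by (rule integral_abs_bound)
  also have "\<dots> \<le> expectation h" using assms by (intro integral_mono_AE) auto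
  finally show ?thesis .
qed

text \<open>Vectors of length \<open>d\<close> are coded as sequences that vanish from
  \<open>d\<close> on. The cosine and sine hypotheses are convergence of characteristic functions in
  real form, and the uniform second moments provide tightness.\<close>

locale fdd_limit = M: prob_space M + N: prob_space N
  for M :: "'a measure" and N :: "'b measure" +
  fixes d :: nat and V :: "nat \<Rightarrow> 'a \<Rightarrow> nat \<Rightarrow> real" and Y :: "'b \<Rightarrow> nat \<Rightarrow> real" and c :: real
  assumes V_coord: "\<And>n k. (\<lambda>\<omega>. V n \<omega> k) \<in> borel_measurable M"
    and Y_coord: "\<And>k. (\<lambda>\<omega>. Y \<omega> k) \<in> borel_measurable N"
    and V_zero: "\<And>n \<omega> k. d \<le> k \<Longrightarrow> V n \<omega> k = 0" and Y_zero: "\<And>\<omega> k. d \<le> k \<Longrightarrow> Y \<omega> k = 0"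
    and V_square: "\<And>n k. integrable M (\<lambda>\<omega>. (V n \<omega> k)\<^sup>2)" "\<And>n k. (\<integral>\<omega>. (V n \<omega> k)\<^sup>2 \<partial>M) \<le> c"
    and Y_square: "\<And>k. integrable N (\<lambda>\<omega>. (Y \<omega> k)\<^sup>2)" "\<And>k. (\<integral>\<omega>. (Y \<omega> k)\<^sup>2 \<partial>N) \<le> c"
    and cos_conv: "\<And>a. (\<lambda>n. \<integral>\<omega>. cos (\<Sum>k<d. a k * V n \<omega> k) \<partial>M) \<longlonglongrightarrow> (\<integral>\<omega>. cos (\<Sum>k<d. a k * Y \<omega> k) \<partial>N)"
    and sin_conv: "\<And>a. (\<lambda>n. \<integral>\<omega>. sin (\<Sum>k<d. a k * V n \<omega> k) \<partial>M) \<longlonglongrightarrow> (\<integral>\<omega>. sin (\<Sum>k<d. a k * Y \<omega> k) \<partial>N)"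
begin

lemma V_meas [measurable]: "V n \<in> borel_measurable M"
  using V_coord by (rule measurable_coordinatewise_then_product)

lemma Y_meas [measurable]: "Y \<in> borel_measurable N"
  using Y_coord by (rule measurable_coordinatewise_then_product)

lemma integrable_comp:
  fixes f :: "(nat \<Rightarrow> real) \<Rightarrow> real"
  assumes "continuous_on UNIV f" "\<And>x. \<bar>f x\<bar> \<le> K"
  shows "integrable M (\<lambda>\<omega>. f (V n \<omega>))" "integrable N (\<lambda>\<omega>. f (Y \<omega>))"
proof -
  have [measurable]: "f \<in> borel_measurable borel" by (rule borel_measurable_continuous_onI[OF assms(1)])
  show "integrable M (\<lambda>\<omega>. f (V n \<omega>))" by (rule M.integrable_const_bound[of _ K]) (use assms in auto)
  show "integrable N (\<lambda>\<omega>. f (Y \<omega>))" by (rule N.integrable_const_bound[of _ K]) (use assms in auto)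
qed

lemma trig_poly_integrable:
  assumes "trig_poly d p"
  shows "integrable M (\<lambda>\<omega>. p (V n \<omega>))" "integrable N (\<lambda>\<omega>. p (Y \<omega>))"
  using trig_poly_bounded[OF assms] trig_poly_continuous[OF assms] integrable_comp by blast+

lemma trig_poly_conv:
  assumes "trig_poly d p"
  shows "(\<lambda>n. \<integral>\<omega>. p (V n \<omega>) \<partial>M) \<longlonglongrightarrow> (\<integral>\<omega>. p (Y \<omega>) \<partial>N)"
  using assms
proof (induction rule: trig_poly.induct)
  case (wave c a e)
  have int: "integrable M (\<lambda>\<omega>. cos (\<Sum>k<d. a k * V n \<omega> k))" "integrable M (\<lambda>\<omega>. sin (\<Sum>k<d. a k * V n \<omega> k))"
    "integrable N (\<lambda>\<omega>. cos (\<Sum>k<d. a k * Y \<omega> k))" "integrable N (\<lambda>\<omega>. sin (\<Sum>k<d. a k * Y \<omega> k))" for n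
    using trig_poly_integrable[OF trig_poly.wave[of d 1 a 0]] trig_poly_integrable[OF trig_poly.wave[of d 0 a 1]] by auto
  show ?case using int
    by (simp add: Bochner_Integration.integral_add) (intro tendsto_intros cos_conv sin_conv)
next
  case (add f g)
  then show ?case
    using trig_poly_integrable[OF add.hyps(1)] trig_poly_integrable[OF add.hyps(2)]
    by (simp add: Bochner_Integration.integral_add tendsto_add)
qed

text \<open>Truncating a trigonometric polynomial keeps the approximation bounded off the cube on which it is good.\<close>

lemma continuous_trig_poly_conv:
  fixes \<phi> :: "real \<Rightarrow> real"
  assumes p: "trig_poly d p" and \<phi>: "continuous_on UNIV \<phi>"
  shows "(\<lambda>n. \<integral>\<omega>. \<phi> (p (V n \<omega>)) \<partial>M) \<longlonglongrightarrow> (\<integral>\<omega>. \<phi> (p (Y \<omega>)) \<partial>N)"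
proof (rule tendsto_of_approximations)
  fix \<epsilon> :: real assume \<epsilon>: "0 < \<epsilon>"
  obtain K where K: "\<And>x. \<bar>p x\<bar> \<le> K" using trig_poly_bounded[OF p] by auto
  have c\<phi>: "continuous_on {-K..K} \<phi>" using \<phi> continuous_on_subset by blast
  \<comment> \<open>A polynomial in a trigonometric polynomial is again one, so it is enough to
    approximate \<phi> on the range of \<open>p\<close>.\<close>
  from Stone_Weierstrass_real_polynomial_function[OF _ this \<epsilon>] obtain q where
    q: "real_polynomial_function q" "\<And>x. x \<in> {-K..K} \<Longrightarrow> \<bar>\<phi> x - q x\<bar> < \<epsilon>" by auto
  have tq: "trig_poly d (\<lambda>x. q (p x))" by (rule trig_poly_compose[OF p q(1)])
  have pK: "p x \<in> {-K..K}" for x using K[of x] by auto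
  have "compact (\<phi> ` {-K..K})" by (intro compact_continuous_image c\<phi>) auto
  then obtain K' where K': "\<And>t. t \<in> {-K..K} \<Longrightarrow> \<bar>\<phi> t\<bar> \<le> K'"
    using compact_imp_bounded[of "\<phi> ` {-K..K}"] unfolding bounded_iff by force
  have "continuous_on UNIV (\<lambda>x. \<phi> (p x))"
    by (rule continuous_on_compose2[OF \<phi> trig_poly_continuous[OF p]]) auto
  then have int: "integrable M (\<lambda>\<omega>. \<phi> (p (V n \<omega>)))" "integrable N (\<lambda>\<omega>. \<phi> (p (Y \<omega>)))" for n
    using integrable_comp[of "\<lambda>x. \<phi> (p x)" K'] K' pK by auto
  have *: "\<bar>\<phi> (p x) - q (p x)\<bar> \<le> \<epsilon>" for x using q(2)[OF pK[of x]] by auto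
  have "\<bar>(\<integral>\<omega>. \<phi> (p (V n \<omega>)) \<partial>M) - (\<integral>\<omega>. q (p (V n \<omega>)) \<partial>M)\<bar> \<le> (\<integral>\<omega>. \<epsilon> \<partial>M)" for n
    by (rule M.abs_expectation_diff_le) (use int trig_poly_integrable[OF tq] * in auto)
  moreover have "\<bar>(\<integral>\<omega>. \<phi> (p (Y \<omega>)) \<partial>N) - (\<integral>\<omega>. q (p (Y \<omega>)) \<partial>N)\<bar> \<le> (\<integral>\<omega>. \<epsilon> \<partial>N)"
    by (rule N.abs_expectation_diff_le) (use int trig_poly_integrable[OF tq] * in auto)
  ultimately show "\<exists>x' y'. (\<forall>\<^sub>F n in sequentially. \<bar>(\<integral>\<omega>. \<phi> (p (V n \<omega>)) \<partial>M) - x' n\<bar> \<le> \<epsilon>) \<and>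
     \<bar>(\<integral>\<omega>. \<phi> (p (Y \<omega>)) \<partial>N) - y'\<bar> \<le> \<epsilon> \<and> x' \<longlonglongrightarrow> y'"
    using trig_poly_conv[OF tq]
    by (intro exI[of _ "\<lambda>n. \<integral>\<omega>. q (p (V n \<omega>)) \<partial>M"] exI[of _ "\<integral>\<omega>. q (p (Y \<omega>)) \<partial>N"])
       (auto simp: M.prob_space N.prob_space)
qed

text \<open>On a large cube \<open>f\<close> is close to a trigonometric polynomial
  \<open>p\<close>. Off the cube \<open>f\<close> and the truncation of \<open>p\<close> to [-K, K]
  differ by at most 2 K, which a Chebyshev bound makes negligible in mean, for the sequence and the
  limit alike.\<close>

theorem expectation_conv:
  fixes f :: "(nat \<Rightarrow> real) \<Rightarrow> real"
  assumes f: "continuous_on UNIV f" and K: "\<And>x. \<bar>f x\<bar> \<le> K"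
  shows "(\<lambda>n. \<integral>\<omega>. f (V n \<omega>) \<partial>M) \<longlonglongrightarrow> (\<integral>\<omega>. f (Y \<omega>) \<partial>N)"
proof (rule tendsto_of_approximations)
  fix \<epsilon> :: real assume \<epsilon>: "0 < \<epsilon>"
  have K0: "0 \<le> K" using K[of undefined] by auto
  have "0 \<le> (\<integral>\<omega>. (Y \<omega> 0)\<^sup>2 \<partial>N)" by simp
  then have c0: "0 \<le> c" using Y_square(2)[of 0] by linarith
  \<comment> \<open>Chosen so that 2 K d c / L^2 \<le> \<epsilon> / 2; the summand 1 keeps
    \<open>L\<close> positive when K, d or c is 0.\<close>
  define L where "L = sqrt (4 * (K * d * c + 1) / \<epsilon>)"
  have "0 \<le> K * d * c" using K0 c0 by simp
  then have L: "0 < L" "L\<^sup>2 = 4 * (K * d * c + 1) / \<epsilon>" using \<epsilon> by (auto simp: L_def)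
  obtain p where p: "trig_poly d p"
    "\<And>x. (\<And>k. k < d \<Longrightarrow> \<bar>x k\<bar> \<le> L) \<Longrightarrow> (\<And>k. d \<le> k \<Longrightarrow> x k = 0) \<Longrightarrow> \<bar>f x - p x\<bar> < \<epsilon> / 2"
    by (rule trig_poly_dense[OF f, of "\<epsilon>/2" d L]) (use \<epsilon> in auto)
  define \<phi> where "\<phi> t = max (- K) (min K t)" for t :: real
  have \<phi>: "continuous_on UNIV \<phi>" unfolding \<phi>_def by (intro continuous_intros)
  have \<phi>K: "\<bar>\<phi> t\<bar> \<le> K" for t using K0 by (auto simp: \<phi>_def)
  \<comment> \<open>Dominates the approximation error everywhere: off the cube some coordinate
    exceeds \<open>L\<close>, so the sum of squares exceeds L^2.\<close>
  define h where "h x = \<epsilon> / 2 + 2 * K / L\<^sup>2 * (\<Sum>k<d. (x k)\<^sup>2)" for x :: "nat \<Rightarrow> real"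
  have *: "\<bar>f x - \<phi> (p x)\<bar> \<le> h x" if "\<And>k. d \<le> k \<Longrightarrow> x k = 0" for x
  proof (cases "\<forall>k<d. \<bar>x k\<bar> \<le> L")
    case True
    then have "\<bar>f x - p x\<bar> < \<epsilon> / 2" using p(2) that by auto
    then have "\<bar>f x - \<phi> (p x)\<bar> \<le> \<epsilon> / 2" using K[of x] by (auto simp: \<phi>_def abs_if split: if_splits)
    also have "0 \<le> 2 * K / L\<^sup>2 * (\<Sum>k<d. (x k)\<^sup>2)"
      by (intro mult_nonneg_nonneg divide_nonneg_nonneg sum_nonneg) (use K0 in auto)
    then have "\<epsilon> / 2 \<le> h x" by (simp add: h_def)
    finally show ?thesis .
  next
    case False
    then obtain k where k: "k < d" "L < \<bar>x k\<bar>" by auto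
    have "\<bar>f x - \<phi> (p x)\<bar> \<le> 2 * K" using K[of x] \<phi>K[of "p x"] by linarith
    also have "\<dots> = 2 * K / L\<^sup>2 * L\<^sup>2" using L(1) by simp
    also have "\<dots> \<le> 2 * K / L\<^sup>2 * (\<Sum>k<d. (x k)\<^sup>2)"
    proof (rule mult_left_mono)
      have "L\<^sup>2 \<le> (x k)\<^sup>2" using k L by (metis abs_le_square_iff abs_of_pos less_imp_le)
      also have "\<dots> \<le> (\<Sum>k<d. (x k)\<^sup>2)" using k by (intro member_le_sum) auto
      finally show "L\<^sup>2 \<le> (\<Sum>k<d. (x k)\<^sup>2)" .
    qed (use K0 in auto)
    also have "\<dots> \<le> h x" using \<epsilon> by (simp add: h_def)
    finally show ?thesis .
  qed
  have small: "\<epsilon> / 2 + 2 * K / L\<^sup>2 * (d * c) \<le> \<epsilon>"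
  proof -
    have "2 * K / L\<^sup>2 * (d * c) = \<epsilon> / 2 * (K * d * c / (K * d * c + 1))"
      using \<epsilon> \<open>0 \<le> K * d * c\<close> unfolding L(2) by (simp add: field_simps)
    also have "\<dots> \<le> \<epsilon> / 2 * 1"
      using \<epsilon> \<open>0 \<le> K * d * c\<close> by (intro mult_left_mono) auto
    finally show ?thesis by simp
  qed
  have "continuous_on UNIV (\<lambda>x. \<phi> (p x))"
    by (rule continuous_on_compose2[OF \<phi> trig_poly_continuous[OF p(1)]]) auto
  note int = integrable_comp[OF f K] integrable_comp[OF this \<phi>K]
  have ih: "integrable M (\<lambda>\<omega>. h (V n \<omega>))" "integrable N (\<lambda>\<omega>. h (Y \<omega>))" for n
    unfolding h_def using V_square Y_square by auto
  have "(\<integral>\<omega>. h (V n \<omega>) \<partial>M) = \<epsilon> / 2 + 2 * K / L\<^sup>2 * (\<Sum>k<d. \<integral>\<omega>. (V n \<omega> k)\<^sup>2 \<partial>M)" for n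
    unfolding h_def using V_square
    by (subst Bochner_Integration.integral_add) (auto simp: M.prob_space Bochner_Integration.integral_sum)
  also have "\<dots> n \<le> \<epsilon> / 2 + 2 * K / L\<^sup>2 * (\<Sum>k<d. c)" for n
    using V_square(2) K0 by (intro add_left_mono mult_left_mono sum_mono) auto
  finally have "(\<integral>\<omega>. h (V n \<omega>) \<partial>M) \<le> \<epsilon> / 2 + 2 * K / L\<^sup>2 * (\<Sum>k<d. c)" for n .
  then have hV: "(\<integral>\<omega>. h (V n \<omega>) \<partial>M) \<le> \<epsilon>" for n by (rule order_trans) (use small in simp)
  have "(\<integral>\<omega>. h (Y \<omega>) \<partial>N) = \<epsilon> / 2 + 2 * K / L\<^sup>2 * (\<Sum>k<d. \<integral>\<omega>. (Y \<omega> k)\<^sup>2 \<partial>N)"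
    unfolding h_def using Y_square
    by (subst Bochner_Integration.integral_add) (auto simp: N.prob_space Bochner_Integration.integral_sum)
  also have "\<dots> \<le> \<epsilon> / 2 + 2 * K / L\<^sup>2 * (\<Sum>k<d. c)"
    using Y_square(2) K0 by (intro add_left_mono mult_left_mono sum_mono) auto
  finally have hY: "(\<integral>\<omega>. h (Y \<omega>) \<partial>N) \<le> \<epsilon>" using small by simp
  have 1: "\<bar>(\<integral>\<omega>. f (V n \<omega>) \<partial>M) - (\<integral>\<omega>. \<phi> (p (V n \<omega>)) \<partial>M)\<bar> \<le> \<epsilon>" for n
    by (rule order_trans[OF M.abs_expectation_diff_le hV[of n]]) (use int ih * V_zero in auto)
  have 2: "\<bar>(\<integral>\<omega>. f (Y \<omega>) \<partial>N) - (\<integral>\<omega>. \<phi> (p (Y \<omega>)) \<partial>N)\<bar> \<le> \<epsilon>"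
    by (rule order_trans[OF N.abs_expectation_diff_le hY]) (use int ih * Y_zero in auto)
  show "\<exists>x' y'. (\<forall>\<^sub>F n in sequentially. \<bar>(\<integral>\<omega>. f (V n \<omega>) \<partial>M) - x' n\<bar> \<le> \<epsilon>) \<and>
     \<bar>(\<integral>\<omega>. f (Y \<omega>) \<partial>N) - y'\<bar> \<le> \<epsilon> \<and> x' \<longlonglongrightarrow> y'"
    using 1 2 continuous_trig_poly_conv[OF p(1) \<phi>]
    by (intro exI[of _ "\<lambda>n. \<integral>\<omega>. \<phi> (p (V n \<omega>)) \<partial>M"] exI[of _ "\<integral>\<omega>. \<phi> (p (Y \<omega>)) \<partial>N"]) auto
qed

end

section \<open>Gaussian fields and the central limit theorem for linear combinations\<close>

lemma normal_rv_square_integrable: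
  assumes "prob_space N" "normal_rv N Z"
  shows "integrable N (\<lambda>\<omega>. (Z \<omega>)\<^sup>2)"
proof -
  interpret N: prob_space N by fact
  have [measurable]: "Z \<in> borel_measurable N" using assms by (simp add: normal_rv_def)
  from assms(2) consider (const) m where "AE \<omega> in N. Z \<omega> = m"
    | (dens) m \<sigma> where "0 < \<sigma>" "distributed N lborel Z (normal_density m \<sigma>)"
    by (auto simp: normal_rv_def)
  then show ?thesis
  proof cases
    case const
    then have "integrable N (\<lambda>\<omega>. (Z \<omega>)\<^sup>2) \<longleftrightarrow> integrable N (\<lambda>\<omega>. m\<^sup>2)"
      by (intro integrable_cong_AE) (auto elim: eventually_mono)
    then show ?thesis by simp
  next
    case dens
    have "integrable lborel (\<lambda>x. normal_density m \<sigma> x * (x - m)^2)"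
      "integrable lborel (\<lambda>x. normal_density m \<sigma> x * x)" "integrable lborel (normal_density m \<sigma>)"
      using integrable_normal_moment[OF dens(1), of m 2] integrable_normal_moment_nz_1[OF dens(1)] dens(1) by auto
    then have "integrable lborel (\<lambda>x. normal_density m \<sigma> x * (x - m)^2 + (2 * m * (normal_density m \<sigma> x * x) - m\<^sup>2 * normal_density m \<sigma> x))"
      by (intro Bochner_Integration.integrable_add Bochner_Integration.integrable_diff integrable_mult_right) auto
    then have "integrable lborel (\<lambda>x. normal_density m \<sigma> x * x\<^sup>2)"
      by (rule Bochner_Integration.integrable_cong[THEN iffD1, rotated -1]) (auto simp: power2_eq_square algebra_simps)
    then show ?thesis using distributed_integrable[OF dens(2), of "\<lambda>x. x\<^sup>2"] by simp
  qed
qed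

text \<open>The second moment decides between the two alternatives of \<open>normal_rv\<close> and
  determines the law, so that it can be matched with the limit in the central limit theorem.\<close>

lemma normal_rv_centered:
  assumes N: "prob_space N" and Z: "normal_rv N Z" and mean: "(\<integral>\<omega>. Z \<omega> \<partial>N) = 0" and v: "(\<integral>\<omega>. (Z \<omega>)\<^sup>2 \<partial>N) = v"
  shows "0 \<le> v" "v = 0 \<Longrightarrow> AE \<omega> in N. Z \<omega> = 0" "0 < v \<Longrightarrow> distributed N lborel Z (normal_density 0 (sqrt v))"
proof -
  interpret N: prob_space N by fact
  have [measurable]: "Z \<in> borel_measurable N" using Z by (simp add: normal_rv_def)
  show "0 \<le> v" unfolding v[symmetric] by simp
  show "AE \<omega> in N. Z \<omega> = 0" if "v = 0"
    using v that integral_nonneg_eq_0_iff_AE[OF normal_rv_square_integrable[OF N Z]] by simp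
  show "distributed N lborel Z (normal_density 0 (sqrt v))" if v0: "0 < v"
  proof -
    from Z consider (const) m where "AE \<omega> in N. Z \<omega> = m"
      | (dens) m \<sigma> where "0 < \<sigma>" "distributed N lborel Z (normal_density m \<sigma>)"
      by (auto simp: normal_rv_def)
    then show ?thesis
    proof cases
      case const
      have "(\<integral>\<omega>. Z \<omega> \<partial>N) = (\<integral>\<omega>. m \<partial>N)" using const by (intro integral_cong_AE) auto
      with mean have "m = 0" by (simp add: N.prob_space)
      have "(\<integral>\<omega>. (Z \<omega>)\<^sup>2 \<partial>N) = (\<integral>\<omega>. 0 \<partial>N)"
        using const \<open>m = 0\<close> by (intro integral_cong_AE) auto
      with v v0 show ?thesis by simp
    next
      case dens
      have "m = 0"
        using distributed_integral[OF dens(2), of "\<lambda>x. x"] integral_normal_moment_nz_1[OF dens(1), of m] mean by simp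
      have "v = \<sigma>\<^sup>2"
        using distributed_integral[OF dens(2), of "\<lambda>x. x\<^sup>2"] integral_normal_moment_even[OF dens(1), of m 1] v \<open>m = 0\<close>
        by (simp add: fact_numeral)
      then show ?thesis using dens \<open>m = 0\<close> by simp
    qed
  qed
qed

lemma integrable_product_of_squares:
  fixes f g :: "'a \<Rightarrow> real"
  assumes [measurable]: "f \<in> borel_measurable M" "g \<in> borel_measurable M"
    and "integrable M (\<lambda>x. (f x)\<^sup>2)" "integrable M (\<lambda>x. (g x)\<^sup>2)"
  shows "integrable M (\<lambda>x. f x * g x)"
proof (rule Bochner_Integration.integrable_bound)
  show "integrable M (\<lambda>x. (f x)\<^sup>2 + (g x)\<^sup>2)" using assms by auto
  have "\<bar>a * b\<bar> \<le> a\<^sup>2 + b\<^sup>2" for a b :: real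
  proof -
    have "0 \<le> (\<bar>a\<bar> - \<bar>b\<bar>)\<^sup>2" by simp
    then have "2 * \<bar>a * b\<bar> \<le> a\<^sup>2 + b\<^sup>2" by (simp add: power2_diff abs_mult)
    then show ?thesis by (smt (verit) abs_ge_zero)
  qed
  then show "AE x in M. norm (f x * g x) \<le> norm ((f x)\<^sup>2 + (g x)\<^sup>2)"
    by (intro AE_I2) (metis abs_of_nonneg order_trans abs_ge_self real_norm_def)
qed auto

lemma integral_square_sum:
  fixes Y :: "'i \<Rightarrow> 'a \<Rightarrow> real"
  assumes "finite I" "\<And>k l. k \<in> I \<Longrightarrow> l \<in> I \<Longrightarrow> integrable M (\<lambda>\<omega>. Y k \<omega> * Y l \<omega>)"
  shows "integrable M (\<lambda>\<omega>. (\<Sum>k\<in>I. a k * Y k \<omega>)\<^sup>2)"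
    "(\<integral>\<omega>. (\<Sum>k\<in>I. a k * Y k \<omega>)\<^sup>2 \<partial>M) = (\<Sum>k\<in>I. \<Sum>l\<in>I. a k * a l * (\<integral>\<omega>. Y k \<omega> * Y l \<omega> \<partial>M))"
proof -
  have eq: "(\<Sum>k\<in>I. a k * Y k \<omega>)\<^sup>2 = (\<Sum>k\<in>I. \<Sum>l\<in>I. a k * a l * (Y k \<omega> * Y l \<omega>))" for \<omega>
    by (simp add: power2_eq_square sum_product algebra_simps)
  show "integrable M (\<lambda>\<omega>. (\<Sum>k\<in>I. a k * Y k \<omega>)\<^sup>2)"
    unfolding eq using assms by (intro Bochner_Integration.integrable_sum integrable_mult_right) auto
  show "(\<integral>\<omega>. (\<Sum>k\<in>I. a k * Y k \<omega>)\<^sup>2 \<partial>M) = (\<Sum>k\<in>I. \<Sum>l\<in>I. a k * a l * (\<integral>\<omega>. Y k \<omega> * Y l \<omega> \<partial>M))"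
    unfolding eq using assms by (simp add: Bochner_Integration.integral_sum)
qed

definition bridge_cov :: "(real \<Rightarrow> real \<Rightarrow> real) \<Rightarrow> real \<times> real \<Rightarrow> real \<times> real \<Rightarrow> real" where
  "bridge_cov C x y = C (min (fst x) (fst y)) (min (snd x) (snd y)) - C (fst x) (snd x) * C (fst y) (snd y)"

context
  fixes N :: "'b measure" and C B
  assumes N: "prob_space N" and B: "C_bridge N C B"
begin

lemma bridge_normal:
  assumes "finite I" "I \<subseteq> {0..1} \<times> {0..1}"
  shows "normal_rv N (\<lambda>\<omega>. \<Sum>u\<in>I. a u * B u \<omega>)"
  using B assms unfolding C_bridge_def gaussian_field_def by blast

lemma bridge_normal1: "u \<in> {0..1} \<times> {0..1} \<Longrightarrow> normal_rv N (B u)"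
  using bridge_normal[of "{u}" "\<lambda>_. 1"] by simp

lemma bridge_measurable: "u \<in> {0..1} \<times> {0..1} \<Longrightarrow> B u \<in> borel_measurable N"
  using bridge_normal1 by (auto simp: normal_rv_def)

lemma bridge_integrable_mult:
  "u \<in> {0..1} \<times> {0..1} \<Longrightarrow> v \<in> {0..1} \<times> {0..1} \<Longrightarrow> integrable N (\<lambda>\<omega>. B u \<omega> * B v \<omega>)"
  by (intro integrable_product_of_squares bridge_measurable normal_rv_square_integrable[OF N] bridge_normal1)

lemma bridge_expectation_mult:
  assumes "u \<in> {0..1} \<times> {0..1}" "v \<in> {0..1} \<times> {0..1}"
  shows "(\<integral>\<omega>. B u \<omega> * B v \<omega> \<partial>N) = bridge_cov C u v"
proof -
  have "\<forall>x1\<in>{0..1}. \<forall>x2\<in>{0..1}. \<forall>y1\<in>{0..1}. \<forall>y2\<in>{0..1}.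
        cov N (B (x1, x2)) (B (y1, y2)) = C (min x1 y1) (min x2 y2) - C x1 x2 * C y1 y2"
    using B by (simp add: C_bridge_def)
  then have "cov N (B (fst u, snd u)) (B (fst v, snd v)) = bridge_cov C u v"
    unfolding bridge_cov_def using assms unfolding mem_Times_iff by blast
  moreover have "(\<integral>\<omega>. B u \<omega> \<partial>N) = 0" "(\<integral>\<omega>. B v \<omega> \<partial>N) = 0" using B assms by (auto simp: C_bridge_def)
  ultimately show ?thesis by (simp add: cov_def)
qed

lemma bridge_linear_combination:
  fixes a :: "real \<times> real \<Rightarrow> real"
  assumes I: "finite I" "I \<subseteq> {0..1} \<times> {0..1}"
  defines "Z \<equiv> \<lambda>\<omega>. \<Sum>u\<in>I. a u * B u \<omega>"
  shows "normal_rv N Z" "(\<integral>\<omega>. Z \<omega> \<partial>N) = 0"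
    "(\<integral>\<omega>. (Z \<omega>)\<^sup>2 \<partial>N) = (\<Sum>u\<in>I. \<Sum>v\<in>I. a u * a v * bridge_cov C u v)"
proof -
  interpret N: prob_space N by (rule N)
  show "normal_rv N Z" unfolding Z_def by (rule bridge_normal[OF I])
  have "integrable N (B u)" if "u \<in> I" for u
  proof (rule N.square_integrable_imp_integrable)
    have u: "u \<in> {0..1} \<times> {0..1}" using that I by auto
    show "B u \<in> borel_measurable N" by (rule bridge_measurable[OF u])
    show "integrable N (\<lambda>\<omega>. (B u \<omega>)\<^sup>2)" by (rule normal_rv_square_integrable[OF N bridge_normal1[OF u]])
  qed
  then have "(\<integral>\<omega>. Z \<omega> \<partial>N) = (\<Sum>u\<in>I. a u * (\<integral>\<omega>. B u \<omega> \<partial>N))"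
    unfolding Z_def by (subst Bochner_Integration.integral_sum) auto
  also have "\<dots> = 0" using B I by (intro sum.neutral ballI) (auto simp: C_bridge_def)
  finally show "(\<integral>\<omega>. Z \<omega> \<partial>N) = 0" .
  show "(\<integral>\<omega>. (Z \<omega>)\<^sup>2 \<partial>N) = (\<Sum>u\<in>I. \<Sum>v\<in>I. a u * a v * bridge_cov C u v)"
    unfolding Z_def using I
    by (subst integral_square_sum) (auto intro!: bridge_integrable_mult sum.cong bridge_expectation_mult)
qed

end

context copula_sample
begin

definition below :: "nat \<Rightarrow> real \<times> real \<Rightarrow> 'a \<Rightarrow> real" where
  "below i p \<omega> = of_bool (fst (W i \<omega>) \<le> fst p \<and> snd (W i \<omega>) \<le> snd p)"

definition centered :: "nat \<Rightarrow> real \<times> real \<Rightarrow> 'a \<Rightarrow> real" where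
  "centered i p \<omega> = below i p \<omega> - C (fst p) (snd p)"

lemma below_measurable [measurable]: "below i p \<in> borel_measurable M"
  unfolding below_def by measurable

lemma below_integrable [simp]: "integrable M (below i p)"
  by (rule integrable_const_bound[of _ 1]) (auto simp: below_def)

lemma expectation_below:
  assumes "p \<in> {0..1} \<times> {0..1}"
  shows "expectation (below i p) = C (fst p) (snd p)"
proof -
  have "expectation (below i p) = expectation (indicator {\<omega>\<in>space M. fst (W i \<omega>) \<le> fst p \<and> snd (W i \<omega>) \<le> snd p})"
    by (rule Bochner_Integration.integral_cong) (auto simp: below_def indicator_def)
  also have "\<dots> = C (fst p) (snd p)" using W_cdf[of "fst p" "snd p" i] assms by (auto simp: mem_Times_iff)
  finally show ?thesis .
qed

text \<open>Two lower left quadrants intersect in the quadrant of the componentwise minimum; this is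
  the origin of the first term of the covariance.\<close>

lemma below_mult: "below i p \<omega> * below i q \<omega> = below i (min (fst p) (fst q), min (snd p) (snd q)) \<omega>"
  by (auto simp: below_def)

lemma centered_measurable [measurable]: "centered i p \<in> borel_measurable M"
  unfolding centered_def by measurable

lemma expectation_centered:
  assumes "p \<in> {0..1} \<times> {0..1}"
  shows "integrable M (centered i p)" "expectation (centered i p) = 0"
  unfolding centered_def using assms by (simp_all add: expectation_below prob_space)

lemma expectation_centered_mult:
  assumes "p \<in> {0..1} \<times> {0..1}" "q \<in> {0..1} \<times> {0..1}"
  shows "integrable M (\<lambda>\<omega>. centered i p \<omega> * centered i q \<omega>)"
    "expectation (\<lambda>\<omega>. centered i p \<omega> * centered i q \<omega>) = bridge_cov C p q"
proof -
  let ?m = "(min (fst p) (fst q), min (snd p) (snd q))"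
  have m: "?m \<in> {0..1} \<times> {0..1}" using assms by auto
  have eq: "centered i p \<omega> * centered i q \<omega> = below i ?m \<omega> - C (fst q) (snd q) * below i p \<omega>
      - C (fst p) (snd p) * below i q \<omega> + C (fst p) (snd p) * C (fst q) (snd q)" for \<omega>
    unfolding centered_def below_mult[symmetric] by (simp add: algebra_simps)
  show "integrable M (\<lambda>\<omega>. centered i p \<omega> * centered i q \<omega>)" unfolding eq by simp
  show "expectation (\<lambda>\<omega>. centered i p \<omega> * centered i q \<omega>) = bridge_cov C p q"
    unfolding eq by (simp add: expectation_below[OF m] expectation_below[OF assms(1)]
        expectation_below[OF assms(2)] prob_space bridge_cov_def)
qed

lemma eproc_centered: "eproc C n (\<lambda>i. W i \<omega>) p = (\<Sum>i<n. centered i p \<omega>) / sqrt n"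
proof (cases "n = 0")
  case True then show ?thesis by (simp add: eproc_def)
next
  case False
  define r where "r = sqrt (real n)"
  have r: "0 < r" "real n = r * r" using False by (auto simp: r_def)
  define S where "S = (\<Sum>i<n. below i p \<omega>)"
  have 1: "(\<Sum>i<n. centered i p \<omega>) = S - real n * C (fst p) (snd p)" by (simp add: S_def centered_def sum_subtractf)
  have 2: "eproc C n (\<lambda>i. W i \<omega>) p = r * (S / real n - C (fst p) (snd p))"
    by (simp add: eproc_def edf_def S_def below_def r_def del: sum_of_bool_eq)
  show ?thesis using r(1) unfolding 1 2 r_def[symmetric] r(2) by (simp add: field_simps)
qed

lemma indep_comp:
  assumes "h \<in> borel_measurable borel"
  shows "indep_vars (\<lambda>_. borel) (\<lambda>i \<omega>. h (W i \<omega>)) UNIV"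
  by (rule indep_vars_compose2[OF indep, where Y="\<lambda>_. h"]) (use assms in auto)

lemma centered_eq: "centered i p \<omega> = (\<lambda>w. of_bool (fst w \<le> fst p \<and> snd w \<le> snd p) - C (fst p) (snd p)) (W i \<omega>)"
  by (simp add: centered_def below_def)

text \<open>Independence makes the summands uncorrelated, so for n > 0 the second moment is the
  variance of one summand, at most 1. This is the uniform moment bound that \<open>fdd_limit\<close>
  asks for.\<close>

lemma eproc_square:
  assumes p: "p \<in> {0..1} \<times> {0..1}"
  shows "integrable M (\<lambda>\<omega>. (eproc C n (\<lambda>i. W i \<omega>) p)\<^sup>2)" "expectation (\<lambda>\<omega>. (eproc C n (\<lambda>i. W i \<omega>) p)\<^sup>2) \<le> 1"
proof -
  have ind: "indep_vars (\<lambda>_. borel) (\<lambda>i. centered i p) UNIV"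
    unfolding centered_eq by (rule indep_comp) measurable
  have 1: "integrable M (\<lambda>\<omega>. centered i p \<omega> * centered j p \<omega>) \<and>
     expectation (\<lambda>\<omega>. centered i p \<omega> * centered j p \<omega>) = (if i = j then bridge_cov C p p else 0)" for i j
  proof (cases "i = j")
    case True then show ?thesis using expectation_centered_mult[OF p p] by simp
  next
    case False
    have I: "indep_vars (\<lambda>_. borel) (\<lambda>i. centered i p) {i, j}" by (rule indep_vars_subset[OF ind]) auto
    show ?thesis
      using indep_vars_lebesgue_integral[OF _ I] indep_vars_integrable[OF _ I] False expectation_centered[OF p]
      by simp
  qed
  have eq: "(eproc C n (\<lambda>i. W i \<omega>) p)\<^sup>2 = (\<Sum>i<n. 1 * centered i p \<omega>)\<^sup>2 / n" for \<omega>
    by (simp add: eproc_centered power_divide)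
  show "integrable M (\<lambda>\<omega>. (eproc C n (\<lambda>i. W i \<omega>) p)\<^sup>2)"
    unfolding eq using 1 by (intro integrable_divide_zero integral_square_sum) auto
  have "expectation (\<lambda>\<omega>. (eproc C n (\<lambda>i. W i \<omega>) p)\<^sup>2) = (\<Sum>i<n. \<Sum>j<n. if i = j then bridge_cov C p p else 0) / n"
    unfolding eq using 1 by (subst integral_divide_zero, subst integral_square_sum) auto
  also have "\<dots> = (if n = 0 then 0 else bridge_cov C p p)" by simp
  also have "\<dots> \<le> 1"
  proof -
    have "C (fst p) (snd p) \<le> 1" using range[of "fst p" "snd p"] p by (auto simp: mem_Times_iff)
    moreover have "0 \<le> C (fst p) (snd p) * C (fst p) (snd p)" by simp
    ultimately have "bridge_cov C p p \<le> 1" unfolding bridge_cov_def min.idem by linarith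
    then show ?thesis by simp
  qed
  finally show "expectation (\<lambda>\<omega>. (eproc C n (\<lambda>i. W i \<omega>) p)\<^sup>2) \<le> 1" .
qed

text \<open>The combination is a normalised sum of independent, identically distributed, centred
  variables whose variance \<open>v\<close> equals that of the same combination of \<open>B\<close>.
  The limit theorem needs positive variance; for v = 0 both combinations vanish almost surely. Since
  it refers to the standard normal law, the test function is rescaled by \<sigma>.\<close>

lemma clt_linear_combination:
  fixes g :: "real \<Rightarrow> real"
  assumes N: "prob_space N" and B: "C_bridge N C B"
    and I: "finite I" "I \<subseteq> {0..1} \<times> {0..1}"
    and g: "\<And>x. isCont g x" "\<And>x. \<bar>g x\<bar> \<le> K"
  shows "(\<lambda>n. expectation (\<lambda>\<omega>. g (\<Sum>u\<in>I. a u * eproc C n (\<lambda>i. W i \<omega>) u)))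
    \<longlonglongrightarrow> (\<integral>\<omega>. g (\<Sum>u\<in>I. a u * B u \<omega>) \<partial>N)"
proof -
  interpret N: prob_space N by (rule N)
  define v where "v = (\<Sum>u\<in>I. \<Sum>w\<in>I. a u * a w * bridge_cov C u w)"
  define Y where "Y \<omega> = (\<Sum>u\<in>I. a u * B u \<omega>)" for \<omega>
  note Y = bridge_linear_combination[OF N B I, of a, folded Y_def v_def]
  note Yv = normal_rv_centered[OF N Y]
  have [measurable]: "Y \<in> borel_measurable N" using Y(1) by (simp add: normal_rv_def)
  have [measurable]: "g \<in> borel_measurable borel"
    by (intro borel_measurable_continuous_onI continuous_at_imp_continuous_on) (use g in auto)
  define h where "h w = (\<Sum>u\<in>I. a u * (of_bool (fst w \<le> fst u \<and> snd w \<le> snd u) - C (fst u) (snd u)))" for w :: "real \<times> real"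
  have [measurable]: "h \<in> borel_measurable borel" unfolding h_def by measurable
  define Z where "Z i \<omega> = h (W i \<omega>)" for i \<omega>
  have Zc: "Z i \<omega> = (\<Sum>u\<in>I. a u * centered i u \<omega>)" for i \<omega> by (simp add: Z_def h_def centered_def below_def)
  have [measurable]: "Z i \<in> borel_measurable M" for i unfolding Z_def by measurable
  have S: "(\<Sum>u\<in>I. a u * eproc C n (\<lambda>i. W i \<omega>) u) = (\<Sum>i<n. Z i \<omega>) / sqrt n" for n \<omega>
    unfolding Zc eproc_centered by (subst sum.swap) (simp add: sum_distrib_left sum_divide_distrib)
  have Zmean: "integrable M (Z i)" "expectation (Z i) = 0" for i
  proof -
    have c: "integrable M (centered i u)" "expectation (centered i u) = 0" if "u \<in> I" for u
      using expectation_centered[of u i] that I by auto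
    show "integrable M (Z i)" unfolding Zc using c by (intro Bochner_Integration.integrable_sum integrable_mult_right) auto
    have "expectation (Z i) = (\<Sum>u\<in>I. a u * expectation (centered i u))"
      unfolding Zc using c by (subst Bochner_Integration.integral_sum) auto
    then show "expectation (Z i) = 0" using c by simp
  qed
  have Zsq: "integrable M (\<lambda>\<omega>. (Z i \<omega>)\<^sup>2)" "expectation (\<lambda>\<omega>. (Z i \<omega>)\<^sup>2) = v" for i
    unfolding Zc v_def using I integral_square_sum[OF I(1), of M "centered i" a] expectation_centered_mult
    by (auto simp: subset_iff intro!: sum.cong)
  show ?thesis
  proof (cases "v = 0")
    case True
    have "AE \<omega> in M. Z i \<omega> = 0" for i
      using integral_nonneg_eq_0_iff_AE[OF Zsq(1)[of i]] Zsq(2) True by simp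
    then have AE: "AE \<omega> in M. \<forall>i. Z i \<omega> = 0" by (simp add: AE_all_countable)
    have "expectation (\<lambda>\<omega>. g ((\<Sum>i<n. Z i \<omega>) / sqrt n)) = expectation (\<lambda>\<omega>. g 0)" for n
      using AE by (intro integral_cong_AE) (auto elim: eventually_mono)
    moreover have "(\<integral>\<omega>. g (Y \<omega>) \<partial>N) = (\<integral>\<omega>. g 0 \<partial>N)"
      using Yv(2)[OF True] by (intro integral_cong_AE) (auto elim: eventually_mono)
    ultimately show ?thesis unfolding S Y_def[symmetric] by (simp add: prob_space N.prob_space)
  next
    case False
    with Yv(1) have v: "0 < v" by simp
    define \<sigma> where "\<sigma> = sqrt v"
    have \<sigma>: "0 < \<sigma>" "\<sigma>\<^sup>2 = v" using v by (auto simp: \<sigma>_def)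
    have dist: "distr M borel (Z i) = distr M borel (Z 0)" for i
    proof -
      have "distr (distr M borel (W i)) borel h = distr (distr M borel (W 0)) borel h"
        by (simp add: W_distr[of i 0])
      then show ?thesis by (simp add: distr_distr comp_def Z_def[abs_def])
    qed
    have clt: "weak_conv_m (\<lambda>n. distr M borel (\<lambda>\<omega>. (\<Sum>i<n. Z i \<omega>) / sqrt (n * \<sigma>\<^sup>2))) std_normal_distribution"
    proof (rule central_limit_theorem_zero_mean)
      show "indep_vars (\<lambda>i. borel) Z UNIV" unfolding Z_def by (rule indep_comp) measurable
      show "distr M borel (Z n) = distr M borel (Z 0)" for n by (rule dist)
      show "expectation (Z n) = 0" "integrable M (\<lambda>\<omega>. (Z n \<omega>)\<^sup>2)" for n by (rule Zmean Zsq)+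
      then show "expectation (\<lambda>\<omega>. (Z n \<omega> - expectation (Z n))\<^sup>2) = \<sigma>\<^sup>2" for n
        by (simp only: Zmean(2) diff_zero Zsq(2) \<sigma>(2))
    qed (rule \<sigma>(1))
    have "(\<lambda>n. \<integral>x. g (\<sigma> * x) \<partial>distr M borel (\<lambda>\<omega>. (\<Sum>i<n. Z i \<omega>) / sqrt (n * \<sigma>\<^sup>2)))
        \<longlonglongrightarrow> (\<integral>x. g (\<sigma> * x) \<partial>std_normal_distribution)"
    proof (rule weak_conv_imp_integral_bdd_continuous_conv[OF _ real_dist_normal_dist clt])
      show "isCont (\<lambda>x. g (\<sigma> * x)) x" for x
        by (rule isCont_o2[where f="\<lambda>x. \<sigma> * x"]) (auto intro: g(1))
      show "norm (g (\<sigma> * x)) \<le> K" for x using g(2) by simp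
    qed (auto intro!: real_distribution_distr)
    moreover have "(\<integral>x. g (\<sigma> * x) \<partial>distr M borel (\<lambda>\<omega>. (\<Sum>i<n. Z i \<omega>) / sqrt (n * \<sigma>\<^sup>2))) =
        expectation (\<lambda>\<omega>. g ((\<Sum>i<n. Z i \<omega>) / sqrt n))" for n
    proof -
      have "\<sigma> * (t / sqrt (n * \<sigma>\<^sup>2)) = t / sqrt n" for t
        using \<sigma>(1) by (simp add: real_sqrt_mult)
      then show ?thesis by (subst integral_distr) auto
    qed
    moreover have "(\<integral>x. g (\<sigma> * x) \<partial>std_normal_distribution) = (\<integral>\<omega>. g (Y \<omega>) \<partial>N)"
    proof -
      have "distributed N lborel (\<lambda>\<omega>. (Y \<omega> - 0) / \<sigma>) std_normal_density"
        using Yv(3)[OF v] N.normal_standard_normal_convert[OF \<sigma>(1), of Y 0] by (simp add: \<sigma>_def)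
      from distributed_integral[OF this, of "\<lambda>x. g (\<sigma> * x)"]
      have "(\<integral>x. std_normal_density x * g (\<sigma> * x) \<partial>lborel) = (\<integral>\<omega>. g (Y \<omega>) \<partial>N)"
        using \<sigma>(1) by simp
      moreover have "(\<integral>x. g (\<sigma> * x) \<partial>std_normal_distribution) = (\<integral>x. std_normal_density x * g (\<sigma> * x) \<partial>lborel)"
        by (rule integral_real_density) auto
      ultimately show ?thesis by simp
    qed
    ultimately show ?thesis unfolding S Y_def[symmetric] by simp
  qed
qed

end

section \<open>Generic samples and functionals on a grid\<close>

text \<open>Continuity at every path in the values on \<open>I\<close> alone. It includes that
  \<open>F\<close> does not see the path elsewhere, as \<open>grid_continuous_cong\<close>
  shows.\<close>

definition grid_continuous :: "(real \<times> real) set \<Rightarrow> ((real \<times> real \<Rightarrow> real) \<Rightarrow> real) \<Rightarrow> bool" where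
  "grid_continuous I F \<longleftrightarrow> (\<forall>b \<epsilon>. 0 < \<epsilon> \<longrightarrow> (\<exists>\<delta>>0. \<forall>b'. (\<forall>u\<in>I. \<bar>b' u - b u\<bar> \<le> \<delta>) \<longrightarrow> \<bar>F b' - F b\<bar> \<le> \<epsilon>))"

lemma grid_continuous_cong:
  assumes "grid_continuous I F" "\<And>u. u \<in> I \<Longrightarrow> b' u = b u"
  shows "F b' = F b"
proof -
  have "\<bar>F b' - F b\<bar> \<le> 0 + \<epsilon>" if \<epsilon>: "0 < \<epsilon>" for \<epsilon>
  proof -
    obtain \<delta> where "0 < \<delta>" "\<forall>b'. (\<forall>u\<in>I. \<bar>b' u - b u\<bar> \<le> \<delta>) \<longrightarrow> \<bar>F b' - F b\<bar> \<le> \<epsilon>"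
      using assms(1) \<epsilon> unfolding grid_continuous_def by blast
    then show ?thesis using assms(2) by auto
  qed
  then have "\<bar>F b' - F b\<bar> \<le> 0" by (rule field_le_epsilon)
  then show ?thesis by simp
qed

lemma grid_continuous_compose:
  assumes "grid_continuous I F" "continuous_on UNIV (\<phi> :: real \<Rightarrow> real)"
  shows "grid_continuous I (\<lambda>b. \<phi> (F b))"
  unfolding grid_continuous_def
proof (intro allI impI)
  fix b and \<epsilon> :: real assume \<epsilon>: "0 < \<epsilon>"
  have "isCont \<phi> (F b)" using assms(2) by (simp add: continuous_on_eq_continuous_at)
  then obtain r where r: "0 < r" "\<And>t. \<bar>t - F b\<bar> < r \<Longrightarrow> \<bar>\<phi> t - \<phi> (F b)\<bar> < \<epsilon>"
    using \<epsilon> unfolding continuous_at_eps_delta by (metis real_norm_def dist_real_def)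
  obtain \<delta> where "0 < \<delta>" "\<forall>b'. (\<forall>u\<in>I. \<bar>b' u - b u\<bar> \<le> \<delta>) \<longrightarrow> \<bar>F b' - F b\<bar> \<le> r / 2"
    using assms(1) r(1) unfolding grid_continuous_def by (meson half_gt_zero)
  then show "\<exists>\<delta>>0. \<forall>b'. (\<forall>u\<in>I. \<bar>b' u - b u\<bar> \<le> \<delta>) \<longrightarrow> \<bar>\<phi> (F b') - \<phi> (F b)\<bar> \<le> \<epsilon>"
    using r by (intro exI[of _ \<delta>]) (fastforce intro: less_imp_le)
qed

text \<open>An enumeration of \<open>I\<close> turns \<open>F\<close> into a continuous function on
  the sequence space to which \<open>fdd_limit\<close> applies; since the values stay in the range
  of \<open>F\<close>, bounds carry over.\<close>

lemma grid_coordinates: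
  assumes I: "finite I" and F: "grid_continuous I F"
  obtains d p f where "bij_betw p {..<d::nat} I" "continuous_on UNIV f"
    "\<And>b. F b = f (\<lambda>k. if k < d then b (p k) else 0)" "\<And>x :: nat \<Rightarrow> real. f x \<in> range F"
proof -
  obtain p where "bij_betw p {0..<card I} I" using ex_bij_betw_nat_finite[OF I] by auto
  then have p: "bij_betw p {..<card I} I" by (simp add: atLeast0LessThan)
  define d where "d = card I"
  define q where "q = the_inv_into {..<d} p"
  have q: "q u < d" "p (q u) = u" if "u \<in> I" for u
    using p that f_the_inv_into_f_bij_betw[OF p] the_inv_into_into[of p "{..<card I}" u "{..<card I}"]
    by (auto simp: q_def d_def bij_betw_def)
  define f where "f x = F (\<lambda>u. x (q u))" for x :: "nat \<Rightarrow> real"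
  have cont: "continuous_on UNIV f"
    unfolding continuous_on_topological
  proof (intro ballI allI impI)
    fix x and S assume "open S" "f x \<in> S"
    then obtain \<epsilon> where \<epsilon>: "0 < \<epsilon>" "cball (f x) \<epsilon> \<subseteq> S" using open_contains_cball by blast
    obtain \<delta> where \<delta>: "0 < \<delta>" "\<And>b'. (\<forall>u\<in>I. \<bar>b' u - x (q u)\<bar> \<le> \<delta>) \<Longrightarrow> \<bar>F b' - F (\<lambda>u. x (q u))\<bar> \<le> \<epsilon>"
      using F \<epsilon>(1) unfolding grid_continuous_def by meson
    \<comment> \<open>Open in the product topology because only finitely many coordinates are
      constrained.\<close>
    define A where "A = {y :: nat \<Rightarrow> real. \<forall>k\<in>{..<d}. y (id k) \<in> ball (x k) \<delta>}"
    have "open A" unfolding A_def by (rule product_topology_basis') auto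
    moreover have "x \<in> A" using \<delta>(1) by (simp add: A_def)
    moreover have "f y \<in> S" if "y \<in> A" for y
    proof -
      have "\<bar>y (q u) - x (q u)\<bar> \<le> \<delta>" if "u \<in> I" for u
        using \<open>y \<in> A\<close> q(1)[OF that] unfolding A_def
        by (simp add: dist_real_def abs_minus_commute less_imp_le)
      then have "\<bar>f y - f x\<bar> \<le> \<epsilon>" unfolding f_def by (intro \<delta>(2)) auto
      then show ?thesis using \<epsilon>(2) by (auto simp: dist_real_def subset_iff abs_minus_commute)
    qed
    ultimately show "\<exists>A. open A \<and> x \<in> A \<and> (\<forall>y\<in>UNIV. y \<in> A \<longrightarrow> f y \<in> S)" by blast
  qed
  have eq: "F b = f (\<lambda>k. if k < d then b (p k) else 0)" for b
    unfolding f_def by (rule grid_continuous_cong[OF F]) (use q in auto)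
  show ?thesis by (rule that[OF p[folded d_def] cont eq]) (auto simp: f_def)
qed

lemma grid_functional_measurable:
  assumes "finite I" "grid_continuous I F" "\<And>u. u \<in> I \<Longrightarrow> (\<lambda>\<omega>. b \<omega> u) \<in> borel_measurable M"
  shows "(\<lambda>\<omega>. F (b \<omega>)) \<in> borel_measurable M"
proof -
  obtain d p f where *: "bij_betw p {..<d::nat} I" "continuous_on UNIV f"
    "\<And>b. F b = f (\<lambda>k. if k < d then b (p k) else 0)" by (rule grid_coordinates[OF assms(1,2)]) blast
  have [measurable]: "f \<in> borel_measurable borel" by (rule borel_measurable_continuous_onI[OF *(2)])
  have [measurable]: "(\<lambda>\<omega> k. if k < d then b \<omega> (p k) else 0) \<in> borel_measurable M"
  proof (rule measurable_coordinatewise_then_product)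
    fix k show "(\<lambda>\<omega>. if k < d then b \<omega> (p k) else 0) \<in> borel_measurable M"
      using assms(3)[of "p k"] *(1) by (cases "k < d") (auto simp: bij_betw_def)
  qed
  show ?thesis unfolding *(3) by measurable
qed

context copula_sample
begin

theorem grid_expectation_conv:
  assumes N: "prob_space N" and B: "C_bridge N C B"
    and I: "finite I" "I \<subseteq> {0..1} \<times> {0..1}" and F: "grid_continuous I F" "\<And>b. \<bar>F b\<bar> \<le> K"
  shows "(\<lambda>n. expectation (\<lambda>\<omega>. F (eproc C n (\<lambda>i. W i \<omega>)))) \<longlonglongrightarrow> (\<integral>\<omega>. F (\<lambda>u. B u \<omega>) \<partial>N)"
proof -
  interpret N: prob_space N by (rule N)
  obtain d p f where *: "bij_betw p {..<d::nat} I" "continuous_on UNIV f"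
    "\<And>b. F b = f (\<lambda>k. if k < d then b (p k) else 0)" "\<And>x :: nat \<Rightarrow> real. f x \<in> range F"
    by (rule grid_coordinates[OF I(1) F(1)]) blast
  define V where "V n \<omega> k = (if k < d then eproc C n (\<lambda>i. W i \<omega>) (p k) else 0)" for n \<omega> k
  define Y where "Y \<omega> k = (if k < d then B (p k) \<omega> else 0)" for \<omega> k
  have pI: "p k \<in> I" if "k < d" for k using *(1) that by (auto simp: bij_betw_def)
  have pQ: "p k \<in> {0..1} \<times> {0..1}" if "k < d" for k using pI[OF that] I by auto
  have sum_eq: "(\<Sum>k<d. a k * h (p k)) = (\<Sum>u\<in>I. a (the_inv_into {..<d} p u) * h u)" for a h :: "_ \<Rightarrow> real"
    using sum.reindex_bij_betw[OF *(1), of "\<lambda>u. a (the_inv_into {..<d} p u) * h u"] *(1)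
    by (simp add: bij_betw_def the_inv_into_f_f)
  have V_sum: "(\<Sum>k<d. a k * V n \<omega> k) = (\<Sum>u\<in>I. a (the_inv_into {..<d} p u) * eproc C n (\<lambda>i. W i \<omega>) u)" for a n \<omega>
    unfolding sum_eq[symmetric] by (simp add: V_def)
  have Y_sum: "(\<Sum>k<d. a k * Y \<omega> k) = (\<Sum>u\<in>I. a (the_inv_into {..<d} p u) * B u \<omega>)" for a \<omega>
    using sum_eq[of a "\<lambda>u. B u \<omega>"] by (simp add: Y_def)
  interpret fdd_limit M N d V Y 1
  proof
    fix n k a
    show "(\<lambda>\<omega>. V n \<omega> k) \<in> borel_measurable M" unfolding V_def by measurable
    show "(\<lambda>\<omega>. Y \<omega> k) \<in> borel_measurable N"
      using bridge_measurable[OF N B pQ, of k] by (cases "k < d") (auto simp: Y_def)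
    show "integrable M (\<lambda>\<omega>. (V n \<omega> k)\<^sup>2)" "expectation (\<lambda>\<omega>. (V n \<omega> k)\<^sup>2) \<le> 1"
      using eproc_square[of "p k" n] pQ[of k] by (cases "k < d"; simp add: V_def)+
    have "bridge_cov C (p k) (p k) \<le> 1" if "k < d"
    proof -
      have "C (fst (p k)) (snd (p k)) \<le> 1" using range[of "fst (p k)" "snd (p k)"] pQ[OF that] by (auto simp: mem_Times_iff)
      moreover have "0 \<le> C (fst (p k)) (snd (p k)) * C (fst (p k)) (snd (p k))" by simp
      ultimately show ?thesis unfolding bridge_cov_def min.idem by linarith
    qed
    then show "integrable N (\<lambda>\<omega>. (Y \<omega> k)\<^sup>2)" "(\<integral>\<omega>. (Y \<omega> k)\<^sup>2 \<partial>N) \<le> 1"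
      using bridge_integrable_mult[OF N B pQ pQ, of k k] bridge_expectation_mult[OF N B pQ pQ, of k k]
      by (cases "k < d"; simp add: Y_def power2_eq_square)+
    show "(\<lambda>n. expectation (\<lambda>\<omega>. cos (\<Sum>k<d. a k * V n \<omega> k))) \<longlonglongrightarrow> (\<integral>\<omega>. cos (\<Sum>k<d. a k * Y \<omega> k) \<partial>N)"
      unfolding V_sum Y_sum by (rule clt_linear_combination[OF N B I, of _ 1]) auto
    show "(\<lambda>n. expectation (\<lambda>\<omega>. sin (\<Sum>k<d. a k * V n \<omega> k))) \<longlonglongrightarrow> (\<integral>\<omega>. sin (\<Sum>k<d. a k * Y \<omega> k) \<partial>N)"
      unfolding V_sum Y_sum by (rule clt_linear_combination[OF N B I, of _ 1]) auto
  qed (auto simp: V_def Y_def)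
  have "(\<lambda>n. expectation (\<lambda>\<omega>. f (V n \<omega>))) \<longlonglongrightarrow> (\<integral>\<omega>. f (Y \<omega>) \<partial>N)"
    by (rule expectation_conv[OF *(2), of K]) (use *(4) F(2) in \<open>metis imageE\<close>)
  then show ?thesis unfolding *(3) V_def Y_def .
qed

section \<open>Almost sure properties of the transformed sample\<close>

lemma AE_not_below:
  assumes "u \<in> {0..1}" "v \<in> {0..1}" "C u v = 0"
  shows "AE \<omega> in M. \<not> (fst (W i \<omega>) \<le> u \<and> snd (W i \<omega>) \<le> v)"
  using W_cdf[OF assms(1,2), of i] assms(3) by (subst prob_Collect_eq_0[symmetric]) auto

lemma AE_le_1: "AE \<omega> in M. fst (W i \<omega>) \<le> 1 \<and> snd (W i \<omega>) \<le> 1"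
  using W_cdf[of 1 1 i] by (subst prob_Collect_eq_1[symmetric]) auto

lemma AE_unit: "AE \<omega> in M. 0 < fst (W i \<omega>) \<and> fst (W i \<omega>) \<le> 1 \<and> 0 < snd (W i \<omega>) \<and> snd (W i \<omega>) \<le> 1"
  using AE_le_1[of i] AE_not_below[of 0 1 i] AE_not_below[of 1 0 i] by auto

text \<open>The first margin is uniform. A tie puts both values into the same one of
  \<open>m\<close> strips of mass 1 / m, which has probability at most m / m^2 = 1 / m, for every
  \<open>m\<close>.\<close>

lemma AE_fst_distinct:
  assumes "i \<noteq> j"
  shows "AE \<omega> in M. fst (W i \<omega>) \<noteq> fst (W j \<omega>)"
proof -
  let ?E = "{\<omega>\<in>space M. fst (W i \<omega>) = fst (W j \<omega>)}"
  have bound: "prob ?E \<le> 1 / real m" if m: "0 < m" for m :: nat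
  proof -
    define S where "S k = {real k / m<..real (Suc k) / m} \<times> {..1::real}" for k
    have S[measurable]: "S k \<in> sets borel" for k unfolding S_def by (intro borel_Times) auto
    have pS: "prob (W l -` S k \<inter> space M) = 1 / m" if "k < m" for k l
    proof -
      have "real (Suc k) \<le> m" "real k \<le> m" using that by linarith+
      then have "real k / m \<in> {0..1}" "real (Suc k) / m \<in> {0..1}" using m by auto
      then show ?thesis unfolding S_def using m
        by (subst prob_strip) (auto simp: divide_right_mono add_divide_distrib)
    qed
    have pp: "prob ((W i -` S k \<inter> space M) \<inter> (W j -` S k \<inter> space M)) = 1 / m * (1 / m)" if "k < m" for k
    proof -
      have "prob (\<Inter>l\<in>{i, j}. W l -` S k \<inter> space M) = (\<Prod>l\<in>{i, j}. prob (W l -` S k \<inter> space M))"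
        by (rule indep_varsD[OF indep]) auto
      then show ?thesis using pS[OF that] assms by simp
    qed
    have "AE \<omega> in M. \<omega> \<in> ?E \<longrightarrow> \<omega> \<in> (\<Union>k<m. (W i -` S k \<inter> space M) \<inter> (W j -` S k \<inter> space M))"
      using AE_unit[of i] AE_unit[of j] AE_space
    proof eventually_elim
      case (elim \<omega>)
      show ?case
      proof
        assume e: "\<omega> \<in> ?E"
        define t where "t = fst (W i \<omega>)"
        have t: "0 < t" "t \<le> 1" "fst (W j \<omega>) = t" using elim e by (auto simp: t_def)
        \<comment> \<open>Ceiling minus one because the strips are open on the left and closed on
          the right.\<close>
        define k where "k = nat (\<lceil>m * t\<rceil> - 1)"
        have mt: "0 < m * t" "m * t \<le> m" using m t by (auto simp: mult_left_le)
        then have k: "real k = of_int \<lceil>m * t\<rceil> - 1" by (auto simp: k_def)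
        have "real k < m * t" "m * t \<le> real (Suc k)" unfolding k of_nat_Suc by linarith+
        moreover have "k < m" using k mt by linarith
        ultimately have "k < m" "real k / m < t" "t \<le> real (Suc k) / m"
          using m by (simp_all add: field_simps)
        then show "\<omega> \<in> (\<Union>k<m. (W i -` S k \<inter> space M) \<inter> (W j -` S k \<inter> space M))"
          using elim t by (auto simp: S_def mem_Times_iff t_def[symmetric] intro!: bexI[of _ k])
      qed
    qed
    then have "prob ?E \<le> prob (\<Union>k<m. (W i -` S k \<inter> space M) \<inter> (W j -` S k \<inter> space M))"
      by (intro finite_measure_mono_AE) auto
    also have "\<dots> \<le> (\<Sum>k<m. prob ((W i -` S k \<inter> space M) \<inter> (W j -` S k \<inter> space M)))"
      by (intro finite_measure_subadditive_finite) auto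
    also have "\<dots> = 1 / m" using m by (simp add: pp)
    finally show ?thesis .
  qed
  have "prob ?E \<le> 0 + e" if e: "0 < e" for e
  proof -
    obtain m :: nat where "0 < m" "1 / real m < e"
      using e by (metis nat_approx_posE zero_less_Suc)
    then show ?thesis using bound[of m] by simp
  qed
  then have "prob ?E \<le> 0" by (rule field_le_epsilon)
  then have "prob ?E = 0" using measure_nonneg[of M ?E] by linarith
  then show ?thesis by (subst prob_Collect_eq_0[symmetric]) auto
qed

lemma AE_snd_distinct: "i \<noteq> j \<Longrightarrow> AE \<omega> in M. snd (W i \<omega>) \<noteq> snd (W j \<omega>)"
  using copula_sample.AE_fst_distinct[OF flip, of i j] by simp

text \<open>At a zero of \<open>C\<close> no observation lies below, so both \<open>edf\<close> and
  \<open>C\<close> vanish; at (1, 1) both equal 1 (if n > 0). There are only countably many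
  observations, pairs and rational zeros.\<close>

lemma AE_generic:
  "AE \<omega> in M. \<forall>n. generic_sample n (\<lambda>i. W i \<omega>) \<and> tied_down C (eproc C n (\<lambda>i. W i \<omega>))"
proof -
  have 1: "AE \<omega> in M. \<forall>i. 0 < fst (W i \<omega>) \<and> fst (W i \<omega>) \<le> 1 \<and> 0 < snd (W i \<omega>) \<and> snd (W i \<omega>) \<le> 1"
    using AE_unit by (simp add: AE_all_countable)
  have 2: "AE \<omega> in M. \<forall>i j. i \<noteq> j \<longrightarrow> fst (W i \<omega>) \<noteq> fst (W j \<omega>) \<and> snd (W i \<omega>) \<noteq> snd (W j \<omega>)"
    unfolding AE_all_countable
  proof (intro allI)
    fix i j show "AE \<omega> in M. i \<noteq> j \<longrightarrow> fst (W i \<omega>) \<noteq> fst (W j \<omega>) \<and> snd (W i \<omega>) \<noteq> snd (W j \<omega>)"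
      by (cases "i = j") (use AE_fst_distinct[of i j] AE_snd_distinct[of i j] in auto)
  qed
  have 3: "AE \<omega> in M. \<forall>i. \<forall>u\<in>{0..1} \<inter> \<rat>. \<forall>v\<in>{0..1} \<inter> \<rat>. C u v = 0 \<longrightarrow> \<not> (fst (W i \<omega>) \<le> u \<and> snd (W i \<omega>) \<le> v)"
    unfolding AE_all_countable
  proof
    fix i
    have "countable ({0..1::real} \<inter> \<rat>)" using countable_rat by blast
    then show "AE \<omega> in M. \<forall>u\<in>{0..1} \<inter> \<rat>. \<forall>v\<in>{0..1} \<inter> \<rat>. C u v = 0 \<longrightarrow> \<not> (fst (W i \<omega>) \<le> u \<and> snd (W i \<omega>) \<le> v)"
      by (intro AE_ball_countable[THEN iffD2] ballI) (use AE_not_below in auto)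
  qed
  from 1 2 3 show ?thesis
  proof eventually_elim
    case (elim \<omega>)
    show ?case
    proof
      fix n
      have gen: "generic_sample n (\<lambda>i. W i \<omega>)"
        using elim(1,2) unfolding generic_sample_def inj_on_def by (simp add: comp_def) metis
      have z: "eproc C n (\<lambda>i. W i \<omega>) (u, v) = 0"
        if "\<And>i. \<not> (fst (W i \<omega>) \<le> u \<and> snd (W i \<omega>) \<le> v)" "C u v = 0" for u v
        using that by (auto simp: eproc_def edf_def)
      have "eproc C n (\<lambda>i. W i \<omega>) (0, t) = 0 \<and> eproc C n (\<lambda>i. W i \<omega>) (t, 0) = 0" if "t \<in> {0..1}" for t
        using elim(1) that by (intro conjI z) (auto simp: not_le)
      moreover have "eproc C n (\<lambda>i. W i \<omega>) (1, 1) = 0"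
        using elim(1) by (cases "n = 0") (simp_all add: eproc_def edf_def)
      moreover have "eproc C n (\<lambda>i. W i \<omega>) (u, v) = 0"
        if "u \<in> {0..1} \<inter> \<rat>" "v \<in> {0..1} \<inter> \<rat>" "C u v = 0" for u v
        using elim(3) that by (intro z) blast+
      ultimately have "tied_down C (eproc C n (\<lambda>i. W i \<omega>))" unfolding tied_down_def by blast
      with gen show "generic_sample n (\<lambda>i. W i \<omega>) \<and> tied_down C (eproc C n (\<lambda>i. W i \<omega>))" by blast
    qed
  qed
qed

end

section \<open>Measurability, discretised paths and functionals on the cube\<close>

definition unit_clamp :: "real \<Rightarrow> real" where
  "unit_clamp t = max 0 (min 1 t)"

lemma unit_clamp_range [simp]: "unit_clamp t \<in> {0..1}" "0 \<le> unit_clamp t" "unit_clamp t \<le> 1"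
  by (auto simp: unit_clamp_def)

lemma unit_clamp_id [simp]: "t \<in> {0..1} \<Longrightarrow> unit_clamp t = t"
  by (auto simp: unit_clamp_def)

lemma continuous_on_unit_clamp [continuous_intros]:
  "continuous_on S f \<Longrightarrow> continuous_on S (\<lambda>x. unit_clamp (f x))"
  unfolding unit_clamp_def by (intro continuous_intros)

lemma unit_clamp_measurable [measurable]: "unit_clamp \<in> borel_measurable borel"
  unfolding unit_clamp_def by measurable

text \<open>Measurability on the unit cube is expressed through clamping, since the functions of interest
  take junk values outside the cube.\<close>

definition cube_measurable :: "(real \<Rightarrow> real \<Rightarrow> real \<Rightarrow> real) \<Rightarrow> bool" where
  "cube_measurable h \<longleftrightarrow>
     (\<lambda>p. h (unit_clamp (fst p)) (unit_clamp (fst (snd p))) (unit_clamp (snd (snd p)))) \<in> borel_measurable borel"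

definition square_measurable :: "(real \<times> real \<Rightarrow> real) \<Rightarrow> bool" where
  "square_measurable b \<longleftrightarrow> (\<lambda>p. b (unit_clamp (fst p), unit_clamp (snd p))) \<in> borel_measurable borel"

lemma square_measurableD:
  assumes "square_measurable b" "f \<in> borel_measurable M" "g \<in> borel_measurable M"
  shows "(\<lambda>x. b (unit_clamp (f x), unit_clamp (g x))) \<in> borel_measurable M"
proof -
  have "(\<lambda>x. (f x, g x)) \<in> measurable M (borel :: (real \<times> real) measure)"
    using assms by (intro borel_measurable_Pair)
  from measurable_compose[OF this assms(1)[unfolded square_measurable_def]] show ?thesis by simp
qed

lemma square_measurable_continuous:
  assumes "continuous_on ({0..1} \<times> {0..1}) b"
  shows "square_measurable b"
  unfolding square_measurable_def
  by (intro borel_measurable_continuous_onI continuous_on_compose2[OF assms] continuous_intros) auto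

text \<open>The path becomes constant on half-open dyadic cells. As 1 is a grid point of its own,
  the margins b(u, 1) and b(1, v) used by \<open>G_lim\<close> are discretised along the
  edges.\<close>

definition discretize :: "nat \<Rightarrow> (real \<times> real \<Rightarrow> real) \<Rightarrow> real \<times> real \<Rightarrow> real" where
  "discretize m b p = b (real (dyadic m (fst p)) / 2^m, real (dyadic m (snd p)) / 2^m)"

definition dyadic_grid :: "nat \<Rightarrow> (real \<times> real) set" where
  "dyadic_grid m = (\<lambda>(i, j). (real i / 2^m, real j / 2^m)) ` ({..2^m} \<times> {..2^m})"

lemma finite_dyadic_grid: "finite (dyadic_grid m)"
  by (simp add: dyadic_grid_def)

lemma dyadic_grid_subset: "dyadic_grid m \<subseteq> {0..1} \<times> {0..1}"
proof -
  have "real i \<le> 2 ^ m" if "i \<le> 2 ^ m" for i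
    using that by (metis of_nat_le_iff of_nat_numeral of_nat_power)
  then show ?thesis by (auto simp: dyadic_grid_def)
qed

lemma dyadic_in_grid:
  "u \<in> {0..1} \<Longrightarrow> v \<in> {0..1} \<Longrightarrow> (real (dyadic m u) / 2^m, real (dyadic m v) / 2^m) \<in> dyadic_grid m"
  using dyadic_bounds(1)[of u m] dyadic_bounds(1)[of v m] by (force simp: dyadic_grid_def)

lemma dyadic_abs_diff: "u \<in> {0..1} \<Longrightarrow> \<bar>real (dyadic m u) / 2^m - u\<bar> \<le> 1 / 2^m"
  using dyadic_bounds(2,3)[of u m] by (simp add: add_divide_distrib)

lemma dyadic_measurable [measurable]: "dyadic m \<in> measurable borel (count_space UNIV)"
  unfolding dyadic_def by measurable

text \<open>Holds for an arbitrary \<open>b\<close>, since a discretised path factors through a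
  countable set of cell indices.\<close>

lemma square_measurable_discretize: "square_measurable (discretize m b)"
proof -
  have 1: "(\<lambda>p :: real \<times> real. (dyadic m (unit_clamp (fst p)), dyadic m (unit_clamp (snd p)))) \<in>
     measurable borel (count_space UNIV \<Otimes>\<^sub>M count_space UNIV)" by measurable
  have "(\<lambda>p :: real \<times> real. (dyadic m (unit_clamp (fst p)), dyadic m (unit_clamp (snd p)))) \<in> measurable borel (count_space UNIV)"
    using 1 by (subst (asm) pair_measure_countable) auto
  from measurable_compose[OF this, of "\<lambda>(i, j). b (real i / 2^m, real j / 2^m)" borel]
  show ?thesis by (simp add: square_measurable_def discretize_def)
qed

context smooth_copula
begin

lemma C_square_measurable: "square_measurable (\<lambda>p. C (fst p) (snd p))"
  by (rule square_measurable_continuous[OF continuous_on])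

text \<open>Clamping the first coordinate sends everything outside the open strip to 0 or 1, where
  \<open>dC1\<close> is 0 by convention; so the clamped derivative is a continuous function on an
  open set, extended by 0.\<close>

lemma dC1_square_measurable: "square_measurable (\<lambda>p. dC1 C (fst p) (snd p))"
proof -
  let ?A = "{0<..<1::real} \<times> (UNIV :: real set)"
  have "continuous_on ?A (\<lambda>p. (\<lambda>(u, v). dC1 C u v) (fst p, unit_clamp (snd p)))"
    by (intro continuous_on_compose2[OF cont1] continuous_intros) auto
  then have "(\<lambda>p. if p \<in> ?A then dC1 C (fst p) (unit_clamp (snd p)) else 0) \<in> borel_measurable borel"
    by (intro borel_measurable_continuous_on_if) (auto intro!: borel_Times)
  also have "(\<lambda>p. if p \<in> ?A then dC1 C (fst p) (unit_clamp (snd p)) else 0) =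
      (\<lambda>p. dC1 C (unit_clamp (fst p)) (unit_clamp (snd p)))"
    by (auto simp: fun_eq_iff dC1_def unit_clamp_def)
  finally show ?thesis by (simp add: square_measurable_def)
qed

lemma dC2_square_measurable: "square_measurable (\<lambda>p. dC2 C (fst p) (snd p))"
proof -
  let ?A = "(UNIV :: real set) \<times> {0<..<1::real}"
  have "continuous_on ?A (\<lambda>p. (\<lambda>(u, v). dC1 (\<lambda>u v. C v u) u v) (snd p, unit_clamp (fst p)))"
    by (intro continuous_on_compose2[OF flip.cont1] continuous_intros) auto
  then have "(\<lambda>p. if p \<in> ?A then dC2 C (unit_clamp (fst p)) (snd p) else 0) \<in> borel_measurable borel"
    unfolding dC2_eq by (intro borel_measurable_continuous_on_if) (auto intro!: borel_Times)
  also have "(\<lambda>p. if p \<in> ?A then dC2 C (unit_clamp (fst p)) (snd p) else 0) =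
      (\<lambda>p. dC2 C (unit_clamp (fst p)) (unit_clamp (snd p)))"
    by (auto simp: fun_eq_iff dC2_def unit_clamp_def)
  finally show ?thesis by (simp add: square_measurable_def)
qed

lemma G_lim_square_measurable:
  assumes "square_measurable b"
  shows "square_measurable (\<lambda>p. G_lim C b (fst p) (snd p))"
proof -
  have "(\<lambda>p. b (unit_clamp (fst p), unit_clamp (snd p))) \<in> borel_measurable borel"
    "(\<lambda>p. b (unit_clamp (fst p), unit_clamp 1)) \<in> borel_measurable borel"
    "(\<lambda>p. b (unit_clamp 1, unit_clamp (snd p))) \<in> borel_measurable borel"
    by (rule square_measurableD[OF assms]; measurable)+
  moreover have "(\<lambda>p. dC1 C (unit_clamp (fst p)) (unit_clamp (snd p))) \<in> borel_measurable borel"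
    "(\<lambda>p. dC2 C (unit_clamp (fst p)) (unit_clamp (snd p))) \<in> borel_measurable borel"
    using dC1_square_measurable dC2_square_measurable by (simp_all add: square_measurable_def)
  ultimately show ?thesis
    unfolding square_measurable_def G_lim_def fst_conv snd_conv
    by (intro borel_measurable_diff borel_measurable_times) simp_all
qed

lemma H_lim_cube_measurable:
  assumes b: "square_measurable b"
  shows "cube_measurable (H_lim C b)"
proof -
  define x y z :: "real \<times> real \<times> real \<Rightarrow> real" where "x p = unit_clamp (fst p)" and
    "y p = unit_clamp (fst (snd p))" and "z p = unit_clamp (snd (snd p))" for p
  have m[measurable]: "x \<in> borel_measurable borel" "y \<in> borel_measurable borel" "z \<in> borel_measurable borel"
    unfolding x_def y_def z_def by (intro borel_measurable_continuous_onI continuous_intros)+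
  have in01: "x p \<in> {0..1}" "y p \<in> {0..1}" "z p \<in> {0..1}" for p by (simp_all add: x_def y_def z_def)
  have C01: "C (y p) (z p) \<in> {0..1}" "C (x p) (y p) \<in> {0..1}" for p using range in01 by blast+
  \<comment> \<open>The inner arguments of \<open>H_lim\<close>, including the values of
    \<open>C\<close>, stay in [0, 1], so clamping leaves them unchanged.\<close>
  have comp: "(\<lambda>p. f (g p, h p)) \<in> borel_measurable borel"
    if "square_measurable f" "g \<in> borel_measurable borel" "h \<in> borel_measurable borel"
      "\<And>p. g p \<in> {0..1}" "\<And>p. h p \<in> {0..1}" for f and g h :: "real \<times> real \<times> real \<Rightarrow> real"
    using square_measurableD[OF that(1-3)] that(4,5) by simp
  have c1: "(\<lambda>p. C (y p) (z p)) \<in> borel_measurable borel" "(\<lambda>p. C (x p) (y p)) \<in> borel_measurable borel"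
    using comp[OF C_square_measurable, of y z] comp[OF C_square_measurable, of x y] m in01 by simp_all
  note G = comp[OF G_lim_square_measurable[OF b], simplified fst_conv snd_conv]
  have "(\<lambda>p. H_lim C b (x p) (y p) (z p)) \<in> borel_measurable borel"
    unfolding H_lim_def
    using G[OF m(1) c1(1) in01(1) C01(1)] G[OF c1(2) m(3) C01(2) in01(3)] G[OF m(2,3) in01(2,3)] G[OF m(1,2) in01(1,2)]
      comp[OF dC2_square_measurable m(1) c1(1) in01(1) C01(1)] comp[OF dC1_square_measurable c1(2) m(3) C01(2) in01(3)]
    by (intro borel_measurable_diff borel_measurable_add borel_measurable_times) simp_all
  then show ?thesis by (simp add: cube_measurable_def x_def y_def z_def)
qed

end

lemma H_emp_cube_measurable: "cube_measurable (H_emp n s)"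
proof (cases "n = 0")
  case True then show ?thesis by (simp add: cube_measurable_def H_emp_def)
next
  case False
  have comp: "(\<lambda>p. emp_copula n s (g p) (h p)) \<in> borel_measurable borel"
    if [measurable]: "g \<in> borel_measurable borel" "h \<in> borel_measurable borel" for g h :: "real \<times> real \<times> real \<Rightarrow> real"
    using False by (simp only: emp_copula_rank neq0_conv) measurable
  have m: "(\<lambda>p :: real \<times> real \<times> real. unit_clamp (fst p)) \<in> borel_measurable borel"
     "(\<lambda>p :: real \<times> real \<times> real. unit_clamp (fst (snd p))) \<in> borel_measurable borel"
     "(\<lambda>p :: real \<times> real \<times> real. unit_clamp (snd (snd p))) \<in> borel_measurable borel"
    by (intro borel_measurable_continuous_onI continuous_intros)+
  show ?thesis unfolding cube_measurable_def H_emp_def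
    by (intro borel_measurable_times borel_measurable_diff borel_measurable_const comp m)
qed

text \<open>\<open>H_emp\<close> depends on the sample only through the two order relations on the
  indices, of which there are finitely many. Hence any functional of it is measurable, suprema over
  uncountable sets included.\<close>

lemma H_emp_functional_measurable:
  assumes X[measurable]: "\<And>i. X i \<in> borel_measurable M"
  shows "(\<lambda>\<omega>. \<Phi> (H_emp n (\<lambda>i. X i \<omega>)) :: real) \<in> borel_measurable M"
proof -
  define ord where "ord s = ({(i, j). i < n \<and> j < n \<and> fst (s i :: real \<times> real) < (fst (s j) :: real)},
     {(i, j). i < n \<and> j < n \<and> snd (s i) < (snd (s j) :: real)})" for s
  have e: "emp_copula n s = emp_copula n t" if "ord s = ord t" for s t
    by (rule emp_copula_cong_order) (use that in \<open>auto simp: ord_def set_eq_iff\<close>)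
  have H: "H_emp n s = H_emp n t" if "ord s = ord t" for s t
    using e[OF that] by (simp add: fun_eq_iff H_emp_def)
  \<comment> \<open>Evaluates \<Phi> at some sample with the given order relations.\<close>
  define G where "G O' = \<Phi> (H_emp n (SOME s. ord s = O'))" for O'
  have G: "\<Phi> (H_emp n s) = G (ord s)" for s
    unfolding G_def by (rule arg_cong[where f=\<Phi>], rule H, rule someI[where P="\<lambda>t. ord t = ord s", symmetric]) simp
  define P where "P = Pow ({..<n} \<times> {..<n}) \<times> Pow ({..<n} \<times> {..<n})"
  have "(\<lambda>\<omega>. ord (\<lambda>i. X i \<omega>)) \<in> measurable M (count_space P)"
  proof (subst measurable_count_space_eq2)
    show "finite P" by (simp add: P_def)
    show "(\<lambda>\<omega>. ord (\<lambda>i. X i \<omega>)) \<in> space M \<rightarrow> P \<and> (\<forall>a\<in>P. (\<lambda>\<omega>. ord (\<lambda>i. X i \<omega>)) -` {a} \<inter> space M \<in> sets M)"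
    proof (intro conjI ballI)
      fix a assume a: "a \<in> P"
      have "(\<lambda>\<omega>. ord (\<lambda>i. X i \<omega>)) -` {a} \<inter> space M =
        {\<omega> \<in> space M. \<forall>i j. ((i < n \<and> j < n \<and> fst (X i \<omega>) < fst (X j \<omega>)) \<longleftrightarrow> (i, j) \<in> fst a) \<and>
           ((i < n \<and> j < n \<and> snd (X i \<omega>) < snd (X j \<omega>)) \<longleftrightarrow> (i, j) \<in> snd a)}"
        by (cases a) (auto simp: ord_def set_eq_iff)
      also have "\<dots> \<in> sets M" by measurable
      finally show "(\<lambda>\<omega>. ord (\<lambda>i. X i \<omega>)) -` {a} \<inter> space M \<in> sets M" .
    qed (auto simp: ord_def P_def)
  qed
  then have "(\<lambda>\<omega>. G (ord (\<lambda>i. X i \<omega>))) \<in> borel_measurable M"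
    by (rule measurable_compose) simp
  then show ?thesis by (simp add: G)
qed

text \<open>Uniform continuity on balls of the supremum norm, the common feature of both test
  statistics. The bound \<open>L\<close> is there because squaring is not uniformly continuous on
  the whole line, and measurability because of the integral.\<close>

definition cube_functional :: "((real \<Rightarrow> real \<Rightarrow> real \<Rightarrow> real) \<Rightarrow> real) \<Rightarrow> bool" where
  "cube_functional \<Phi> \<longleftrightarrow> (\<forall>L>0. \<forall>\<epsilon>>0. \<exists>\<delta>>0. \<forall>h g. cube_measurable h \<longrightarrow> cube_measurable g \<longrightarrow>
     (\<forall>x\<in>{0..1}. \<forall>y\<in>{0..1}. \<forall>z\<in>{0..1}. \<bar>h x y z\<bar> \<le> L \<and> \<bar>g x y z\<bar> \<le> L \<and> \<bar>h x y z - g x y z\<bar> \<le> \<delta>) \<longrightarrow>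
     \<bar>\<Phi> h - \<Phi> g\<bar> \<le> \<epsilon>)"

lemma cube_functionalE:
  assumes "cube_functional \<Phi>" "0 < L" "0 < \<epsilon>"
  obtains \<delta> where "0 < \<delta>" "\<And>h g. cube_measurable h \<Longrightarrow> cube_measurable g \<Longrightarrow>
     (\<And>x y z. x \<in> {0..1} \<Longrightarrow> y \<in> {0..1} \<Longrightarrow> z \<in> {0..1} \<Longrightarrow> \<bar>h x y z\<bar> \<le> L \<and> \<bar>g x y z\<bar> \<le> L \<and> \<bar>h x y z - g x y z\<bar> \<le> \<delta>) \<Longrightarrow>
     \<bar>\<Phi> h - \<Phi> g\<bar> \<le> \<epsilon>"
proof -
  note * = assms(1)[unfolded cube_functional_def, THEN spec, THEN mp, OF assms(2), THEN spec, THEN mp, OF assms(3)]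
  from * obtain \<delta> where \<delta>: "0 < \<delta>" and close: "\<forall>h g. cube_measurable h \<longrightarrow> cube_measurable g \<longrightarrow>
     (\<forall>x\<in>{0..1}. \<forall>y\<in>{0..1}. \<forall>z\<in>{0..1}. \<bar>h x y z\<bar> \<le> L \<and> \<bar>g x y z\<bar> \<le> L \<and> \<bar>h x y z - g x y z\<bar> \<le> \<delta>) \<longrightarrow>
     \<bar>\<Phi> h - \<Phi> g\<bar> \<le> \<epsilon>"
    by (elim exE conjE)
  show ?thesis
    by (rule that[OF \<delta>], rule close[THEN spec, THEN spec, THEN mp, THEN mp, THEN mp]) simp_all
qed

lemma bounded_path_discretize: "bounded_path L b \<Longrightarrow> bounded_path L (discretize m b)"
  unfolding bounded_path_def discretize_def fst_conv snd_conv using dyadic_bounds(4) by blast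

lemma osc_le_discretize:
  assumes "osc_le (1 / 2^m) \<eta> b" "m \<le> k"
  shows "bounded_path \<eta> (\<lambda>p. b p - discretize k b p)"
  unfolding bounded_path_def discretize_def
proof (intro ballI)
  fix u v :: real assume uv: "u \<in> {0..1}" "v \<in> {0..1}"
  have "(2::real) ^ m \<le> 2 ^ k" using assms(2) by (intro power_increasing) auto
  then have "1 / 2 ^ k \<le> (1 / 2 ^ m :: real)" by (intro divide_left_mono) auto
  then have "\<bar>u - real (dyadic k u) / 2^k\<bar> \<le> 1 / 2^m" "\<bar>v - real (dyadic k v) / 2^k\<bar> \<le> 1 / 2^m"
    using dyadic_abs_diff[OF uv(1), of k] dyadic_abs_diff[OF uv(2), of k] by linarith+
  then show "\<bar>b (u, v) - b (real (dyadic k (fst (u, v))) / 2^k, real (dyadic k (snd (u, v))) / 2^k)\<bar> \<le> \<eta>"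
    unfolding fst_conv snd_conv using uv by (intro osc_leD[OF assms(1)] dyadic_bounds(4))
qed

lemma continuous_osc_le:
  assumes "continuous_on ({0..1} \<times> {0..1}) b" "0 < \<eta>"
  obtains m where "osc_le (1 / 2^m) \<eta> b"
proof -
  have "uniformly_continuous_on ({0..1} \<times> {0..1}) b"
    using assms(1) by (intro compact_uniformly_continuous compact_Times) auto
  then obtain d where d: "0 < d" "\<And>p q. p \<in> {0..1} \<times> {0..1} \<Longrightarrow> q \<in> {0..1} \<times> {0..1} \<Longrightarrow> dist q p < d \<Longrightarrow> dist (b q) (b p) < \<eta>"
    using assms(2) unfolding uniformly_continuous_on_def by metis
  have "(\<lambda>m. 1 / (2::real) ^ m) \<longlonglongrightarrow> 0"
    using LIMSEQ_inverse_realpow_zero[of 2] by (simp add: inverse_eq_divide)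
  from order_tendstoD(2)[OF this, of "d/2"] d(1) obtain m where m: "1 / (2::real) ^ m < d / 2"
    by (auto simp: eventually_sequentially)
  show ?thesis
  proof (rule that[of m], unfold osc_le_def, intro ballI impI)
    fix u u' v v' :: real assume *: "u \<in> {0..1}" "u' \<in> {0..1}" "v \<in> {0..1}" "v' \<in> {0..1}"
      "\<bar>u' - u\<bar> \<le> 1 / 2^m" "\<bar>v' - v\<bar> \<le> 1 / 2^m"
    have "dist (u', v') (u, v) \<le> dist u' u + dist v' v"
      unfolding dist_Pair_Pair by (rule sqrt_sum_squares_le_sum) auto
    also have "\<dots> < d" using * m by (auto simp: dist_real_def)
    finally show "\<bar>b (u', v') - b (u, v)\<bar> \<le> \<eta>"
      using d(2)[of "(u, v)" "(u', v')"] * by (auto simp: dist_real_def)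
  qed
qed

lemma continuous_bounded_path:
  assumes "continuous_on ({0..1} \<times> {0..1}) b"
  obtains L where "0 < L" "bounded_path L b"
proof -
  have "compact (b ` ({0..1} \<times> {0..1}))" by (intro compact_continuous_image assms compact_Times) auto
  then obtain L where "\<And>p. p \<in> {0..1} \<times> {0..1} \<Longrightarrow> \<bar>b p\<bar> \<le> L"
    using compact_imp_bounded[of "b ` ({0..1} \<times> {0..1})"] unfolding bounded_iff by force
  then have "bounded_path (\<bar>L\<bar> + 1) b" by (fastforce simp: bounded_path_def)
  then show ?thesis by (intro that[of "\<bar>L\<bar> + 1"]) auto
qed

context smooth_copula
begin

text \<open>\<open>H_lim\<close> is Lipschitz with constant 12 in the path, and a discretised path
  takes its values from the grid.\<close>

lemma grid_continuous_functional:
  assumes \<Phi>: "cube_functional \<Phi>"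
  shows "grid_continuous (dyadic_grid m) (\<lambda>b. \<Phi> (H_lim C (discretize m b)))"
  unfolding grid_continuous_def
proof (intro allI impI)
  fix b :: "real \<times> real \<Rightarrow> real" and \<epsilon> :: real assume \<epsilon>: "0 < \<epsilon>"
  define L where "L = Max ((\<lambda>u. \<bar>b u\<bar>) ` dyadic_grid m) + 1"
  have ne: "dyadic_grid m \<noteq> {}" by (auto simp: dyadic_grid_def)
  have L: "\<bar>b u\<bar> + 1 \<le> L" if "u \<in> dyadic_grid m" for u
    unfolding L_def using that finite_dyadic_grid by (auto intro!: Max_ge)
  obtain u0 where "u0 \<in> dyadic_grid m" using ne by blast
  then have L0: "0 < L" using L[of u0] by linarith
  then have "0 < 12 * L" by simp
  from cube_functionalE[OF \<Phi> this \<epsilon>] obtain \<delta> where \<delta>: "0 < \<delta>" "\<And>h g. cube_measurable h \<Longrightarrow> cube_measurable g \<Longrightarrow>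
     (\<And>x y z. x \<in> {0..1} \<Longrightarrow> y \<in> {0..1} \<Longrightarrow> z \<in> {0..1} \<Longrightarrow> \<bar>h x y z\<bar> \<le> 12 * L \<and> \<bar>g x y z\<bar> \<le> 12 * L \<and> \<bar>h x y z - g x y z\<bar> \<le> \<delta>) \<Longrightarrow>
     \<bar>\<Phi> h - \<Phi> g\<bar> \<le> \<epsilon>" by blast
  show "\<exists>\<delta>>0. \<forall>b'. (\<forall>u\<in>dyadic_grid m. \<bar>b' u - b u\<bar> \<le> \<delta>) \<longrightarrow>
      \<bar>\<Phi> (H_lim C (discretize m b')) - \<Phi> (H_lim C (discretize m b))\<bar> \<le> \<epsilon>"
  \<comment> \<open>The 1 keeps \<open>b'\<close> below the same bound L = max + 1 as
    \<open>b\<close>; the 12 is the Lipschitz constant of \<open>H_lim\<close>.\<close>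
  proof (intro exI[of _ "min 1 (\<delta> / 12)"] conjI allI impI)
    fix b' assume b': "\<forall>u\<in>dyadic_grid m. \<bar>b' u - b u\<bar> \<le> min 1 (\<delta> / 12)"
    have "\<bar>b' u\<bar> \<le> L" "\<bar>b u\<bar> \<le> L" if "u \<in> dyadic_grid m" for u
      using b' L[OF that] that by fastforce+
    then have bd: "bounded_path L (discretize m b')" "bounded_path L (discretize m b)"
      using dyadic_in_grid by (auto simp: bounded_path_def discretize_def)
    have diff: "bounded_path (\<delta> / 12) (\<lambda>p. discretize m b' p - discretize m b p)"
      using b' dyadic_in_grid by (auto simp: bounded_path_def discretize_def)
    show "\<bar>\<Phi> (H_lim C (discretize m b')) - \<Phi> (H_lim C (discretize m b))\<bar> \<le> \<epsilon>"
    proof (rule \<delta>(2))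
      fix x y z :: real assume *: "x \<in> {0..1}" "y \<in> {0..1}" "z \<in> {0..1}"
      show "\<bar>H_lim C (discretize m b') x y z\<bar> \<le> 12 * L \<and> \<bar>H_lim C (discretize m b) x y z\<bar> \<le> 12 * L \<and>
         \<bar>H_lim C (discretize m b') x y z - H_lim C (discretize m b) x y z\<bar> \<le> \<delta>"
        using H_lim_abs_le[OF bd(1) *] H_lim_abs_le[OF bd(2) *] H_lim_abs_le[OF diff *]
        by (simp add: H_lim_diff)
    qed (intro H_lim_cube_measurable square_measurable_discretize)+
  qed (use \<delta> in auto)
qed

text \<open>Used path by path for \<open>B\<close>: it yields the convergence of the grid
  functionals to the limit variable and also the measurability of the latter.\<close>

lemma functional_discretize_tendsto:
  assumes \<Phi>: "cube_functional \<Phi>" and b: "continuous_on ({0..1} \<times> {0..1}) b"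
  shows "(\<lambda>m. \<Phi> (H_lim C (discretize m b))) \<longlonglongrightarrow> \<Phi> (H_lim C b)"
proof (rule LIMSEQ_I)
  fix r :: real assume r: "0 < r"
  obtain L where L: "0 < L" "bounded_path L b" by (rule continuous_bounded_path[OF b])
  have "0 < 12 * L" "0 < r / 2" using L r by auto
  from cube_functionalE[OF \<Phi> this] obtain \<delta> where \<delta>: "0 < \<delta>" "\<And>h g. cube_measurable h \<Longrightarrow> cube_measurable g \<Longrightarrow>
     (\<And>x y z. x \<in> {0..1} \<Longrightarrow> y \<in> {0..1} \<Longrightarrow> z \<in> {0..1} \<Longrightarrow> \<bar>h x y z\<bar> \<le> 12 * L \<and> \<bar>g x y z\<bar> \<le> 12 * L \<and> \<bar>h x y z - g x y z\<bar> \<le> \<delta>) \<Longrightarrow>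
     \<bar>\<Phi> h - \<Phi> g\<bar> \<le> r / 2" by blast
  obtain m0 where m0: "osc_le (1 / 2^m0) (\<delta> / 12) b"
    by (rule continuous_osc_le[OF b, of "\<delta> / 12"]) (use \<delta> in auto)
  show "\<exists>m0. \<forall>m\<ge>m0. norm (\<Phi> (H_lim C (discretize m b)) - \<Phi> (H_lim C b)) < r"
  proof (intro exI[of _ m0] allI impI)
    fix m assume m: "m0 \<le> m"
    have diff: "bounded_path (\<delta> / 12) (\<lambda>p. b p - discretize m b p)" by (rule osc_le_discretize[OF m0 m])
    have "\<bar>\<Phi> (H_lim C b) - \<Phi> (H_lim C (discretize m b))\<bar> \<le> r / 2"
    proof (rule \<delta>(2))
      fix x y z :: real assume *: "x \<in> {0..1}" "y \<in> {0..1}" "z \<in> {0..1}"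
      show "\<bar>H_lim C b x y z\<bar> \<le> 12 * L \<and> \<bar>H_lim C (discretize m b) x y z\<bar> \<le> 12 * L \<and>
         \<bar>H_lim C b x y z - H_lim C (discretize m b) x y z\<bar> \<le> \<delta>"
        using H_lim_abs_le[OF L(2) *] H_lim_abs_le[OF bounded_path_discretize[OF L(2)] *] H_lim_abs_le[OF diff *]
        by (simp add: H_lim_diff)
    qed (intro H_lim_cube_measurable square_measurable_discretize square_measurable_continuous b)+
    then show "norm (\<Phi> (H_lim C (discretize m b)) - \<Phi> (H_lim C b)) < r"
      using r by (simp add: abs_minus_commute)
  qed
qed

end

section \<open>Convergence of functionals and the main theorem\<close>

lemma cts_step_bounds: "a < b \<Longrightarrow> 0 \<le> cts_step a b x \<and> cts_step a b x \<le> 1"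
  by (auto simp: cts_step_def field_simps)

locale smooth_copula_sample = copula_sample M C W + smooth_copula C
  for M :: "'a measure" and C and W
begin

text \<open>The statistic \<open>Y n\<close> is compared with the grid functional
  \<open>T m n\<close> of the empirical process, which converges to \<open>Zm m\<close> for fixed
  \<open>m\<close>, which in turn approaches \<open>Z\<close>. The tests \<open>cts_step\<close> are
  bounded and uniformly continuous and determine weak convergence.\<close>

theorem functional_clt:
  fixes N :: "'b measure"
  assumes assoc: "\<And>x y z. x \<in> {0..1} \<Longrightarrow> y \<in> {0..1} \<Longrightarrow> z \<in> {0..1} \<Longrightarrow> C x (C y z) = C (C x y) z"
    and N: "prob_space N" and B: "C_bridge N C B" and \<Phi>: "cube_functional \<Phi>"
    and X[measurable]: "\<And>i. X i \<in> borel_measurable M"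
    and eq: "AE \<omega> in M. \<forall>n. emp_copula n (\<lambda>i. X i \<omega>) = emp_copula n (\<lambda>i. W i \<omega>)"
  shows "converges_weakly M (\<lambda>n \<omega>. \<Phi> (H_emp n (\<lambda>i. X i \<omega>))) N (\<lambda>\<omega>. \<Phi> (H_lim C (\<lambda>u. B u \<omega>)))"
proof -
  interpret N: prob_space N by (rule N)
  define Y where "Y n \<omega> = \<Phi> (H_emp n (\<lambda>i. X i \<omega>))" for n \<omega>
  define T where "T m n \<omega> = \<Phi> (H_lim C (discretize m (eproc C n (\<lambda>i. W i \<omega>))))" for m n \<omega>
  define Z where "Z \<omega> = \<Phi> (H_lim C (\<lambda>u. B u \<omega>))" for \<omega>
  define Zm where "Zm m \<omega> = \<Phi> (H_lim C (discretize m (\<lambda>u. B u \<omega>)))" for m \<omega>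
  have [measurable]: "Y n \<in> borel_measurable M" for n unfolding Y_def by (rule H_emp_functional_measurable[OF X])
  note grid = finite_dyadic_grid grid_continuous_functional[OF \<Phi>]
  have [measurable]: "T m n \<in> borel_measurable M" for m n
    unfolding T_def by (rule grid_functional_measurable[OF grid]) measurable
  have [measurable]: "Zm m \<in> borel_measurable N" for m
    unfolding Zm_def
    by (rule grid_functional_measurable[OF grid], rule bridge_measurable[OF N B]) (use dyadic_grid_subset in blast)
  have paths: "continuous_on ({0..1} \<times> {0..1}) (\<lambda>u. B u \<omega>)" if "\<omega> \<in> space N" for \<omega>
    using B that by (simp add: C_bridge_def)
  have ZmZ: "(\<lambda>m. Zm m \<omega>) \<longlonglongrightarrow> Z \<omega>" if "\<omega> \<in> space N" for \<omega>
    unfolding Zm_def Z_def by (rule functional_discretize_tendsto[OF \<Phi> paths[OF that]])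
  have [measurable]: "Z \<in> borel_measurable N"
    by (rule borel_measurable_LIMSEQ_real[OF ZmZ]) auto
  have conv: "(\<lambda>n. expectation (\<lambda>\<omega>. cts_step x y (Y n \<omega>))) \<longlonglongrightarrow> N.expectation (\<lambda>\<omega>. cts_step x y (Z \<omega>))"
    if xy: "x < y" for x y
  proof (rule tendsto_of_approximations)
    fix \<epsilon> :: real assume \<epsilon>: "0 < \<epsilon>"
    define \<phi> where "\<phi> = cts_step x y"
    have \<phi>01: "0 \<le> \<phi> t" "\<phi> t \<le> 1" for t using cts_step_bounds[OF xy] by (auto simp: \<phi>_def)
    have uc: "uniformly_continuous_on UNIV \<phi>" unfolding \<phi>_def by (rule cts_step_uniformly_continuous[OF xy])
    then have cont: "continuous_on UNIV \<phi>" by (rule uniformly_continuous_imp_continuous)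
    have [measurable]: "\<phi> \<in> borel_measurable borel" by (rule borel_measurable_continuous_onI[OF cont])
    obtain r where r: "0 < r" "\<And>s t. \<bar>s - t\<bar> < r \<Longrightarrow> \<bar>\<phi> s - \<phi> t\<bar> < \<epsilon> / 3"
      using uc \<epsilon> unfolding uniformly_continuous_on_def dist_real_def
      by (metis UNIV_I zero_less_divide_iff zero_less_numeral)
    \<comment> \<open>This first use, with oscillation bound 1, only serves to bound the path by L =
      2^m1. The bound must be known before \<delta>, on which \<eta> and the finer scale
      \<open>m2\<close> depend.\<close>
    obtain m1 where m1: "\<forall>\<^sub>F n in sequentially. \<exists>A\<in>events. 1 - \<epsilon> / 6 \<le> prob A \<and>
        (\<forall>\<omega>\<in>A. osc_le (1 / 2^m1) 1 (eproc C n (\<lambda>i. W i \<omega>)))"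
      by (rule asymptotic_equicontinuity[of "\<epsilon> / 6" 1]) (use \<epsilon> in auto)
    define L :: real where "L = 2 ^ m1"
    have L: "0 < L" by (simp add: L_def)
    then have L': "0 < 12 * L + 82" "0 < r / 2" using r by auto
    from cube_functionalE[OF \<Phi> this] obtain \<delta> where \<delta>: "0 < \<delta>" "\<And>h g. cube_measurable h \<Longrightarrow> cube_measurable g \<Longrightarrow>
       (\<And>x y z. x \<in> {0..1} \<Longrightarrow> y \<in> {0..1} \<Longrightarrow> z \<in> {0..1} \<Longrightarrow>
          \<bar>h x y z\<bar> \<le> 12 * L + 82 \<and> \<bar>g x y z\<bar> \<le> 12 * L + 82 \<and> \<bar>h x y z - g x y z\<bar> \<le> \<delta>) \<Longrightarrow>
       \<bar>\<Phi> h - \<Phi> g\<bar> \<le> r / 2" by blast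
    \<comment> \<open>94 = 82 + 12, from \<open>H_emp_asymp\<close> and from discretisation; the
      bound 1 ensures \<bar>\<open>H_emp\<close>\<bar> \<le> 12 L + 82.\<close>
    define \<eta> where "\<eta> = min 1 (\<delta> / 94)"
    have \<eta>: "0 < \<eta>" "\<eta> \<le> 1" "94 * \<eta> \<le> \<delta>" using \<delta>(1) by (auto simp: \<eta>_def)
    obtain m2 where m2: "\<forall>\<^sub>F n in sequentially. \<exists>A\<in>events. 1 - \<epsilon> / 6 \<le> prob A \<and>
        (\<forall>\<omega>\<in>A. osc_le (1 / 2^m2) \<eta> (eproc C n (\<lambda>i. W i \<omega>)))"
      by (rule asymptotic_equicontinuity[of "\<epsilon> / 6" \<eta>]) (use \<epsilon> \<eta> in auto)
    have "(\<lambda>m. N.expectation (\<lambda>\<omega>. \<phi> (Zm m \<omega>))) \<longlonglongrightarrow> N.expectation (\<lambda>\<omega>. \<phi> (Z \<omega>))"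
    proof (rule integral_dominated_convergence[where w="\<lambda>_. 1"])
      show "AE \<omega> in N. (\<lambda>m. \<phi> (Zm m \<omega>)) \<longlonglongrightarrow> \<phi> (Z \<omega>)"
        by (intro AE_I2 continuous_on_tendsto_compose[OF cont ZmZ]) auto
    qed (use \<phi>01 in auto)
    from tendstoD[OF this \<epsilon>] have "\<forall>\<^sub>F m in sequentially. dist (N.expectation (\<lambda>\<omega>. \<phi> (Zm m \<omega>))) (N.expectation (\<lambda>\<omega>. \<phi> (Z \<omega>))) < \<epsilon>" .
    from eventually_happens'[OF sequentially_bot eventually_conj[OF eventually_ge_at_top[of m2] this]]
    obtain m where m: "m2 \<le> m"
      "dist (N.expectation (\<lambda>\<omega>. \<phi> (Zm m \<omega>))) (N.expectation (\<lambda>\<omega>. \<phi> (Z \<omega>))) < \<epsilon>"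
      by blast
    have main: "\<forall>\<^sub>F n in sequentially. \<bar>expectation (\<lambda>\<omega>. \<phi> (Y n \<omega>)) - expectation (\<lambda>\<omega>. \<phi> (T m n \<omega>))\<bar> \<le> \<epsilon>"
      using m1 m2 H_emp_asymp[OF assoc \<eta>(1) _ L, of "1 / 2^m2", simplified]
    proof eventually_elim
      case (elim n)
      obtain A1 where A1: "A1 \<in> events" "1 - \<epsilon> / 6 \<le> prob A1" "\<And>\<omega>. \<omega> \<in> A1 \<Longrightarrow> osc_le (1 / 2^m1) 1 (eproc C n (\<lambda>i. W i \<omega>))"
        using elim(1) by blast
      obtain A2 where A2: "A2 \<in> events" "1 - \<epsilon> / 6 \<le> prob A2" "\<And>\<omega>. \<omega> \<in> A2 \<Longrightarrow> osc_le (1 / 2^m2) \<eta> (eproc C n (\<lambda>i. W i \<omega>))"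
        using elim(2) by blast
      have good: "\<bar>\<phi> (Y n \<omega>) - \<phi> (T m n \<omega>)\<bar> \<le> \<epsilon> / 3"
        if \<omega>: "\<omega> \<in> A1" "\<omega> \<in> A2" and gen: "generic_sample n (\<lambda>i. W i \<omega>)" "tied_down C (eproc C n (\<lambda>i. W i \<omega>))"
          and e: "emp_copula n (\<lambda>i. X i \<omega>) = emp_copula n (\<lambda>i. W i \<omega>)" for \<omega>
      proof -
        define b where "b = eproc C n (\<lambda>i. W i \<omega>)"
        have b00: "b (0, 0) = 0" using gen(2) by (auto simp: b_def tied_down_def)
        have "bounded_path (real (2 ^ m1) * 1) b"
          by (rule osc_le_bounded_path[OF A1(3)[OF \<omega>(1), folded b_def] b00]) auto
        then have bL: "bounded_path L b" by (simp add: L_def)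
        have bD: "bounded_path L (discretize m b)" by (rule bounded_path_discretize[OF bL])
        have diff: "bounded_path \<eta> (\<lambda>p. b p - discretize m b p)"
          by (rule osc_le_discretize[OF A2(3)[OF \<omega>(2), folded b_def] m(1)])
        have Hx: "H_emp n (\<lambda>i. X i \<omega>) = H_emp n (\<lambda>i. W i \<omega>)" using e by (simp add: fun_eq_iff H_emp_def)
        have "\<bar>\<Phi> (H_emp n (\<lambda>i. W i \<omega>)) - \<Phi> (H_lim C (discretize m b))\<bar> \<le> r / 2"
        proof (rule \<delta>(2))
          fix x y z :: real assume *: "x \<in> {0..1}" "y \<in> {0..1}" "z \<in> {0..1}"
          have 1: "\<bar>H_emp n (\<lambda>i. W i \<omega>) x y z - H_lim C b x y z\<bar> \<le> 82 * \<eta>"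
            using elim(3) gen A2(3)[OF \<omega>(2)] bL * unfolding b_def by auto
          have 2: "\<bar>H_lim C b x y z - H_lim C (discretize m b) x y z\<bar> \<le> 12 * \<eta>"
            unfolding H_lim_diff by (rule H_lim_abs_le[OF diff *])
          have 3: "\<bar>H_lim C b x y z\<bar> \<le> 12 * L" "\<bar>H_lim C (discretize m b) x y z\<bar> \<le> 12 * L"
            by (rule H_lim_abs_le[OF bL *] H_lim_abs_le[OF bD *])+
          show "\<bar>H_emp n (\<lambda>i. W i \<omega>) x y z\<bar> \<le> 12 * L + 82 \<and> \<bar>H_lim C (discretize m b) x y z\<bar> \<le> 12 * L + 82 \<and>
             \<bar>H_emp n (\<lambda>i. W i \<omega>) x y z - H_lim C (discretize m b) x y z\<bar> \<le> \<delta>"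
          proof (intro conjI)
            show "\<bar>H_emp n (\<lambda>i. W i \<omega>) x y z\<bar> \<le> 12 * L + 82" using 1 3(1) \<eta>(2) by linarith
            show "\<bar>H_lim C (discretize m b) x y z\<bar> \<le> 12 * L + 82" using 3(2) by linarith
            show "\<bar>H_emp n (\<lambda>i. W i \<omega>) x y z - H_lim C (discretize m b) x y z\<bar> \<le> \<delta>" using 1 2 \<eta>(3) by linarith
          qed
        qed (intro H_emp_cube_measurable H_lim_cube_measurable square_measurable_discretize)+
        then have "\<bar>Y n \<omega> - T m n \<omega>\<bar> < r" using r(1) unfolding Y_def T_def Hx b_def by linarith
        from r(2)[OF this] show ?thesis by simp
      qed
      \<comment> \<open>Off the good events the difference is only known to be at most 1. In
        expectation this costs at most \<epsilon>/6 for each of the two events, besides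
        \<epsilon>/3.\<close>
      have "AE \<omega> in M. \<bar>\<phi> (Y n \<omega>) - \<phi> (T m n \<omega>)\<bar> \<le> \<epsilon> / 3 + (indicator (space M - A1) \<omega> + indicator (space M - A2) \<omega>)"
        using AE_generic eq AE_space
      proof eventually_elim
        case (elim \<omega>)
        show ?case
        proof (cases "\<omega> \<in> A1 \<and> \<omega> \<in> A2")
          case True then show ?thesis using good elim by auto
        next
          case False
          have "\<bar>\<phi> (Y n \<omega>) - \<phi> (T m n \<omega>)\<bar> \<le> 1" using \<phi>01[of "Y n \<omega>"] \<phi>01[of "T m n \<omega>"] by linarith
          also have "1 \<le> indicat_real (space M - A1) \<omega> + indicat_real (space M - A2) \<omega>"
            using False elim by (auto simp: indicator_def)
          finally show ?thesis using \<epsilon> by linarith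
        qed
      qed
      then have "\<bar>expectation (\<lambda>\<omega>. \<phi> (Y n \<omega>)) - expectation (\<lambda>\<omega>. \<phi> (T m n \<omega>))\<bar>
          \<le> expectation (\<lambda>\<omega>. \<epsilon> / 3 + (indicator (space M - A1) \<omega> + indicator (space M - A2) \<omega>))"
      proof (rule abs_expectation_diff_le[rotated -1])
        show "integrable M (\<lambda>\<omega>. \<phi> (Y n \<omega>))" "integrable M (\<lambda>\<omega>. \<phi> (T m n \<omega>))"
          by (rule integrable_const_bound[of _ 1]; use \<phi>01 in simp)+
        show "integrable M (\<lambda>\<omega>. \<epsilon> / 3 + (indicat_real (space M - A1) \<omega> + indicat_real (space M - A2) \<omega>))"
          using A1(1) A2(1) by (intro Bochner_Integration.integrable_add integrable_const integrable_real_indicator) (auto simp: emeasure_eq_measure)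
      qed
      also have "\<dots> = \<epsilon> / 3 + (prob (space M - A1) + prob (space M - A2))"
        using A1(1) A2(1) by (simp add: prob_space emeasure_eq_measure Bochner_Integration.integral_add)
      also have "\<dots> \<le> \<epsilon> / 3 + (\<epsilon> / 6 + \<epsilon> / 6)"
        using A1(1,2) A2(1,2) by (simp add: prob_compl)
      also have "\<dots> \<le> \<epsilon>" using \<epsilon> by simp
      finally show ?case .
    qed
    define F where "F b = \<phi> (\<Phi> (H_lim C (discretize m b)))" for b
    have gcF: "grid_continuous (dyadic_grid m) F"
      unfolding F_def by (rule grid_continuous_compose[OF grid_continuous_functional[OF \<Phi>] cont])
    have "\<bar>F b\<bar> \<le> 1" for b using \<phi>01 by (simp add: F_def)
    from grid_expectation_conv[OF N B finite_dyadic_grid dyadic_grid_subset gcF this]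
    have "(\<lambda>n. expectation (\<lambda>\<omega>. \<phi> (T m n \<omega>))) \<longlonglongrightarrow> N.expectation (\<lambda>\<omega>. \<phi> (Zm m \<omega>))"
      by (simp add: F_def T_def Zm_def)
    with main m(2) show "\<exists>x' y'. (\<forall>\<^sub>F n in sequentially. \<bar>expectation (\<lambda>\<omega>. cts_step x y (Y n \<omega>)) - x' n\<bar> \<le> \<epsilon>) \<and>
       \<bar>N.expectation (\<lambda>\<omega>. cts_step x y (Z \<omega>)) - y'\<bar> \<le> \<epsilon> \<and> x' \<longlonglongrightarrow> y'"
      unfolding \<phi>_def dist_real_def
      by (intro exI[of _ "\<lambda>n. expectation (\<lambda>\<omega>. cts_step x y (T m n \<omega>))"] exI[of _ "N.expectation (\<lambda>\<omega>. cts_step x y (Zm m \<omega>))"])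
         (auto simp: abs_minus_commute less_imp_le)
  qed
  have "weak_conv_m (\<lambda>n. distr M borel (Y n)) (distr N borel Z)"
  proof (rule integral_cts_step_conv_imp_weak_conv)
    fix x y :: real assume xy: "x < y"
    have [measurable]: "cts_step x y \<in> borel_measurable borel"
      by (intro borel_measurable_continuous_onI uniformly_continuous_imp_continuous cts_step_uniformly_continuous xy)
    show "(\<lambda>n. integral\<^sup>L (distr M borel (Y n)) (cts_step x y)) \<longlonglongrightarrow> integral\<^sup>L (distr N borel Z) (cts_step x y)"
      using conv[OF xy] by (simp add: integral_distr)
  qed (auto intro: real_distribution_distr N.real_distribution_distr)
  then show ?thesis
    unfolding converges_weakly_def Y_def[symmetric] Z_def[symmetric] by (simp add: Y_def[abs_def, symmetric] Z_def[abs_def, symmetric])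
qed

end

section \<open>The two test statistics as functionals on the cube\<close>

lemma cube_functional_Sup:
  "cube_functional (\<lambda>h. SUP (x, y, z)\<in>{0..1} \<times> {0..1} \<times> {0..1}. \<bar>h x y z\<bar>)"
  unfolding cube_functional_def
proof (intro allI impI)
  fix L \<epsilon> :: real assume L: "0 < L" and \<epsilon>: "0 < \<epsilon>"
  let ?I = "{0..1::real} \<times> {0..1::real} \<times> {0..1::real}"
  let ?S = "\<lambda>h :: real \<Rightarrow> real \<Rightarrow> real \<Rightarrow> real. SUP (x, y, z)\<in>?I. \<bar>h x y z\<bar>"
  have le: "?S h \<le> ?S g + \<epsilon>" if "\<forall>x\<in>{0..1}. \<forall>y\<in>{0..1}. \<forall>z\<in>{0..1}. \<bar>g x y z\<bar> \<le> L \<and> \<bar>h x y z - g x y z\<bar> \<le> \<epsilon>" for h g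
  proof (rule cSUP_least)
    fix p assume p: "p \<in> ?I"
    obtain x y z where xyz: "p = (x, y, z)" "x \<in> {0..1}" "y \<in> {0..1}" "z \<in> {0..1}" using p by (cases p) auto
    have "bdd_above ((\<lambda>(x, y, z). \<bar>g x y z\<bar>) ` ?I)"
      using that by (intro bdd_aboveI2[of _ _ L]) auto
    from cSUP_upper[OF p this] have "\<bar>g x y z\<bar> \<le> ?S g" by (simp add: xyz(1))
    moreover have "\<bar>h x y z - g x y z\<bar> \<le> \<epsilon>" using that xyz by blast
    ultimately show "(case p of (x, y, z) \<Rightarrow> \<bar>h x y z\<bar>) \<le> ?S g + \<epsilon>" unfolding xyz(1) prod.case by linarith
  qed auto
  show "\<exists>\<delta>>0. \<forall>h g. cube_measurable h \<longrightarrow> cube_measurable g \<longrightarrow>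
     (\<forall>x\<in>{0..1}. \<forall>y\<in>{0..1}. \<forall>z\<in>{0..1}. \<bar>h x y z\<bar> \<le> L \<and> \<bar>g x y z\<bar> \<le> L \<and> \<bar>h x y z - g x y z\<bar> \<le> \<delta>) \<longrightarrow>
     \<bar>?S h - ?S g\<bar> \<le> \<epsilon>"
  \<comment> \<open>The supremum is 1-Lipschitz, so \<delta> = \<epsilon>; the bound
    \<open>L\<close> only makes the suprema finite.\<close>
  proof (intro exI[of _ \<epsilon>] conjI allI impI \<epsilon>)
    fix h g :: "real \<Rightarrow> real \<Rightarrow> real \<Rightarrow> real"
    assume *: "\<forall>x\<in>{0..1}. \<forall>y\<in>{0..1}. \<forall>z\<in>{0..1}. \<bar>h x y z\<bar> \<le> L \<and> \<bar>g x y z\<bar> \<le> L \<and> \<bar>h x y z - g x y z\<bar> \<le> \<epsilon>"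
    have "?S h \<le> ?S g + \<epsilon>" by (rule le) (use * in blast)
    moreover have "?S g \<le> ?S h + \<epsilon>" by (rule le) (use * in \<open>simp add: abs_minus_commute\<close>)
    ultimately show "\<bar>?S h - ?S g\<bar> \<le> \<epsilon>" by linarith
  qed
qed

lemma cube_functional_square_integral:
  "cube_functional (\<lambda>h. LINT (x, y, z):{0..1} \<times> {0..1} \<times> {0..1}|lborel. (h x y z)\<^sup>2)"
  unfolding cube_functional_def
proof (intro allI impI)
  fix L \<epsilon> :: real assume L: "0 < L" and \<epsilon>: "0 < \<epsilon>"
  let ?I = "{0..1::real} \<times> {0..1::real} \<times> {0..1::real}"
  let ?S = "\<lambda>h :: real \<Rightarrow> real \<Rightarrow> real \<Rightarrow> real. LINT (x, y, z):?I|lborel. (h x y z)\<^sup>2"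
  have I_cbox: "?I = cbox (0, 0, 0) (1, 1, 1)" by (simp add: cbox_Pair_eq)
  have I_fin: "emeasure lborel ?I < \<infinity>" unfolding I_cbox by (rule emeasure_lborel_cbox_finite)
  have I_meas: "measure lborel ?I = 1" unfolding I_cbox by (simp add: content_Pair)
  have I_sets[measurable]: "?I \<in> sets borel" unfolding I_cbox by simp
  define F where "F h p = indicator ?I p * (case p of (x, y, z) \<Rightarrow> (h x y z)\<^sup>2)" for h :: "real \<Rightarrow> real \<Rightarrow> real \<Rightarrow> real" and p
  have S: "?S h = (\<integral>p. F h p \<partial>lborel)" for h by (simp add: set_lebesgue_integral_def F_def)
  have I_int: "integrable lborel (\<lambda>p. c * indicator ?I p)" for c :: real
    using I_fin by (intro integrable_mult_right integrable_real_indicator) auto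
  have F_int: "integrable lborel (F h)" if h: "cube_measurable h" and hL: "\<forall>x\<in>{0..1}. \<forall>y\<in>{0..1}. \<forall>z\<in>{0..1}. \<bar>h x y z\<bar> \<le> L" for h
  proof (rule Bochner_Integration.integrable_bound[OF I_int[of "L\<^sup>2"]])
    have [measurable]: "(\<lambda>p. h (unit_clamp (fst p)) (unit_clamp (fst (snd p))) (unit_clamp (snd (snd p)))) \<in> borel_measurable borel"
      using h by (simp add: cube_measurable_def)
    have "(\<lambda>p. indicator ?I p * (h (unit_clamp (fst p)) (unit_clamp (fst (snd p))) (unit_clamp (snd (snd p))))\<^sup>2) \<in> borel_measurable borel"
      by (intro borel_measurable_times borel_measurable_indicator borel_measurable_power I_sets) measurable
    also have "(\<lambda>p. indicator ?I p * (h (unit_clamp (fst p)) (unit_clamp (fst (snd p))) (unit_clamp (snd (snd p))))\<^sup>2) = F h"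
      by (auto simp: F_def fun_eq_iff indicator_def)
    finally show "F h \<in> borel_measurable lborel" by simp
    show "AE p in lborel. norm (F h p) \<le> norm (L\<^sup>2 * indicat_real ?I p)"
    proof (intro AE_I2)
      fix p :: "real \<times> real \<times> real"
      have "(h x y z)\<^sup>2 \<le> L\<^sup>2" if "x \<in> {0..1}" "y \<in> {0..1}" "z \<in> {0..1}" for x y z
        using hL that L by (metis abs_le_square_iff abs_of_pos)
      then show "norm (F h p) \<le> norm (L\<^sup>2 * indicat_real ?I p)" by (auto simp: F_def indicator_def)
    qed
  qed
  show "\<exists>\<delta>>0. \<forall>h g. cube_measurable h \<longrightarrow> cube_measurable g \<longrightarrow>
     (\<forall>x\<in>{0..1}. \<forall>y\<in>{0..1}. \<forall>z\<in>{0..1}. \<bar>h x y z\<bar> \<le> L \<and> \<bar>g x y z\<bar> \<le> L \<and> \<bar>h x y z - g x y z\<bar> \<le> \<delta>) \<longrightarrow>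
     \<bar>?S h - ?S g\<bar> \<le> \<epsilon>"
  \<comment> \<open>The difference of squares is at most 2 L times the difference, and the cube has
    volume 1.\<close>
  proof (intro exI[of _ "\<epsilon> / (2 * L)"] conjI allI impI)
    fix h g :: "real \<Rightarrow> real \<Rightarrow> real \<Rightarrow> real"
    assume hg: "cube_measurable h" "cube_measurable g" and
      *: "\<forall>x\<in>{0..1}. \<forall>y\<in>{0..1}. \<forall>z\<in>{0..1}. \<bar>h x y z\<bar> \<le> L \<and> \<bar>g x y z\<bar> \<le> L \<and> \<bar>h x y z - g x y z\<bar> \<le> \<epsilon> / (2 * L)"
    have int: "integrable lborel (F h)" "integrable lborel (F g)" by (rule F_int; use hg * in blast)+
    have pt: "\<bar>F h p - F g p\<bar> \<le> \<epsilon> * indicator ?I p" for p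
    proof (cases "p \<in> ?I")
      case True
      then obtain x y z where xyz: "p = (x, y, z)" "x \<in> {0..1}" "y \<in> {0..1}" "z \<in> {0..1}" by (cases p) auto
      have b: "\<bar>h x y z\<bar> \<le> L" "\<bar>g x y z\<bar> \<le> L" "\<bar>h x y z - g x y z\<bar> \<le> \<epsilon> / (2 * L)" using * xyz by blast+
      have "\<bar>(h x y z)\<^sup>2 - (g x y z)\<^sup>2\<bar> = \<bar>h x y z - g x y z\<bar> * \<bar>h x y z + g x y z\<bar>"
        by (simp add: power2_eq_square algebra_simps flip: abs_mult)
      also have "\<dots> \<le> \<epsilon> / (2 * L) * (2 * L)" using b L \<epsilon> by (intro mult_mono) auto
      also have "\<dots> = \<epsilon>" using L by simp
      finally show ?thesis using True by (simp add: F_def xyz(1))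
    qed (auto simp: F_def)
    have "\<bar>?S h - ?S g\<bar> = \<bar>\<integral>p. F h p - F g p \<partial>lborel\<bar>" unfolding S using int by (simp add: Bochner_Integration.integral_diff)
    also have "\<dots> \<le> (\<integral>p. \<bar>F h p - F g p\<bar> \<partial>lborel)" by (rule integral_abs_bound)
    also have "\<dots> \<le> (\<integral>p. \<epsilon> * indicator ?I p \<partial>lborel)"
      by (intro integral_mono I_int integrable_abs Bochner_Integration.integrable_diff int pt)
    also have "\<dots> = \<epsilon>" using I_fin I_meas by simp
    finally show "\<bar>?S h - ?S g\<bar> \<le> \<epsilon>" .
  qed (use L \<epsilon> in auto)
qed

section \<open>The marginal probability transform\<close>

lemma (in real_distribution) continuous_cdf_quantile:
  assumes cont: "continuous_on UNIV (cdf M)" and u: "0 < u" "u < 1"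
  obtains s where "\<And>y. cdf M y \<le> u \<longleftrightarrow> y \<le> s" "cdf M s = u"
proof -
  obtain a where a: "cdf M a < u"
    using order_tendstoD(2)[OF cdf_lim_at_bot u(1)] by (auto simp: eventually_at_bot_linorder)
  obtain b where b: "u < cdf M b"
    using order_tendstoD(1)[OF cdf_lim_at_top_prob u(2)] by (auto simp: eventually_at_top_linorder)
  define S where "S = {y. cdf M y \<le> u}"
  have clo: "closed S" unfolding S_def by (rule closed_Collect_le[OF cont]) simp
  have Sb: "y \<le> b" if "y \<in> S" for y
    using that b cdf_nondecreasing[of b y] by (force simp: S_def)
  have bdd: "bdd_above S" using Sb by (auto simp: bdd_above_def)
  have ne: "S \<noteq> {}" using a by (auto simp: S_def intro!: exI[of _ a])
  define s where "s = Sup S"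
  \<comment> \<open>\<open>s\<close> is the largest point where the distribution function is at most
    \<open>u\<close>, so the sublevel set is a half-line even if the function is flat at this
    height.\<close>
  have sS: "s \<in> S" unfolding s_def by (rule closed_contains_Sup[OF ne bdd clo])
  have iff: "cdf M y \<le> u \<longleftrightarrow> y \<le> s" for y
  proof
    assume "cdf M y \<le> u" then show "y \<le> s" unfolding s_def by (intro cSup_upper bdd) (simp add: S_def)
  next
    assume "y \<le> s" then show "cdf M y \<le> u" using cdf_nondecreasing[of y s] sS by (simp add: S_def)
  qed
  have "continuous_on {s..b} (cdf M)" by (rule continuous_on_subset[OF cont]) auto
  then have "\<exists>x\<ge>s. x \<le> b \<and> cdf M x = u"
    by (intro IVT') (use sS Sb b in \<open>auto simp: S_def\<close>)
  then obtain x where "s \<le> x" "cdf M x = u" by auto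
  with iff[of x] have "cdf M s = u" by auto
  with iff show ?thesis using that by blast
qed

text \<open>For 0 < u < 1 the event is a half-line ending at the quantile. At 0 a quantile need not
  exist, and the mass is squeezed below every positive level; at 1 the event is everything.\<close>

lemma (in real_distribution) prob_continuous_cdf_le:
  assumes cont: "continuous_on UNIV (cdf M)" and u: "u \<in> {0..1}"
  shows "measure M {y. cdf M y \<le> u} = u"
proof -
  have mid: "measure M {y. cdf M y \<le> t} = t" if t01: "0 < t" "t < 1" for t
  proof -
    obtain s where s: "\<And>y. cdf M y \<le> t \<longleftrightarrow> y \<le> s" "cdf M s = t"
      by (rule continuous_cdf_quantile[OF cont t01]) blast
    have "{y. cdf M y \<le> t} = {..s}" using s(1) by auto
    then show ?thesis using s(2) by (simp add: cdf_def)
  qed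
  consider "u = 0" | "u = 1" | "0 < u" "u < 1" using u by fastforce
  then show ?thesis
  proof cases
    case 1
    have "closed {y. cdf M y \<le> t}" for t by (rule closed_Collect_le[OF cont]) simp
    then have sets: "{y. cdf M y \<le> t} \<in> sets M" for t by simp
    have "measure M {y. cdf M y \<le> 0} \<le> 0 + e" if e: "0 < e" for e
    proof -
      have "measure M {y. cdf M y \<le> 0} \<le> measure M {y. cdf M y \<le> min e (1/2)}"
        using e by (intro finite_measure_mono sets) auto
      also have "\<dots> = min e (1/2)" using e by (intro mid) auto
      finally show ?thesis by simp
    qed
    then have "measure M {y. cdf M y \<le> 0} \<le> 0" by (rule field_le_epsilon)
    then have "measure M {y. cdf M y \<le> 0} = 0" using measure_nonneg[of M "{y. cdf M y \<le> 0}"] by linarith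
    then show ?thesis using 1 by simp
  next
    case 2
    have "{y. cdf M y \<le> 1} = space M" using cdf_bounded_prob by auto
    then show ?thesis using 2 prob_space by simp
  qed (rule mid)
qed

text \<open>For interior (u, v) the event is a quadrant with corner at the two quantiles, and
  \<open>copula_of\<close> evaluates its mass. If a coordinate is 0 or 1, where quantiles may fail
  to exist, the uniform margins give the value.\<close>

lemma prob_transform_copula:
  fixes \<mu> :: "(real \<times> real) measure"
  assumes "prob_space \<mu>" and sets[measurable_cong]: "sets \<mu> = sets borel"
    and cont: "continuous_on UNIV (cdf (distr \<mu> borel fst))" "continuous_on UNIV (cdf (distr \<mu> borel snd))"
    and C: "copula_of \<mu> C" and u: "u \<in> {0..1}" and v: "v \<in> {0..1}"
  shows "measure \<mu> {p. cdf (distr \<mu> borel fst) (fst p) \<le> u \<and> cdf (distr \<mu> borel snd) (snd p) \<le> v} = C u v"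
proof -
  interpret prob_space \<mu> by fact
  have sp: "space \<mu> = UNIV" using sets_eq_imp_space_eq[OF sets] by simp
  have [measurable]: "fst \<in> measurable \<mu> (borel :: real measure)" "snd \<in> measurable \<mu> (borel :: real measure)"
    by (simp_all add: measurable_cong_sets[OF sets refl])
  define F1 F2 where "F1 = cdf (distr \<mu> borel fst)" and "F2 = cdf (distr \<mu> borel snd)"
  interpret D1: real_distribution "distr \<mu> borel fst" by (rule real_distribution_distr) measurable
  interpret D2: real_distribution "distr \<mu> borel snd" by (rule real_distribution_distr) measurable
  have [measurable]: "F1 \<in> borel_measurable borel" "F2 \<in> borel_measurable borel"
    unfolding F1_def F2_def using cont by (auto intro: borel_measurable_continuous_onI)
  have cop: "copula C" using C by (simp add: copula_of_def)
  interpret copula_fun C by unfold_locales (rule cop)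
  have marg1: "prob {p. F1 (fst p) \<le> t} = t" if "t \<in> {0..1}" for t
    using D1.prob_continuous_cdf_le[OF cont(1) that] unfolding F1_def[symmetric]
    by (subst (asm) measure_distr) (auto simp: sp vimage_def)
  have marg2: "prob {p. F2 (snd p) \<le> t} = t" if "t \<in> {0..1}" for t
    using D2.prob_continuous_cdf_le[OF cont(2) that] unfolding F2_def[symmetric]
    by (subst (asm) measure_distr) (auto simp: sp vimage_def)
  have ev: "{p. F1 (fst p) \<le> t} \<in> events" "{p. F2 (snd p) \<le> t} \<in> events" for t
  proof -
    have "{p \<in> space \<mu>. F1 (fst p) \<le> t} \<in> events" "{p \<in> space \<mu>. F2 (snd p) \<le> t} \<in> events" by measurable
    then show "{p. F1 (fst p) \<le> t} \<in> events" "{p. F2 (snd p) \<le> t} \<in> events" by (simp_all add: sp)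
  qed
  let ?P = "prob {p. F1 (fst p) \<le> u \<and> F2 (snd p) \<le> v}"
  have le: "?P \<le> u" "?P \<le> v"
    using finite_measure_mono[of "{p. F1 (fst p) \<le> u \<and> F2 (snd p) \<le> v}" "{p. F1 (fst p) \<le> u}"]
      finite_measure_mono[of "{p. F1 (fst p) \<le> u \<and> F2 (snd p) \<le> v}" "{p. F2 (snd p) \<le> v}"] ev marg1[OF u] marg2[OF v]
    by auto
  have le1: "F1 t \<le> 1" "F2 t \<le> 1" for t
    unfolding F1_def F2_def by (rule D1.cdf_bounded_prob D2.cdf_bounded_prob)+
  consider "u = 0" | "v = 0" | "u = 1" | "v = 1" | "0 < u" "u < 1" "0 < v" "v < 1" using u v by fastforce
  then have "?P = C u v"
  proof cases
    case 1 then show ?thesis using le(1) v measure_nonneg[of \<mu>] by (simp add: order_antisym)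
  next
    case 2 then show ?thesis using le(2) u measure_nonneg[of \<mu>] by (simp add: order_antisym)
  next
    case 3 then show ?thesis using marg2[OF v] v le1 by simp
  next
    case 4 then show ?thesis using marg1[OF u] u le1 by simp
  next
    case 5
    obtain s where s: "\<And>y. F1 y \<le> u \<longleftrightarrow> y \<le> s" "F1 s = u"
      unfolding F1_def by (rule D1.continuous_cdf_quantile[OF cont(1) 5(1,2)]) blast
    obtain t where t: "\<And>y. F2 y \<le> v \<longleftrightarrow> y \<le> t" "F2 t = v"
      unfolding F2_def by (rule D2.continuous_cdf_quantile[OF cont(2) 5(3,4)]) blast
    have "{p. F1 (fst p) \<le> u \<and> F2 (snd p) \<le> v} = {..s} \<times> {..t}" using s(1) t(1) by auto
    then have "?P = joint_cdf \<mu> s t" by (simp add: joint_cdf_def)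
    also have "\<dots> = C u v" using C s(2) t(2) by (simp add: copula_of_def F1_def F2_def)
    finally show ?thesis .
  qed
  then show ?thesis by (simp add: F1_def F2_def)
qed

theorem mainTheorem3:
  fixes M :: "'a measure" and X :: "nat \<Rightarrow> 'a \<Rightarrow> real \<times> real"
    and \<mu> :: "(real \<times> real) measure" and C :: "real \<Rightarrow> real \<Rightarrow> real"
    and N :: "'b measure" and B :: "real \<times> real \<Rightarrow> 'b \<Rightarrow> real"
  assumes "prob_space M"
    and "prob_space.indep_vars M (\<lambda>_. borel) X UNIV"
    and "\<And>i. distr M borel (X i) = \<mu>"
    and "continuous_on UNIV (\<lambda>(x1, x2). joint_cdf \<mu> x1 x2)"
    and "continuous_on UNIV (cdf (distr \<mu> borel fst))"
    and "continuous_on UNIV (cdf (distr \<mu> borel snd))"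
    and "copula_of \<mu> C"
    and "\<And>x y z. x \<in> {0..1} \<Longrightarrow> y \<in> {0..1} \<Longrightarrow> z \<in> {0..1} \<Longrightarrow> C x (C y z) = C (C x y) z"
    and "\<And>u v. u \<in> {0<..<1} \<Longrightarrow> v \<in> {0..1} \<Longrightarrow> (\<lambda>t. C t v) differentiable (at u)"
    and "continuous_on ({0<..<1} \<times> {0..1}) (\<lambda>(u, v). dC1 C u v)"
    and "\<And>u v. u \<in> {0..1} \<Longrightarrow> v \<in> {0<..<1} \<Longrightarrow> (\<lambda>t. C u t) differentiable (at v)"
    and "continuous_on ({0..1} \<times> {0<..<1}) (\<lambda>(u, v). dC2 C u v)"
    and "prob_space N"
    and "C_bridge N C B"
  shows "converges_weakly
           M (\<lambda>n \<omega>. LINT (x, y, z):{0..1} \<times> {0..1} \<times> {0..1}|lborel.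
                 (H_emp n (\<lambda>i. X i \<omega>) x y z)\<^sup>2)
           N (\<lambda>\<omega>. LINT (x, y, z):{0..1} \<times> {0..1} \<times> {0..1}|lborel.
                 (H_lim C (\<lambda>u. B u \<omega>) x y z)\<^sup>2)
       \<and> converges_weakly
           M (\<lambda>n \<omega>. SUP (x, y, z)\<in>{0..1} \<times> {0..1} \<times> {0..1}. \<bar>H_emp n (\<lambda>i. X i \<omega>) x y z\<bar>)
           N (\<lambda>\<omega>. SUP (x, y, z)\<in>{0..1} \<times> {0..1} \<times> {0..1}. \<bar>H_lim C (\<lambda>u. B u \<omega>) x y z\<bar>)"
proof -
  interpret M: prob_space M by fact
  have X[measurable]: "X i \<in> borel_measurable M" for i using assms(2) by (auto simp: M.indep_vars_def)
  have \<mu>: "prob_space \<mu>" "sets \<mu> = sets borel"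
    using M.prob_space_distr[OF X, of 0] assms(3)[of 0] by auto
  define F1 F2 where "F1 = cdf (distr \<mu> borel fst)" and "F2 = cdf (distr \<mu> borel snd)"
  have [measurable]: "F1 \<in> borel_measurable borel" "F2 \<in> borel_measurable borel"
    unfolding F1_def F2_def using assms(5,6) by (auto intro: borel_measurable_continuous_onI)
  have mono_F: "mono F1" "mono F2"
  proof -
    interpret \<mu>: prob_space \<mu> by (rule \<mu>)
    have [measurable]: "fst \<in> measurable \<mu> (borel :: real measure)" "snd \<in> measurable \<mu> (borel :: real measure)"
      by (simp_all add: measurable_cong_sets[OF \<mu>(2) refl])
    interpret D1: real_distribution "distr \<mu> borel fst" by (rule \<mu>.real_distribution_distr) measurable
    interpret D2: real_distribution "distr \<mu> borel snd" by (rule \<mu>.real_distribution_distr) measurable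
    show "mono F1" "mono F2" unfolding F1_def F2_def by (auto intro!: monoI D1.cdf_nondecreasing D2.cdf_nondecreasing)
  qed
  define h where "h p = (F1 (fst p), F2 (snd p))" for p :: "real \<times> real"
  have h[measurable]: "h \<in> measurable borel borel" unfolding h_def by (intro borel_measurable_Pair) measurable
  define W where "W i \<omega> = h (X i \<omega>)" for i \<omega>
  have cop: "copula C" using assms(7) by (simp add: copula_of_def)
  interpret copula_fun C by unfold_locales (rule cop)
  have cont2: "continuous_on ({0<..<1} \<times> {0..1}) (\<lambda>(u, v). dC1 (\<lambda>u v. C v u) u v)"
  proof -
    have "continuous_on ({0<..<1} \<times> {0..1}) (\<lambda>p. (\<lambda>(u, v). dC2 C u v) (snd p, fst p))"
      by (intro continuous_on_compose2[OF assms(12)] continuous_intros) auto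
    also have "(\<lambda>p. (\<lambda>(u, v). dC2 C u v) (snd p, fst p)) = (\<lambda>(u, v). dC1 (\<lambda>u v. C v u) u v)"
      by (auto simp: fun_eq_iff dC1_def dC2_def)
    finally show ?thesis .
  qed
  interpret smooth_copula_sample M C W
  proof (unfold_locales)
    show "M.indep_vars (\<lambda>_. borel) W UNIV"
      unfolding W_def by (rule M.indep_vars_compose2[OF assms(2)]) auto
    fix i j
    have "distr (distr M borel (X i)) borel h = distr (distr M borel (X j)) borel h" by (simp add: assms(3))
    then show "distr M borel (W i) = distr M borel (W j)" by (simp add: distr_distr comp_def W_def[abs_def])
  next
    fix u v :: real and i assume uv: "u \<in> {0..1}" "v \<in> {0..1}"
    have "C u v = measure (distr M borel (X i)) {p. F1 (fst p) \<le> u \<and> F2 (snd p) \<le> v}"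
      using prob_transform_copula[OF \<mu> assms(5,6,7) uv] by (simp add: F1_def F2_def assms(3))
    also have "\<dots> = M.prob {\<omega> \<in> space M. fst (W i \<omega>) \<le> u \<and> snd (W i \<omega>) \<le> v}"
    proof (subst measure_distr)
      have "{p \<in> space borel. F1 (fst p) \<le> u \<and> F2 (snd p) \<le> v} \<in> sets (borel :: (real \<times> real) measure)" by measurable
      then show "{p. F1 (fst p) \<le> u \<and> F2 (snd p) \<le> v} \<in> sets borel" by simp
    qed (auto simp: W_def h_def intro!: arg_cong[where f=M.prob])
    finally show "M.prob {\<omega> \<in> space M. fst (W i \<omega>) \<le> u \<and> snd (W i \<omega>) \<le> v} = C u v" by simp
  qed (use assms cop swap cont2 in auto)
  have same: "AE \<omega> in M. \<forall>n. emp_copula n (\<lambda>i. X i \<omega>) = emp_copula n (\<lambda>i. W i \<omega>)"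
    using AE_generic
  proof eventually_elim
    case (elim \<omega>)
    \<comment> \<open>A marginal distribution function may be flat, but the transformed values are
      almost surely distinct, so on the sample it preserves strict order in both directions.\<close>
    have lt: "x < y \<longleftrightarrow> f x < f y" if "mono f" "x \<noteq> y \<Longrightarrow> f x \<noteq> f y" for f :: "real \<Rightarrow> real" and x y
      using that monoD[OF that(1), of x y] monoD[OF that(1), of y x] by (cases x y rule: linorder_cases) auto
    show ?case
    proof
      fix n
      have inj: "inj_on (fst \<circ> (\<lambda>i. W i \<omega>)) {..<n}" "inj_on (snd \<circ> (\<lambda>i. W i \<omega>)) {..<n}"
        using elim by (auto simp: generic_sample_def)
      show "emp_copula n (\<lambda>i. X i \<omega>) = emp_copula n (\<lambda>i. W i \<omega>)"
      proof (rule emp_copula_cong_order)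
        fix i j assume ij: "i < n" "j < n"
        show "fst (X i \<omega>) < fst (X j \<omega>) \<longleftrightarrow> fst (W i \<omega>) < fst (W j \<omega>)"
          using lt[OF mono_F(1), of "fst (X i \<omega>)" "fst (X j \<omega>)"] inj_onD[OF inj(1), of i j] ij by (auto simp: W_def h_def)
        show "snd (X i \<omega>) < snd (X j \<omega>) \<longleftrightarrow> snd (W i \<omega>) < snd (W j \<omega>)"
          using lt[OF mono_F(2), of "snd (X i \<omega>)" "snd (X j \<omega>)"] inj_onD[OF inj(2), of i j] ij by (auto simp: W_def h_def)
      qed
    qed
  qed
  have clt: "converges_weakly M (\<lambda>n \<omega>. \<Phi> (H_emp n (\<lambda>i. X i \<omega>))) N (\<lambda>\<omega>. \<Phi> (H_lim C (\<lambda>u. B u \<omega>)))"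
    if "cube_functional \<Phi>" for \<Phi>
    by (rule functional_clt[OF _ assms(13,14) that X same]) (rule assms(8))
  show ?thesis
    using clt[OF cube_functional_square_integral] clt[OF cube_functional_Sup] by blast
qed

end
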